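(* Let $d \geq 2$ and write $d = 2^n r$ with $r$ odd. Take $\mathcal{Q} = C_2^{n} \times C_r$ and $\mathcal{P} = \mathcal{Q} \rtimes \mathrm{Aut}(\mathcal{Q})$. Then $\mathcal{Q}$ and $\mathcal{P}$ can be embedded in $\mathrm{Sym}(d)$ (with $\mathcal{Q} \lhd \mathcal{P} \le \mathrm{Sym}(d)$) such that $\mathcal{Q}$ acts transitively on $\{1,\dots,d\}$, and consequently $G_{\mathcal{Q}}^{\mathcal{P}}$ is regular branch, its Hausdorff dimension equals $$\mathcal{H}(G_{\mathcal{Q}}^{\mathcal{P}}) = \frac{\log(d)}{\log(d!)},$$ and its fixed-point proportion is $$\mathrm{FPP}(G_{\mathcal{Q}}^{\mathcal{P}}) = \frac{\# \{A \in \mathrm{GL}_n(\mathbb{F}_2) : A-1 \in \mathrm{GL}_n(\mathbb{F}_2)\}}{|\mathrm{GL}_n(\mathbb{F}_2)|} \prod_{p \text{ prime},\, p \mid r} \left( \frac{p - 2}{p - 1} \right).$$ When $d \not\equiv 2 \pmod{4}$, the fixed-point proportion is positive.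
   Context: $C_m$ denotes the cyclic group of order $m$; $\mathbb{F}_2$ is the field with two elements; for $n=0$ the group $\mathrm{GL}_0(\mathbb{F}_2)$ is trivial and the first factor equals $1$. $T$ is the $d$-regular rooted tree, identified with the set of finite words over $\{1,\dots,d\}$; $\mathcal{L}_n$ is its $n$-th level and $\mathrm{Aut}(T)$ is the group of bijections of $T$ fixing the root and preserving adjacency. $\mathrm{St}(n)$ is the pointwise stabilizer of $\mathcal{L}_n$ and $\pi_n : \mathrm{Aut}(T) \to \mathrm{Aut}(T)/\mathrm{St}(n)$ the projection. For $g \in \mathrm{Aut}(T)$ and $v \in T$, the section $g|_v \in \mathrm{Aut}(T)$ is defined by $g(vw)=g(v)\,g|_v(w)$ for all words $w$, and the label $g|_v^1 \in \mathrm{Sym}(d)$ is the permutation of $\{1,\dots,d\}$ induced by $g|_v$ on the first level. For subgroups $1 \ne \mathcal{Q} \lhd \mathcal{P} \le \mathrm{Sym}(d)$, $$G_{\mathcal{Q}}^{\mathcal{P}} = \{g \in \mathrm{Aut}(T) : g|_v^1 \in \mathcal{P} \text{ and } (g|_v^1)(g|_w^1)^{-1} \in \mathcal{Q} \text{ for all } v,w \in T\},$$ which is a subgroup of $\mathrm{Aut}(T)$. For a subgroup $G \le \mathrm{Aut}(T)$: $$\mathrm{FPP}(G) = \lim_{n\to\infty} \frac{\#\{g \in \pi_n(G) : g \text{ fixes a vertex in } \mathcal{L}_n\}}{|\pi_n(G)|}, \qquad \mathcal{H}(G) = \liminf_{n\to\infty} \frac{\log|\pi_n(G)|}{\log|\pi_n(\mathrm{Aut}(T))|}.$$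 $G$ is level-transitive if it acts transitively on every $\mathcal{L}_n$. For a subgroup $B \le \mathrm{Aut}(T)$, put $B_1 = \{g \in \mathrm{St}(1) : g|_v \in B \text{ for all } v \in \mathcal{L}_1\}$. $G$ is regular branch if it is level-transitive and there is a subgroup $B$ of $G$ such that $B_1$ is a finite-index subgroup of $B$ and $B$ is a finite-index subgroup of $G$. *)

theory Defs
  imports
    Complex_Main
    "HOL-Library.Extended_Real"
    "HOL-Library.Z2"
    "HOL-Computational_Algebra.Primes"
    "HOL-Algebra.Bij"
    "HOL-Algebra.Coset"
    "HOL-Algebra.Elementary_Groups"
    "HOL-Algebra.Product_Groups"
    "HOL-Algebra.Sym_Groups"
    "Jordan_Normal_Form.Matrix"
begin

section \<open>The regular rooted tree and its automorphism group\<close>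

definition tree :: "nat \<Rightarrow> nat list set" where
  "tree d = lists {1..d}"

definition level :: "nat \<Rightarrow> nat \<Rightarrow> nat list set" where
  "level d n = {v \<in> tree d. length v = n}"

definition adjacent :: "nat list \<Rightarrow> nat list \<Rightarrow> bool" where
  "adjacent u v \<longleftrightarrow> (\<exists>x. v = u @ [x] \<or> u = v @ [x])"

text \<open>As in \<^const>\<open>sym_group\<close>, an automorphism is extended by the identity outside the tree, so
  that distinct automorphisms are distinct functions.\<close>

definition AutT :: "nat \<Rightarrow> (nat list \<Rightarrow> nat list) monoid" where
  "AutT d = \<lparr>carrier = {g. g permutes tree d \<and> g [] = [] \<and>
                 (\<forall>u\<in>tree d. \<forall>v\<in>tree d. adjacent (g u) (g v) \<longleftrightarrow> adjacent u v)},
             mult = (\<circ>), one = id\<rparr>"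

text \<open>The first \<^term>\<open>length v\<close> letters of \<^term>\<open>g (v @ w)\<close> form the word \<^term>\<open>g v\<close>; see
  \<open>section_at_eq\<close> below.\<close>

definition section_at :: "nat \<Rightarrow> (nat list \<Rightarrow> nat list) \<Rightarrow> nat list \<Rightarrow> nat list \<Rightarrow> nat list" where
  "section_at d g v = (\<lambda>w. if w \<in> tree d then drop (length v) (g (v @ w)) else w)"

definition label :: "nat \<Rightarrow> (nat list \<Rightarrow> nat list) \<Rightarrow> nat list \<Rightarrow> nat \<Rightarrow> nat" where
  "label d g v = (\<lambda>x. if x \<in> {1..d} then hd (section_at d g v [x]) else x)"

definition level_stabilizer :: "nat \<Rightarrow> nat \<Rightarrow> (nat list \<Rightarrow> nat list) set" where
  "level_stabilizer d n = {g \<in> carrier (AutT d). \<forall>v\<in>level d n. g v = v}"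

text \<open>The projection \<open>\<pi>\<^sub>n\<close> onto the quotient by the (normal) level stabilizer.\<close>

definition level_proj :: "nat \<Rightarrow> nat \<Rightarrow> (nat list \<Rightarrow> nat list) \<Rightarrow> (nat list \<Rightarrow> nat list) set" where
  "level_proj d n g = level_stabilizer d n #>\<^bsub>AutT d\<^esub> g"

definition GQP :: "nat \<Rightarrow> (nat \<Rightarrow> nat) set \<Rightarrow> (nat \<Rightarrow> nat) set \<Rightarrow> (nat list \<Rightarrow> nat list) set" where
  "GQP d Q P = {g \<in> carrier (AutT d).
     (\<forall>v\<in>tree d. label d g v \<in> P) \<and>
     (\<forall>v\<in>tree d. \<forall>w\<in>tree d.
        label d g v \<otimes>\<^bsub>sym_group d\<^esub> inv\<^bsub>sym_group d\<^esub> (label d g w) \<in> Q)}"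


section \<open>Fixed-point proportion, Hausdorff dimension, regular branch groups\<close>

text \<open>All representatives of an element of the quotient by the \<open>n\<close>-th level stabilizer agree on
  level \<open>n\<close>, so quantifying over all of them is the action of the quotient on that level.\<close>

definition fpp_seq :: "nat \<Rightarrow> (nat list \<Rightarrow> nat list) set \<Rightarrow> nat \<Rightarrow> real" where
  "fpp_seq d G n =
     real (card {C \<in> level_proj d n ` G. \<exists>v\<in>level d n. \<forall>g\<in>C. g v = v}) /
     real (card (level_proj d n ` G))"

text \<open>\<^const>\<open>lim\<close> is meaningful only for convergent sequences; a claim about the value of
  \<open>FPP\<close> should come with \<^term>\<open>convergent (fpp_seq d G)\<close>.\<close>

definition FPP :: "nat \<Rightarrow> (nat list \<Rightarrow> nat list) set \<Rightarrow> real" where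
  "FPP d G = lim (fpp_seq d G)"

definition hausdorff_dim :: "nat \<Rightarrow> (nat list \<Rightarrow> nat list) set \<Rightarrow> ereal" where
  "hausdorff_dim d G =
     liminf (\<lambda>n. ereal (ln (real (card (level_proj d n ` G))) /
                        ln (real (card (level_proj d n ` carrier (AutT d))))))"

definition transitive_on :: "('a \<Rightarrow> 'a) set \<Rightarrow> 'a set \<Rightarrow> bool" where
  "transitive_on G X \<longleftrightarrow> (\<forall>x\<in>X. \<forall>y\<in>X. \<exists>g\<in>G. g x = y)"

definition level_transitive :: "nat \<Rightarrow> (nat list \<Rightarrow> nat list) set \<Rightarrow> bool" where
  "level_transitive d G \<longleftrightarrow> (\<forall>n. transitive_on G (level d n))"

definition finite_index_subgroup :: "('a, 'b) monoid_scheme \<Rightarrow> 'a set \<Rightarrow> 'a set \<Rightarrow> bool" where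
  "finite_index_subgroup A H K \<longleftrightarrow>
     subgroup H (A\<lparr>carrier := K\<rparr>) \<and> finite (rcosets\<^bsub>A\<lparr>carrier := K\<rparr>\<^esub> H)"

definition first_level_copy :: "nat \<Rightarrow> (nat list \<Rightarrow> nat list) set \<Rightarrow> (nat list \<Rightarrow> nat list) set" where
  "first_level_copy d B = {g \<in> level_stabilizer d 1. \<forall>v\<in>level d 1. section_at d g v \<in> B}"

definition regular_branch :: "nat \<Rightarrow> (nat list \<Rightarrow> nat list) set \<Rightarrow> bool" where
  "regular_branch d G \<longleftrightarrow>
     subgroup G (AutT d) \<and> level_transitive d G \<and>
     (\<exists>B. finite_index_subgroup (AutT d) (first_level_copy d B) B \<and>
          finite_index_subgroup (AutT d) B G)"


section \<open>The abstract groups and general linear groups over the field with two elements\<close>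

definition semidirect ::
  "('a, 'c) monoid_scheme \<Rightarrow> ('b, 'e) monoid_scheme \<Rightarrow> ('b \<Rightarrow> 'a \<Rightarrow> 'a) \<Rightarrow> ('a \<times> 'b) monoid" where
  "semidirect N H \<alpha> =
     \<lparr>carrier = carrier N \<times> carrier H,
      mult = (\<lambda>(a, f) (b, g). (a \<otimes>\<^bsub>N\<^esub> \<alpha> f b, f \<otimes>\<^bsub>H\<^esub> g)),
      one = (\<one>\<^bsub>N\<^esub>, \<one>\<^bsub>H\<^esub>)\<rparr>"

type_synonym q_elem = "(nat \<Rightarrow> int) \<times> int"

definition Q_group :: "nat \<Rightarrow> nat \<Rightarrow> q_elem monoid" where
  "Q_group n r = product_group {..<n} (\<lambda>_. integer_mod_group 2) \<times>\<times> integer_mod_group r"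

definition P_group :: "nat \<Rightarrow> nat \<Rightarrow> (q_elem \<times> (q_elem \<Rightarrow> q_elem)) monoid" where
  "P_group n r = semidirect (Q_group n r) (AutoGroup (Q_group n r)) (\<lambda>f. f)"

text \<open>The normal factor \<open>Q\<close>, regarded as a subgroup of \<open>P = Q \<rtimes> Aut(Q)\<close>.\<close>

definition Q_in_P :: "nat \<Rightarrow> nat \<Rightarrow> (q_elem \<times> (q_elem \<Rightarrow> q_elem)) set" where
  "Q_in_P n r = carrier (Q_group n r) \<times> {\<one>\<^bsub>AutoGroup (Q_group n r)\<^esub>}"

definition GL_F2 :: "nat \<Rightarrow> bit mat set" where
  "GL_F2 n = {A \<in> carrier_mat n n. invertible_mat A}"


section \<open>Consistency of the definitions\<close>

lemma tree_snoc_iff: "u @ [x] \<in> tree d \<longleftrightarrow> u \<in> tree d \<and> x \<in> {1..d}"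
  by (auto simp: tree_def)

lemma AutT_adjacent:
  assumes "g \<in> carrier (AutT d)" "u \<in> tree d" "v \<in> tree d"
  shows "adjacent (g u) (g v) \<longleftrightarrow> adjacent u v"
  using assms by (simp add: AutT_def)

lemma AutT_snoc:
  assumes g: "g \<in> carrier (AutT d)" and "u @ [x] \<in> tree d"
  shows "\<exists>y\<in>{1..d}. g (u @ [x]) = g u @ [y]"
  using assms(2)
proof (induction u arbitrary: x rule: rev_induct)
  case Nil
  have mem: "[] \<in> tree d" "[x] \<in> tree d" using Nil by (auto simp: tree_def)
  have "g [x] \<in> tree d" using g mem by (auto simp: AutT_def permutes_in_image)
  moreover have "adjacent [] [x]" by (simp add: adjacent_def)
  hence "adjacent (g []) (g [x])" using AutT_adjacent[OF g mem] by simp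
  moreover have "g [] = []" using g by (simp add: AutT_def)
  ultimately show ?case by (auto simp: adjacent_def tree_def)
next
  case (snoc z u)
  let ?w = "u @ [z]"
  have w: "?w \<in> tree d" "u \<in> tree d" using snoc.prems by (auto simp: tree_def)
  from snoc.IH[OF w(1)] obtain z' where z': "g ?w = g u @ [z']" by blast
  have perm: "g permutes tree d" using g by (simp add: AutT_def)
  have "g (?w @ [x]) \<noteq> g u"
    using permutes_inj[OF perm] by (auto dest!: injD)
  moreover have "adjacent ?w (?w @ [x])" by (auto simp: adjacent_def)
  hence "adjacent (g ?w) (g (?w @ [x]))"
    using AutT_adjacent[OF g w(1) snoc.prems] by simp
  ultimately obtain y where y: "g (?w @ [x]) = g ?w @ [y]"
    using z' by (auto simp: adjacent_def)
  have "g (?w @ [x]) \<in> tree d" using snoc.prems perm by (simp add: permutes_in_image)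
  thus ?case using y by (auto simp: tree_snoc_iff)
qed

lemma AutT_length:
  assumes "g \<in> carrier (AutT d)" "v \<in> tree d"
  shows "length (g v) = length v"
  using assms(2)
proof (induction v rule: rev_induct)
  case Nil
  then show ?case using assms(1) by (simp add: AutT_def)
next
  case (snoc x v)
  then show ?case using AutT_snoc[OF assms(1), of v x] by (auto simp: tree_def)
qed

lemma section_at_eq:
  assumes g: "g \<in> carrier (AutT d)" and v: "v \<in> tree d" and w: "w \<in> tree d"
  shows "g (v @ w) = g v @ section_at d g v w"
proof -
  have "\<exists>z. g (v @ w) = g v @ z"
    using w
  proof (induction w rule: rev_induct)
    case Nil
    then show ?case by simp
  next
    case (snoc x w)
    then show ?case using AutT_snoc[OF g, of "v @ w" x] v by (auto simp: tree_def)
  qed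
  thus ?thesis using AutT_length[OF g v] w by (auto simp: section_at_def)
qed

lemma group_AutT: "group (AutT d)"
proof (rule groupI)
  fix g assume g: "g \<in> carrier (AutT d)"
  hence perm: "g permutes tree d" by (simp add: AutT_def)
  have "inv_into UNIV g \<in> carrier (AutT d)"
    unfolding AutT_def
  proof (simp, intro conjI ballI)
    show "inv_into UNIV g permutes tree d" using perm by (rule permutes_inv)
    show "inv_into UNIV g [] = []"
      using g permutes_inverses(2)[OF perm, of "[]"] by (simp add: AutT_def)
  next
    fix u v assume uv: "u \<in> tree d" "v \<in> tree d"
    let ?u = "inv_into UNIV g u" and ?v = "inv_into UNIV g v"
    have "?u \<in> tree d" "?v \<in> tree d"
      using uv permutes_inv[OF perm] by (simp_all add: permutes_in_image)
    hence "adjacent (g ?u) (g ?v) \<longleftrightarrow> adjacent ?u ?v" using g by (simp add: AutT_def)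
    thus "adjacent ?u ?v \<longleftrightarrow> adjacent u v" using permutes_inverses[OF perm] by simp
  qed
  moreover have "inv_into UNIV g \<otimes>\<^bsub>AutT d\<^esub> g = \<one>\<^bsub>AutT d\<^esub>"
    using permutes_inv_o[OF perm] by (simp add: AutT_def)
  ultimately show "\<exists>h\<in>carrier (AutT d). h \<otimes>\<^bsub>AutT d\<^esub> g = \<one>\<^bsub>AutT d\<^esub>" by blast
qed (auto simp: AutT_def permutes_compose permutes_id permutes_in_image comp_assoc)

lemma group_semidirect:
  assumes "group N" "group H"
    and \<alpha>: "\<And>h. h \<in> carrier H \<Longrightarrow> \<alpha> h \<in> hom N N"
    and one: "\<And>a. a \<in> carrier N \<Longrightarrow> \<alpha> \<one>\<^bsub>H\<^esub> a = a"
    and mult: "\<And>g h a. g \<in> carrier H \<Longrightarrow> h \<in> carrier H \<Longrightarrow> a \<in> carrier N \<Longrightarrow>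
                 \<alpha> (g \<otimes>\<^bsub>H\<^esub> h) a = \<alpha> g (\<alpha> h a)"
  shows "group (semidirect N H \<alpha>)"
proof -
  interpret N: group N by fact
  interpret H: group H by fact
  have cl: "\<alpha> h a \<in> carrier N" if "h \<in> carrier H" "a \<in> carrier N" for h a
    using \<alpha>[OF that(1)] that(2) by (auto simp: hom_def)
  have hm: "\<alpha> h (a \<otimes>\<^bsub>N\<^esub> b) = \<alpha> h a \<otimes>\<^bsub>N\<^esub> \<alpha> h b"
    if "h \<in> carrier H" "a \<in> carrier N" "b \<in> carrier N" for h a b
    using \<alpha>[OF that(1)] that(2,3) by (auto simp: hom_def)
  show ?thesis
  proof (rule groupI)
    fix x assume "x \<in> carrier (semidirect N H \<alpha>)"
    then obtain a h where x: "x = (a, h)" "a \<in> carrier N" "h \<in> carrier H"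
      by (auto simp: semidirect_def)
    let ?y = "(\<alpha> (inv\<^bsub>H\<^esub> h) (inv\<^bsub>N\<^esub> a), inv\<^bsub>H\<^esub> h)"
    have "\<alpha> (inv\<^bsub>H\<^esub> h) (inv\<^bsub>N\<^esub> a) \<otimes>\<^bsub>N\<^esub> \<alpha> (inv\<^bsub>H\<^esub> h) a = \<alpha> (inv\<^bsub>H\<^esub> h) \<one>\<^bsub>N\<^esub>"
      using x hm[of "inv\<^bsub>H\<^esub> h" "inv\<^bsub>N\<^esub> a" a] by simp
    also have "\<dots> = \<one>\<^bsub>N\<^esub>"
      using \<alpha>[of "inv\<^bsub>H\<^esub> h"] x hom_one[OF _ \<open>group N\<close> \<open>group N\<close>] by simp
    finally have "?y \<otimes>\<^bsub>semidirect N H \<alpha>\<^esub> x = \<one>\<^bsub>semidirect N H \<alpha>\<^esub>"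
      using x by (simp add: semidirect_def)
    moreover have "?y \<in> carrier (semidirect N H \<alpha>)"
      using x cl by (simp add: semidirect_def)
    ultimately show "\<exists>y\<in>carrier (semidirect N H \<alpha>). y \<otimes>\<^bsub>semidirect N H \<alpha>\<^esub> x = \<one>\<^bsub>semidirect N H \<alpha>\<^esub>"
      by blast
  qed (auto simp: semidirect_def cl hm one mult N.m_assoc H.m_assoc)
qed

lemma group_Q_group: "group (Q_group n r)"
  unfolding Q_group_def by (intro DirProd_group) auto

lemma group_P_group: "group (P_group n r)"
  unfolding P_group_def
proof (rule group_semidirect)
  interpret Q: group "Q_group n r" by (rule group_Q_group)
  show "group (Q_group n r)" by (rule group_Q_group)
  show "group (AutoGroup (Q_group n r))" by (rule Q.AutoGroup)
  show "f \<in> hom (Q_group n r) (Q_group n r)" if "f \<in> carrier (AutoGroup (Q_group n r))" for f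
    using that by (simp add: AutoGroup_def auto_def)
  show "\<one>\<^bsub>AutoGroup (Q_group n r)\<^esub> a = a" if "a \<in> carrier (Q_group n r)" for a
    using that by (simp add: AutoGroup_def BijGroup_def)
  show "(f \<otimes>\<^bsub>AutoGroup (Q_group n r)\<^esub> g) a = f (g a)"
    if "f \<in> carrier (AutoGroup (Q_group n r))" "g \<in> carrier (AutoGroup (Q_group n r))"
      "a \<in> carrier (Q_group n r)" for f g a
    using that by (simp add: AutoGroup_def BijGroup_def auto_def compose_def)
qed

end

theory Submission
  imports Defs "HOL-Number_Theory.Cong" "Jordan_Normal_Form.Determinant"
begin

text \<open>A transitive embedding makes \<open>Q\<close> regular on \<open>{1..d}\<close> because \<open>|Q| = d\<close>. The group
  \<open>G\<close> is the union, over the cosets \<open>K = Q\<sigma>\<close> in \<open>P\<close>, of the sets of automorphisms all of whose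
  labels lie in \<open>K\<close>. For a fixed \<open>K\<close> the labels are independent and uniform in \<open>K\<close>, so the
  number of fixed vertices on level \<open>n\<close> is a Galton--Watson process whose offspring law is the
  number of fixed points of a random element of \<open>K\<close>. By regularity its mean is \<open>1\<close>, so it dies
  out almost surely unless every element of \<open>K\<close> has exactly one fixed point. The cosets
  correspond to the automorphisms of \<open>Q\<close>, and the surviving ones to the automorphisms fixing only
  the identity. These are counted through \<open>Aut(Q) = GL\<^sub>n(F\<^sub>2) \<times> (Z/r)\<^sup>*\<close>. The group \<open>G\<close> is regular
  branch over the subgroup of elements with all labels in \<open>Q\<close>.\<close>

section \<open>Residues avoiding prescribed classes modulo primes\<close>

text \<open>The claim concerns every transitive embedding \<phi>, not only the affine action of
  \<open>P\<close> on \<open>Q\<close>. In general \<open>\<phi> (1, f)\<close> need not fix the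
  base point: once \<open>Q\<close> is identified with \<open>{1..d}\<close> by regularity, it acts
  as \<open>f\<close> followed by a translation by some \<open>t\<close>. This is harmless because a
  whole coset is considered, and \<open>c + t\<close> runs through \<open>Q\<close> together with
  \<open>c\<close>. All elements of the coset of \<open>f\<close> have exactly one fixed point iff
  \<open>q - f q\<close> takes each value once. As \<open>Q\<close> is abelian,
  \<open>q - f q\<close> is an endomorphism, and on a finite group it is bijective iff its kernel,
  the set of fixed points of \<open>f\<close>, is trivial. The mean 1 is a double count: for each
  letter exactly one element of \<open>Q\<sigma>\<close> fixes it, so \<open>d\<close> elements have
  \<open>d\<close> fixed points in total. The number of cosets is a constant factor in the order of
  each nontrivial congruence quotient and disappears from the logarithmic ratio, which leaves
  \<open>d\<close> independent choices per vertex against \<open>d!\<close>. The exception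
  \<open>d = 2\<close> modulo 4 means \<open>n = 1\<close>, where the only invertible matrix is 1
  and \<open>A - 1 = 0\<close>.\<close>

text \<open>With \<open>C p = {0}\<close> these are the units modulo \<open>m\<close>, with
  \<open>C p = {0, 1}\<close> the units \<open>u\<close> for which \<open>u - 1\<close> is a unit as
  well, so one count serves both sides of the ratio.\<close>

definition avoiding :: "(nat \<Rightarrow> nat set) \<Rightarrow> nat \<Rightarrow> nat set" where
  "avoiding C m = {u \<in> {..<m}. \<forall>p. prime p \<longrightarrow> p dvd m \<longrightarrow> u mod p \<notin> C p}"

text \<open>A repeated prime adds no condition: in \<open>u = a * m + b\<close> only the remainder
  \<open>b\<close> is constrained, and \<open>a\<close> is free among \<open>p\<close>
  values.\<close>

lemma card_avoiding_prime_dvd: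
  assumes p: "prime p" and pm: "p dvd m" and m: "m > 0"
  shows "card (avoiding C (p * m)) = p * card (avoiding C m)"
proof -
  have same: "prime q \<and> q dvd p * m \<longleftrightarrow> prime q \<and> q dvd m" for q
    using p pm by (metis dvd_mult dvd_trans prime_dvd_mult_iff primes_dvd_imp_eq)
  have mem: "u \<in> avoiding C (p * m) \<longleftrightarrow> u < p * m \<and> u mod m \<in> avoiding C m" for u
    using m same unfolding avoiding_def by (auto simp: mod_mod_cancel)
  have "bij_betw (\<lambda>(a, b). a * m + b) ({..<p} \<times> avoiding C m) (avoiding C (p * m))"
  proof (rule bij_betw_byWitness[where f' = "\<lambda>u. (u div m, u mod m)"])
    have less: "a * m + b < p * m" if "a < p" "b < m" for a b
    proof -
      have "a * m + b < Suc a * m" using that by simp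
      also have "\<dots> \<le> p * m" using that by (intro mult_right_mono) auto
      finally show ?thesis .
    qed
    show "(\<lambda>(a, b). a * m + b) ` ({..<p} \<times> avoiding C m) \<subseteq> avoiding C (p * m)"
      using less by (auto simp: mem) (auto simp: avoiding_def)
    show "(\<lambda>u. (u div m, u mod m)) ` avoiding C (p * m) \<subseteq> {..<p} \<times> avoiding C m"
      by (auto simp: mem less_mult_imp_div_less)
  qed (use m in \<open>auto simp: avoiding_def\<close>)
  then show ?thesis using bij_betw_same_card by (fastforce simp: card_cartesian_product)
qed

text \<open>By the Chinese remainder theorem the condition at the new prime is independent of those
  at the primes of \<open>m\<close>.\<close>

lemma card_avoiding_prime_coprime:
  assumes p: "prime p" and pm: "\<not> p dvd m" and m: "m > 0"
  shows "card (avoiding C (p * m)) = card ({..<p} - C p) * card (avoiding C m)"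
proof -
  have p0: "p > 0" using p prime_gt_0_nat by blast
  have cop: "coprime p m" using p pm by (simp add: prime_imp_coprime)
  have same: "prime q \<and> q dvd p * m \<longleftrightarrow> q = p \<or> prime q \<and> q dvd m" for q
    using p by (metis dvd_mult dvd_triv_left prime_dvd_mult_iff primes_dvd_imp_eq)
  have all: "(\<forall>q. prime q \<and> q dvd p * m \<longrightarrow> X q) \<longleftrightarrow> X p \<and> (\<forall>q. prime q \<and> q dvd m \<longrightarrow> X q)" for X
    unfolding same by auto
  have mem: "u \<in> avoiding C (p * m) \<longleftrightarrow> u < p * m \<and> u mod p \<in> {..<p} - C p \<and> u mod m \<in> avoiding C m" for u
  proof -
    have "u mod m mod q = u mod q" if "q dvd m" for q using that by (rule mod_mod_cancel)
    then have "u mod m \<in> avoiding C m \<longleftrightarrow> (\<forall>q. prime q \<longrightarrow> q dvd m \<longrightarrow> u mod q \<notin> C q)"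
      using m unfolding avoiding_def by auto
    then show ?thesis
      unfolding avoiding_def using all[of "\<lambda>q. u mod q \<notin> C q"] p0 by (simp add: imp_conjL)
  qed
  have "bij_betw (\<lambda>u. (u mod p, u mod m)) (avoiding C (p * m)) (({..<p} - C p) \<times> avoiding C m)"
  proof (intro bij_betw_imageI inj_onI equalityI subsetI)
    fix u v assume uv: "u \<in> avoiding C (p * m)" "v \<in> avoiding C (p * m)"
      "(u mod p, u mod m) = (v mod p, v mod m)"
    then have "[u = v] (mod p * m)" using cop by (intro coprime_cong_mult_nat) (auto simp: cong_def)
    then show "u = v" using uv by (simp add: mem cong_less_modulus_unique_nat)
  next
    fix z assume z: "z \<in> ({..<p} - C p) \<times> avoiding C m"
    obtain a b where ab: "z = (a, b)" "a < p" "b < m" using z by (auto simp: avoiding_def)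
    obtain u where "u < p * m" "[u = a] (mod p)" "[u = b] (mod m)"
      using binary_chinese_remainder_unique_nat[OF cop, of a b] p0 m by auto
    then have "u < p * m" "u mod p = a" "u mod m = b" using ab by (auto simp: cong_def)
    then show "z \<in> (\<lambda>u. (u mod p, u mod m)) ` avoiding C (p * m)"
      using z ab by (intro image_eqI[of _ _ u]) (auto simp: mem)
  qed (auto simp: mem)
  then show ?thesis using bij_betw_same_card by (fastforce simp: card_cartesian_product)
qed

text \<open>Multiplying by one prime at a time, a repeated prime contributes \<open>p\<close> and a
  new one \<open>p - card (C p)\<close>, which is \<open>p\<close> times its factor in the
  product.\<close>

lemma card_avoiding:
  assumes "m > 0" "\<And>p. prime p \<Longrightarrow> p dvd m \<Longrightarrow> C p \<subseteq> {..<p}"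
  shows "real (card (avoiding C m)) = real m * (\<Prod>p\<in>prime_factors m. 1 - real (card (C p)) / real p)"
  using assms
proof (induction m rule: prime_divisors_induct)
  case (unit m)
  then have "m = 1" by simp
  moreover have "avoiding C 1 = {0}" by (auto simp: avoiding_def)
  ultimately show ?case by simp
next
  case (factor p m)
  have m: "m > 0" using factor.prems(1) by simp
  have p0: "p > 0" using factor.hyps prime_gt_0_nat by blast
  have IH: "real (card (avoiding C m)) = real m * (\<Prod>p\<in>prime_factors m. 1 - real (card (C p)) / real p)"
    using factor m by simp
  have pf: "prime_factors (p * m) = insert p (prime_factors m)"
    using factor.hyps m p0 by (simp add: prime_factors_product prime_prime_factors)
  show ?case
  proof (cases "p dvd m")
    case True
    then have "p \<in> prime_factors m" using factor.hyps m by (simp add: prime_factors_dvd)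
    then show ?thesis using card_avoiding_prime_dvd[OF factor.hyps True m] IH pf by (simp add: insert_absorb)
  next
    case False
    then have "p \<notin> prime_factors m" by auto
    moreover have "card ({..<p} - C p) + card (C p) = p"
      using card_Diff_subset[of "C p" "{..<p}"] factor.prems(2)[OF factor.hyps] card_mono[of "{..<p}" "C p"]
      by (auto dest: finite_subset)
    then have "real (card ({..<p} - C p)) = real p - real (card (C p))" by linarith
    then have "real (card ({..<p} - C p)) = real p * (1 - real (card (C p)) / real p)"
      using p0 by (simp add: right_diff_distrib)
    ultimately show ?thesis
      using card_avoiding_prime_coprime[OF factor.hyps False m] IH pf by (simp add: mult.assoc)
  qed
qed simp

lemma coprime_iff_no_common_prime_factor:
  fixes a b :: int
  assumes "b \<noteq> 0"
  shows "coprime a b \<longleftrightarrow> (\<forall>p::nat. prime p \<longrightarrow> int p dvd b \<longrightarrow> \<not> int p dvd a)"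
proof
  assume "coprime a b"
  then show "\<forall>p::nat. prime p \<longrightarrow> int p dvd b \<longrightarrow> \<not> int p dvd a"
    by (metis coprime_common_divisor not_prime_unit prime_nat_int_transfer)
next
  assume *: "\<forall>p::nat. prime p \<longrightarrow> int p dvd b \<longrightarrow> \<not> int p dvd a"
  show "coprime a b"
  proof (rule ccontr)
    assume "\<not> coprime a b"
    then have "\<not> is_unit (gcd a b)" by (simp add: coprime_iff_gcd_eq_1)
    moreover have "gcd a b \<noteq> 0" using assms by simp
    ultimately obtain p where p: "prime p" "p dvd gcd a b" using prime_divisor_exists by blast
    then have "prime (nat p)" "int (nat p) = p" using prime_ge_0_int by auto
    then show False using * p by (metis dvd_gcdD1 dvd_gcdD2)
  qed
qed

text \<open>For \<open>r = 1\<close> the residue 0 is a unit, so the trivial group is counted once.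
  Integers are used so that \<open>u - 1\<close> is meaningful at \<open>u = 0\<close>.\<close>

definition units_mod :: "nat \<Rightarrow> nat set" where
  "units_mod r = {u \<in> {..<r}. coprime (int u) (int r)}"

text \<open>Both counts are instances of \<open>card_avoiding\<close>; \<open>r\<close> cancels, and
  each prime leaves \<open>(1 - 2/p) / (1 - 1/p)\<close>.\<close>

lemma units_mod_ratio:
  assumes r: "odd r"
  shows "real (card {u \<in> units_mod r. coprime (int u - 1) (int r)}) / real (card (units_mod r)) =
    (\<Prod>p\<in>{p. prime p \<and> p dvd r}. (real p - 2) / (real p - 1))"
proof -
  have r0: "r > 0" using r by (cases r) auto
  have p3: "p \<ge> 3" if "prime p" "p dvd r" for p :: nat
    using that r prime_ge_2_nat[of p] by (cases "p = 2") auto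
  have one: "int p dvd int u - 1 \<longleftrightarrow> u mod p = 1" if "p \<ge> 3" for p u
  proof -
    have "int p dvd int u - 1 \<longleftrightarrow> int u mod int p = 1 mod int p" by (simp add: mod_eq_dvd_iff)
    also have "\<dots> \<longleftrightarrow> u mod p = 1 mod p" by (metis of_nat_1 of_nat_eq_iff of_nat_mod)
    finally show ?thesis using that by simp
  qed
  have U: "units_mod r = avoiding (\<lambda>_. {0}) r"
    unfolding units_mod_def avoiding_def coprime_iff_no_common_prime_factor[of "int r", simplified, OF r0]
    by (auto simp: mod_greater_zero_iff_not_dvd)
  have V: "{u \<in> units_mod r. coprime (int u - 1) (int r)} = avoiding (\<lambda>_. {0, 1}) r"
  proof -
    have "coprime (int u - 1) (int r) \<longleftrightarrow> (\<forall>p. prime p \<longrightarrow> p dvd r \<longrightarrow> u mod p \<noteq> 1)" for u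
      using coprime_iff_no_common_prime_factor[of "int r" "int u - 1"] r0 one p3 by auto
    then show ?thesis unfolding U by (auto simp: avoiding_def)
  qed
  have factors: "{p. prime p \<and> p dvd r} = prime_factors r" using r0 by (auto simp: prime_factors_dvd)
  have sub: "{0, 1} \<subseteq> {..<p}" "{0} \<subseteq> {..<p}" if "prime p" "p dvd r" for p
    using p3[OF that] by auto
  have "real (card (avoiding (\<lambda>_. {0, 1}) r)) = real r * (\<Prod>p\<in>prime_factors r. 1 - real (card {0, 1::nat}) / real p)"
    using card_avoiding[OF r0, of "\<lambda>_. {0, 1}"] sub(1) by blast
  moreover have "real (card (avoiding (\<lambda>_. {0}) r)) = real r * (\<Prod>p\<in>prime_factors r. 1 - real (card {0::nat}) / real p)"
    using card_avoiding[OF r0, of "\<lambda>_. {0}"] sub(2) by blast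
  moreover have "(1 - 2 / real p) / (1 - 1 / real p) = (real p - 2) / (real p - 1)" if "p \<in> prime_factors r" for p
  proof -
    have "real p \<ge> 3" using p3[of p] that factors by auto
    then show ?thesis by (simp add: diff_divide_distrib[symmetric] divide_simps)
  qed
  ultimately show ?thesis
    unfolding V factors unfolding U using r0 by (simp add: prod_dividef[symmetric])
qed

section \<open>Linear maps over the field with two elements\<close>

text \<open>Passing through the determinant turns the two-sided inverse into a trivial kernel, the
  form in which matrices are compared with injective endomorphisms of \<open>Q\<close>.\<close>

lemma GL_F2_iff:
  "A \<in> GL_F2 n \<longleftrightarrow> A \<in> carrier_mat n n \<and> (\<forall>v\<in>carrier_vec n. A *\<^sub>v v = 0\<^sub>v n \<longrightarrow> v = 0\<^sub>v n)"
proof (cases "A \<in> carrier_mat n n")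
  case A: True
  have "invertible_mat A \<longleftrightarrow> det A \<noteq> 0"
  proof
    assume "invertible_mat A"
    then obtain B where B: "A * B = 1\<^sub>m n" "B * A = 1\<^sub>m (dim_row B)"
      using A by (auto simp: invertible_mat_def inverts_mat_def)
    have "dim_col B = n" using arg_cong[OF B(1), of dim_col] by simp
    moreover have "dim_row B = n" using arg_cong[OF B(2), of dim_col] A by simp
    ultimately have "B \<in> carrier_mat n n" by auto
    then have "det A * det B = 1" using det_mult[OF A, of B] B(1) by simp
    then show "det A \<noteq> 0" by auto
  next
    assume "det A \<noteq> 0"
    from det_non_zero_imp_unit[OF A this, of "()"] show "invertible_mat A"
      using A by (auto simp: Units_def ring_mat_def invertible_mat_def inverts_mat_def square_mat.simps)
  qed
  then show ?thesis
    using A det_0_iff_vec_prod_zero_field[OF A] by (auto simp: GL_F2_def)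
qed (simp add: GL_F2_def)

text \<open>The kernel of \<open>A - 1\<close> is the space of vectors fixed by
  \<open>A\<close>.\<close>

lemma minus_one_GL_F2_iff:
  assumes A: "A \<in> carrier_mat n n"
  shows "A - 1\<^sub>m n \<in> GL_F2 n \<longleftrightarrow> (\<forall>v\<in>carrier_vec n. A *\<^sub>v v = v \<longrightarrow> v = 0\<^sub>v n)"
proof -
  have "(A - 1\<^sub>m n) *\<^sub>v v = 0\<^sub>v n \<longleftrightarrow> A *\<^sub>v v = v" if v: "v \<in> carrier_vec n" for v
  proof -
    have "(A - 1\<^sub>m n) *\<^sub>v v = A *\<^sub>v v - v" using minus_mult_distrib_mat_vec[OF A _ v, of "1\<^sub>m n"] v by simp
    moreover have "A *\<^sub>v v - v = 0\<^sub>v n \<longleftrightarrow> A *\<^sub>v v = v"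
    proof
      assume e: "A *\<^sub>v v - v = 0\<^sub>v n"
      show "A *\<^sub>v v = v"
      proof (rule eq_vecI)
        fix i assume i: "i < dim_vec v"
        then have "(A *\<^sub>v v - v) $ i = 0" using e v by simp
        then have "(A *\<^sub>v v) $ i - v $ i = 0" using index_minus_vec(1)[OF i, of "A *\<^sub>v v"] by metis
        then show "(A *\<^sub>v v) $ i = v $ i" by (rule iffD2[OF eq_iff_diff_eq_0])
      qed (use A v in auto)
    qed (use v in auto)
    ultimately show ?thesis by simp
  qed
  moreover have "A - 1\<^sub>m n \<in> carrier_mat n n" by (rule minus_carrier_mat) simp
  ultimately show ?thesis unfolding GL_F2_iff by blast
qed

lemma mult_mat_unit_vec:
  fixes A :: "'a :: semiring_1 mat"
  assumes A: "A \<in> carrier_mat m n" and k: "k < n"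
  shows "A *\<^sub>v unit_vec n k = col A k"
  using A k by (intro eq_vecI) auto

lemma bit_add_self_vec:
  fixes v :: "bit vec"
  assumes "v \<in> carrier_vec n" shows "v + v = 0\<^sub>v n"
  using assms by (intro eq_vecI) auto

text \<open>Over the field with two elements the only scalars are 0 and 1, so additivity already is
  linearity and the images of the unit vectors form the matrix.\<close>

lemma additive_bit_vec_eq_mat:
  fixes g :: "bit vec \<Rightarrow> bit vec"
  assumes g: "g \<in> carrier_vec n \<rightarrow> carrier_vec n"
    and add: "\<And>v w. v \<in> carrier_vec n \<Longrightarrow> w \<in> carrier_vec n \<Longrightarrow> g (v + w) = g v + g w"
  shows "\<exists>A\<in>carrier_mat n n. \<forall>v\<in>carrier_vec n. g v = A *\<^sub>v v"
proof
  define A where "A = mat n n (\<lambda>(i, j). g (unit_vec n j) $ i)"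
  show A: "A \<in> carrier_mat n n" by (simp add: A_def)
  have gc: "g v \<in> carrier_vec n" if "v \<in> carrier_vec n" for v using g that by blast
  have unit: "g (unit_vec n k) = A *\<^sub>v unit_vec n k" if k: "k < n" for k
  proof -
    have "A *\<^sub>v unit_vec n k = col A k" using mult_mat_unit_vec[OF A k] .
    also have "\<dots> = g (unit_vec n k)" using gc[of "unit_vec n k"] k by (auto simp: A_def)
    finally show ?thesis by simp
  qed
  \<comment> \<open>The induction is on a bound \<open>k\<close> for the support of the
    vector.\<close>
  have "\<forall>v\<in>carrier_vec n. (\<forall>i<n. k \<le> i \<longrightarrow> v $ i = 0) \<longrightarrow> g v = A *\<^sub>v v" for k
  proof (induction k)
    case 0
    show ?case
    proof (intro ballI impI)
      fix v :: "bit vec" assume v: "v \<in> carrier_vec n" "\<forall>i<n. 0 \<le> i \<longrightarrow> v $ i = 0"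
      then have v0: "v = 0\<^sub>v n" by auto
      have "g (0\<^sub>v n + 0\<^sub>v n) = g (0\<^sub>v n) + g (0\<^sub>v n)" by (rule add) auto
      then have "g (0\<^sub>v n) = 0\<^sub>v n" using bit_add_self_vec[OF gc[of "0\<^sub>v n"]] by simp
      moreover have "A *\<^sub>v 0\<^sub>v n = 0\<^sub>v n" using A by auto
      ultimately show "g v = A *\<^sub>v v" by (simp add: v0)
    qed
  next
    case (Suc k)
    show ?case
    proof (intro ballI impI)
      fix v :: "bit vec" assume v: "v \<in> carrier_vec n" "\<forall>i<n. Suc k \<le> i \<longrightarrow> v $ i = 0"
      show "g v = A *\<^sub>v v"
      proof (cases "k < n \<and> v $ k = 1")
        case True
        \<comment> \<open>In characteristic 2, adding the unit vector clears coordinate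
          \<open>k\<close>, and adding it again gives back \<open>v\<close>.\<close>
        define w where "w = v + unit_vec n k"
        have w: "w \<in> carrier_vec n" using v by (simp add: w_def)
        have vw: "v = w + unit_vec n k"
          using v unfolding w_def by (intro eq_vecI) auto
        have "w $ i = 0" if "i < n" "k \<le> i" for i
          using v True that by (cases "i = k") (auto simp: w_def)
        then have "g w = A *\<^sub>v w" using Suc w by blast
        then show ?thesis
          using add[OF w, of "unit_vec n k"] unit True mult_add_distrib_mat_vec[OF A w, of "unit_vec n k"]
          by (simp add: vw)
      next
        case False
        have "v $ i = 0" if "i < n" "k \<le> i" for i
          using v False that by (cases "i = k") auto
        then show ?thesis using Suc v by blast
      qed
    qed
  qed
  from this[of n] show "\<forall>v\<in>carrier_vec n. g v = A *\<^sub>v v" by auto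
qed

text \<open>The witness is multiplication by \<open>x\<close> modulo \<open>x\<^sup>n + x + 1\<close>, a polynomial
  with roots neither at \<open>0\<close> nor at \<open>1\<close>.\<close>

lemma exists_fixed_point_free_GL_F2:
  assumes n: "n \<noteq> 1"
  shows "\<exists>A\<in>GL_F2 n. A - 1\<^sub>m n \<in> GL_F2 n"
proof (cases "n = 0")
  case True
  then have "1\<^sub>m n \<in> GL_F2 n \<and> 1\<^sub>m n - 1\<^sub>m n \<in> GL_F2 n" by (auto simp: GL_F2_iff)
  then show ?thesis by blast
next
  case False
  then have n2: "n \<ge> 2" using n by auto
  \<comment> \<open>Coordinates are the coefficients of 1, \<open>x\<close>, ...,
    \<open>x^(n-1)\<close>. Since \<open>x^n = x + 1\<close>, the top coefficient re-enters at
    positions 0 and 1, which are distinct positions because \<open>n\<close> is at least 2.\<close>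
  define g :: "bit vec \<Rightarrow> bit vec" where
    "g v = vec n (\<lambda>i. if i = 0 then v $ (n - 1) else if i = 1 then v $ 0 + v $ (n - 1) else v $ (i - 1))" for v
  have "g (v + w) = g v + g w" if "v \<in> carrier_vec n" "w \<in> carrier_vec n" for v w
    using that n2 by (intro eq_vecI) (auto simp: g_def)
  then obtain A where A: "A \<in> carrier_mat n n" "\<And>v. v \<in> carrier_vec n \<Longrightarrow> g v = A *\<^sub>v v"
    using additive_bit_vec_eq_mat[of g n] by (auto simp: g_def)
  have "v = 0\<^sub>v n" if v: "v \<in> carrier_vec n" and e: "A *\<^sub>v v = 0\<^sub>v n" for v
  proof (rule eq_vecI)
    fix i assume "i < dim_vec (0\<^sub>v n :: bit vec)"
    then have i: "i < n" by simp
    have e': "g v $ j = 0" if "j < n" for j using A(2)[OF v] e that by simp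
    \<comment> \<open>Row 0 kills the top coordinate, row 1 then kills coordinate 0, and row
      \<open>Suc i\<close> kills the others.\<close>
    show "v $ i = 0\<^sub>v n $ i"
      using e'[of 0] e'[of 1] e'[of "Suc i"] i n2 by (cases "i = n - 1"; cases "i = 0") (auto simp: g_def)
  qed (use v in simp)
  then have "A \<in> GL_F2 n" using A by (simp add: GL_F2_iff)
  moreover have "v = 0\<^sub>v n" if v: "v \<in> carrier_vec n" and e: "A *\<^sub>v v = v" for v
  proof -
    have e': "g v $ j = v $ j" if "j < n" for j using A(2)[OF v] e that by simp
    \<comment> \<open>For a fixed vector, row 0 says \<open>v $ 0 = v $ (n - 1)\<close>, so row 1
      gives \<open>v $ 1 = 0\<close>; the later rows pass this zero upwards to the top coordinate,
      and row 0 brings it back to coordinate 0.\<close>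
    have tail: "v $ Suc i = 0" if "Suc i < n" for i
      using that
    proof (induction i)
      case 0
      then show ?case using e'[of 0] e'[of 1] n2 by (simp add: g_def)
    next
      case (Suc i)
      then show ?case using e'[of "Suc (Suc i)"] by (simp add: g_def)
    qed
    have "v $ (n - 1) = 0" using tail[of "n - 2"] n2 by (simp add: Suc_diff_Suc numeral_2_eq_2)
    then have "v $ 0 = 0" using e'[of 0] n2 by (simp add: g_def)
    with tail have "v $ i = 0" if "i < n" for i using that by (cases i) auto
    then show ?thesis using v by auto
  qed
  ultimately show ?thesis using minus_one_GL_F2_iff[OF A(1)] by blast
qed

section \<open>Automorphisms of the elementary abelian times cyclic group\<close>

text \<open>\<open>of_int\<close> into \<open>bit\<close> is reduction modulo 2, so the addition
  modulo 2 of \<open>Q_group\<close> becomes vector addition. The inverse \<open>of_vec\<close>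
  picks the representatives 0 and 1 and is extensional, as elements of \<open>product_group\<close>
  are.\<close>

definition to_vec :: "nat \<Rightarrow> (nat \<Rightarrow> int) \<Rightarrow> bit vec" where
  "to_vec n x = vec n (\<lambda>i. of_int (x i))"

definition of_vec :: "nat \<Rightarrow> bit vec \<Rightarrow> nat \<Rightarrow> int" where
  "of_vec n v = (\<lambda>i\<in>{..<n}. if v $ i = 1 then 1 else 0)"

abbreviation two_power :: "nat \<Rightarrow> (nat \<Rightarrow> int) set" where
  "two_power n \<equiv> (\<Pi>\<^sub>E i\<in>{..<n}. {0..<2})"

lemma carrier_Q_group: "r > 0 \<Longrightarrow> carrier (Q_group n r) = two_power n \<times> {0..<int r}"
  by (simp add: Q_group_def carrier_integer_mod_group)

lemma mult_Q_group:
  "(x, y) \<otimes>\<^bsub>Q_group n r\<^esub> (x', y') = (\<lambda>i\<in>{..<n}. (x i + x' i) mod 2, (y + y') mod int r)"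
  by (simp add: Q_group_def product_group_def)

lemma one_Q_group: "\<one>\<^bsub>Q_group n r\<^esub> = (\<lambda>i\<in>{..<n}. 0, 0)"
  by (simp add: Q_group_def)

lemma to_vec_carrier [simp]: "to_vec n x \<in> carrier_vec n"
  by (simp add: to_vec_def)

lemma of_vec_mem [simp]: "of_vec n v \<in> two_power n"
  by (auto simp: of_vec_def)

lemma zero_or_one: "x \<in> two_power n \<Longrightarrow> i < n \<Longrightarrow> x i = 0 \<or> x i = 1"
proof -
  assume "x \<in> two_power n" "i < n"
  then have "x i \<in> {0..<2}" by blast
  then show ?thesis by auto
qed

lemma to_vec_of_vec: "v \<in> carrier_vec n \<Longrightarrow> to_vec n (of_vec n v) = v"
  by (intro eq_vecI) (auto simp: to_vec_def of_vec_def)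

lemma of_vec_to_vec: "x \<in> two_power n \<Longrightarrow> of_vec n (to_vec n x) = x"
proof
  fix i assume x: "x \<in> two_power n"
  show "of_vec n (to_vec n x) i = x i"
    using zero_or_one[OF x, of i] PiE_arb[OF x, of i]
    by (cases "i < n") (auto simp: of_vec_def to_vec_def)
qed

lemma to_vec_inj: "x \<in> two_power n \<Longrightarrow> y \<in> two_power n \<Longrightarrow> to_vec n x = to_vec n y \<longleftrightarrow> x = y"
  using of_vec_to_vec[of x n] of_vec_to_vec[of y n] by metis

lemma of_vec_eq_iff:
  assumes v: "v \<in> carrier_vec n" and x: "x \<in> two_power n"
  shows "of_vec n v = x \<longleftrightarrow> v = to_vec n x"
proof
  assume "of_vec n v = x"
  then have "to_vec n (of_vec n v) = to_vec n x" by simp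
  then show "v = to_vec n x" using to_vec_of_vec[OF v] by simp
qed (simp add: of_vec_to_vec[OF x])

lemma to_vec_add:
  assumes x: "x \<in> two_power n" and y: "y \<in> two_power n"
  shows "to_vec n (\<lambda>i\<in>{..<n}. (x i + y i) mod 2) = to_vec n x + to_vec n y"
  using zero_or_one[OF x] zero_or_one[OF y] by (intro eq_vecI) (fastforce simp: to_vec_def)+

lemma add_mem_two_power: "(\<lambda>i\<in>{..<n}. (x i + y i) mod 2) \<in> two_power n" for x y :: "nat \<Rightarrow> int"
  by auto

lemma to_vec_zero: "to_vec n (\<lambda>i\<in>{..<n}. 0) = 0\<^sub>v n"
  by (auto simp: to_vec_def)

text \<open>Block-diagonal endomorphisms. The two factors have coprime orders, so off-diagonal
  blocks vanish and these are all endomorphisms, see \<open>hom_eq_endo\<close>. The restriction to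
  the carrier matches the extensionality of elements of \<open>auto\<close>.\<close>

definition endo :: "nat \<Rightarrow> nat \<Rightarrow> bit mat \<Rightarrow> nat \<Rightarrow> q_elem \<Rightarrow> q_elem" where
  "endo n r A u = (\<lambda>(x, y)\<in>carrier (Q_group n r). (of_vec n (A *\<^sub>v to_vec n x), (int u * y) mod int r))"

context
  fixes n r :: nat
  assumes r: "odd r"
begin

lemma r_pos: "r > 0"
  using r by (cases r) auto

lemmas carr = carrier_Q_group[OF r_pos, of n]

lemma zero_in_two_power: "(\<lambda>i\<in>{..<n}. 0 :: int) \<in> two_power n"
  by auto

lemma endo_eq:
  assumes "x \<in> two_power n" "y \<in> {0..<int r}"
  shows "endo n r A u (x, y) = (of_vec n (A *\<^sub>v to_vec n x), (int u * y) mod int r)"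
  using assms by (simp add: endo_def carr)

lemma endo_hom:
  assumes A: "A \<in> carrier_mat n n"
  shows "endo n r A u \<in> hom (Q_group n r) (Q_group n r)"
proof (rule homI)
  fix z assume "z \<in> carrier (Q_group n r)"
  then show "endo n r A u z \<in> carrier (Q_group n r)"
    using r_pos by (cases z) (simp add: carr endo_eq)
next
  fix z z' assume "z \<in> carrier (Q_group n r)" "z' \<in> carrier (Q_group n r)"
  then obtain x y x' y' where z: "z = (x, y)" "z' = (x', y')" "x \<in> two_power n" "x' \<in> two_power n"
    "y \<in> {0..<int r}" "y' \<in> {0..<int r}" by (auto simp: carr)
  have my: "(y + y') mod int r \<in> {0..<int r}" using r_pos by simp
  have "A *\<^sub>v (to_vec n x + to_vec n x') = A *\<^sub>v to_vec n x + A *\<^sub>v to_vec n x'"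
    by (rule mult_add_distrib_mat_vec[OF A]) auto
  moreover have "to_vec n (\<lambda>i\<in>{..<n}. (of_vec n v i + of_vec n w i) mod 2) = v + w"
    if "v \<in> carrier_vec n" "w \<in> carrier_vec n" for v w
    using to_vec_add[OF of_vec_mem of_vec_mem] to_vec_of_vec that by simp
  then have "of_vec n (v + w) = (\<lambda>i\<in>{..<n}. (of_vec n v i + of_vec n w i) mod 2)"
    if "v \<in> carrier_vec n" "w \<in> carrier_vec n" for v w
    using that of_vec_to_vec[OF add_mem_two_power] by metis
  ultimately have "of_vec n (A *\<^sub>v to_vec n (\<lambda>i\<in>{..<n}. (x i + x' i) mod 2)) =
      (\<lambda>i\<in>{..<n}. (of_vec n (A *\<^sub>v to_vec n x) i + of_vec n (A *\<^sub>v to_vec n x') i) mod 2)"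
    using to_vec_add[OF z(3,4)] A by simp
  moreover have "int u * ((y + y') mod int r) mod int r = (int u * y mod int r + int u * y' mod int r) mod int r"
    by (simp add: mod_simps algebra_simps)
  ultimately show "endo n r A u (z \<otimes>\<^bsub>Q_group n r\<^esub> z') =
      endo n r A u z \<otimes>\<^bsub>Q_group n r\<^esub> endo n r A u z'"
    unfolding z(1,2) mult_Q_group endo_eq[OF z(3,5)] endo_eq[OF z(4,6)] endo_eq[OF add_mem_two_power my]
    by simp
qed

text \<open>Multiplication by \<open>a\<close> has trivial kernel on residues exactly for units;
  otherwise \<open>r\<close> divided by the gcd is a nonzero residue that is killed.\<close>

lemma coprime_iff_mult_inj:
  "coprime a (int r) \<longleftrightarrow> (\<forall>y\<in>{0..<int r}. (a * y) mod int r = 0 \<longrightarrow> y = 0)"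
proof
  assume c: "coprime a (int r)"
  show "\<forall>y\<in>{0..<int r}. (a * y) mod int r = 0 \<longrightarrow> y = 0"
  proof (intro ballI impI)
    fix y assume y: "y \<in> {0..<int r}" "(a * y) mod int r = 0"
    then have "int r dvd y" using c by (metis coprime_commute coprime_dvd_mult_right_iff dvd_eq_mod_eq_0)
    then show "y = 0" using y(1) zdvd_imp_le[of "int r" y] by (cases "y > 0") auto
  qed
next
  assume *: "\<forall>y\<in>{0..<int r}. (a * y) mod int r = 0 \<longrightarrow> y = 0"
  define g where "g = gcd a (int r)"
  have gr: "g dvd int r" "g dvd a" "g > 0" using r_pos by (auto simp: g_def)
  obtain b c where bc: "int r = g * b" "a = g * c" using gr by (elim dvdE)
  have b: "b > 0" using bc gr r_pos by (metis of_nat_0_less_iff zero_less_mult_pos)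
  have "(a * b) mod int r = 0" using bc by (simp add: mult.commute mult.left_commute)
  then have "\<not> b < int r" using *[rule_format, of b] b by auto
  then have "g = 1" using bc gr b mult_less_cancel_right[of 1 b g] by auto
  then show "coprime a (int r)" by (simp add: g_def coprime_iff_gcd_eq_1)
qed

lemma hom_to_self_inj_iff:
  assumes f: "f \<in> hom (Q_group n r) (Q_group n r)"
  shows "inj_on f (carrier (Q_group n r)) \<longleftrightarrow>
    (\<forall>z\<in>carrier (Q_group n r). f z = \<one>\<^bsub>Q_group n r\<^esub> \<longrightarrow> z = \<one>\<^bsub>Q_group n r\<^esub>)"
proof -
  interpret group_hom "Q_group n r" "Q_group n r" f
    using group_Q_group f by (simp add: group_hom_def group_hom_axioms_def)
  show ?thesis using inj_on_one_iff by blast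
qed

lemma finite_Q: "finite (carrier (Q_group n r))"
  unfolding carr by (intro finite_cartesian_product finite_PiE) auto

lemma card_Q_group: "card (carrier (Q_group n r)) = 2 ^ n * r"
  by (simp add: carr card_cartesian_product card_PiE)

lemma endo_one_iff:
  assumes A: "A \<in> carrier_mat n n" and x: "x \<in> two_power n" and y: "y \<in> {0..<int r}"
  shows "endo n r A u (x, y) = \<one>\<^bsub>Q_group n r\<^esub> \<longleftrightarrow> A *\<^sub>v to_vec n x = 0\<^sub>v n \<and> (int u * y) mod int r = 0"
proof -
  have "of_vec n (A *\<^sub>v to_vec n x) = (\<lambda>i\<in>{..<n}. 0) \<longleftrightarrow> A *\<^sub>v to_vec n x = 0\<^sub>v n"
    using of_vec_eq_iff[OF _ zero_in_two_power, of "A *\<^sub>v to_vec n x"] A to_vec_zero by simp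
  then show ?thesis by (simp add: endo_eq[OF x y] one_Q_group)
qed

lemma endo_fixed_iff:
  assumes A: "A \<in> carrier_mat n n" and x: "x \<in> two_power n" and y: "y \<in> {0..<int r}"
  shows "endo n r A u (x, y) = (x, y) \<longleftrightarrow> A *\<^sub>v to_vec n x = to_vec n x \<and> ((int u - 1) * y) mod int r = 0"
proof -
  have "of_vec n (A *\<^sub>v to_vec n x) = x \<longleftrightarrow> A *\<^sub>v to_vec n x = to_vec n x"
    using of_vec_eq_iff[OF _ x, of "A *\<^sub>v to_vec n x"] A by simp
  moreover have "(int u * y) mod int r = y \<longleftrightarrow> ((int u - 1) * y) mod int r = 0"
  proof -
    have "(int u * y) mod int r = y \<longleftrightarrow> (int u * y) mod int r = y mod int r" using y by simp
    also have "\<dots> \<longleftrightarrow> ((int u - 1) * y) mod int r = 0"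
      by (simp add: mod_eq_dvd_iff left_diff_distrib dvd_eq_mod_eq_0)
    finally show ?thesis .
  qed
  ultimately show ?thesis by (simp add: endo_eq[OF x y])
qed

text \<open>Splits a condition on pairs into its two components. Since zero satisfies both
  predicates, a solution in one component can be padded by zero in the other. It is applied once to
  kernels and once to fixed points.\<close>

lemma all_Q_group_iff:
  "(\<forall>z\<in>carrier (Q_group n r). P1 (to_vec n (fst z)) \<and> P2 (snd z) \<longrightarrow> z = \<one>\<^bsub>Q_group n r\<^esub>) \<longleftrightarrow>
   (\<forall>v\<in>carrier_vec n. P1 v \<longrightarrow> v = 0\<^sub>v n) \<and> (\<forall>y\<in>{0..<int r}. P2 y \<longrightarrow> y = 0)"
  if "P1 (0\<^sub>v n)" "P2 0"
proof
  assume L: "\<forall>z\<in>carrier (Q_group n r). P1 (to_vec n (fst z)) \<and> P2 (snd z) \<longrightarrow> z = \<one>\<^bsub>Q_group n r\<^esub>"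
  show "(\<forall>v\<in>carrier_vec n. P1 v \<longrightarrow> v = 0\<^sub>v n) \<and> (\<forall>y\<in>{0..<int r}. P2 y \<longrightarrow> y = 0)"
  proof (intro conjI ballI impI)
    fix v assume v: "v \<in> carrier_vec n" "P1 v"
    have "(of_vec n v, 0) \<in> carrier (Q_group n r)" using r_pos by (simp add: carr)
    then have "(of_vec n v, 0) = \<one>\<^bsub>Q_group n r\<^esub>" using L v that to_vec_of_vec by fastforce
    then have "of_vec n v = (\<lambda>i\<in>{..<n}. 0)" by (simp add: one_Q_group)
    then show "v = 0\<^sub>v n" using to_vec_of_vec[OF v(1)] to_vec_zero by simp
  next
    fix y assume y: "y \<in> {0..<int r}" "P2 y"
    have "(\<lambda>i\<in>{..<n}. 0, y) \<in> carrier (Q_group n r)" using y by (auto simp: carr)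
    then have "(\<lambda>i\<in>{..<n}. 0, y) = \<one>\<^bsub>Q_group n r\<^esub>" using L y that to_vec_zero by fastforce
    then show "y = 0" by (simp add: one_Q_group)
  qed
next
  assume R: "(\<forall>v\<in>carrier_vec n. P1 v \<longrightarrow> v = 0\<^sub>v n) \<and> (\<forall>y\<in>{0..<int r}. P2 y \<longrightarrow> y = 0)"
  show "\<forall>z\<in>carrier (Q_group n r). P1 (to_vec n (fst z)) \<and> P2 (snd z) \<longrightarrow> z = \<one>\<^bsub>Q_group n r\<^esub>"
  proof (intro ballI impI)
    fix z assume z: "z \<in> carrier (Q_group n r)" "P1 (to_vec n (fst z)) \<and> P2 (snd z)"
    have x: "fst z \<in> two_power n" and y: "snd z \<in> {0..<int r}" using z(1) unfolding carr mem_Times_iff by blast+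
    have "to_vec n (fst z) = to_vec n (\<lambda>i\<in>{..<n}. 0)" using R z(2) to_vec_carrier to_vec_zero by metis
    then have "fst z = (\<lambda>i\<in>{..<n}. 0)" using to_vec_inj[OF x zero_in_two_power] by blast
    moreover have "snd z = 0" using R y z(2) by blast
    ultimately show "z = \<one>\<^bsub>Q_group n r\<^esub>" by (simp add: one_Q_group prod_eq_iff)
  qed
qed

text \<open>On a finite carrier injectivity suffices, and the kernel is the product of the kernels
  of the two blocks.\<close>

lemma endo_auto_iff:
  assumes A: "A \<in> carrier_mat n n"
  shows "endo n r A u \<in> auto (Q_group n r) \<longleftrightarrow> A \<in> GL_F2 n \<and> coprime (int u) (int r)"
proof -
  let ?f = "endo n r A u"
  have maps: "?f ` carrier (Q_group n r) \<subseteq> carrier (Q_group n r)"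
    using endo_hom[OF A] unfolding hom_def by blast
  have "?f \<in> auto (Q_group n r) \<longleftrightarrow> inj_on ?f (carrier (Q_group n r))"
  proof
    assume inj: "inj_on ?f (carrier (Q_group n r))"
    have "?f ` carrier (Q_group n r) = carrier (Q_group n r)"
      by (rule endo_inj_surj[OF finite_Q maps inj])
    moreover have "?f \<in> extensional (carrier (Q_group n r))" unfolding endo_def by (rule restrict_extensional)
    ultimately show "?f \<in> auto (Q_group n r)"
      using endo_hom[OF A] inj by (simp add: auto_def Bij_def bij_betw_def)
  qed (simp add: auto_def Bij_def bij_betw_def)
  also have "\<dots> \<longleftrightarrow> (\<forall>z\<in>carrier (Q_group n r). (A *\<^sub>v to_vec n (fst z) = 0\<^sub>v n) \<and> (int u * snd z) mod int r = 0
      \<longrightarrow> z = \<one>\<^bsub>Q_group n r\<^esub>)"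
    unfolding hom_to_self_inj_iff[OF endo_hom[OF A]] using endo_one_iff[OF A] by (auto simp: carr)
  also have "\<dots> \<longleftrightarrow> A \<in> GL_F2 n \<and> coprime (int u) (int r)"
    unfolding GL_F2_iff coprime_iff_mult_inj using A
    by (subst all_Q_group_iff[of "\<lambda>v. A *\<^sub>v v = 0\<^sub>v n" "\<lambda>y. (int u * y) mod int r = 0"]) auto
  finally show ?thesis .
qed

text \<open>The fixed points are the product of the kernels of \<open>A - 1\<close> and of
  multiplication by \<open>u - 1\<close>.\<close>

lemma endo_fixed_point_free_iff:
  assumes A: "A \<in> carrier_mat n n"
  shows "(\<forall>z\<in>carrier (Q_group n r). endo n r A u z = z \<longrightarrow> z = \<one>\<^bsub>Q_group n r\<^esub>) \<longleftrightarrow>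
    A - 1\<^sub>m n \<in> GL_F2 n \<and> coprime (int u - 1) (int r)"
proof -
  have "(\<forall>z\<in>carrier (Q_group n r). endo n r A u z = z \<longrightarrow> z = \<one>\<^bsub>Q_group n r\<^esub>) \<longleftrightarrow>
    (\<forall>z\<in>carrier (Q_group n r). (A *\<^sub>v to_vec n (fst z) = to_vec n (fst z)) \<and> ((int u - 1) * snd z) mod int r = 0
      \<longrightarrow> z = \<one>\<^bsub>Q_group n r\<^esub>)"
    using endo_fixed_iff[OF A] by (auto simp: carr)
  also have "\<dots> \<longleftrightarrow> A - 1\<^sub>m n \<in> GL_F2 n \<and> coprime (int u - 1) (int r)"
    unfolding minus_one_GL_F2_iff[OF A] coprime_iff_mult_inj using A
    by (subst all_Q_group_iff[of "\<lambda>v. A *\<^sub>v v = v" "\<lambda>y. ((int u - 1) * y) mod int r = 0"]) auto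
  finally show ?thesis .
qed

lemma inj_endo: "inj_on (\<lambda>(A, u). endo n r A u) (carrier_mat n n \<times> {..<r})"
proof (rule inj_onI, clarify)
  fix A B :: "bit mat" and u v
  assume A: "A \<in> carrier_mat n n" and B: "B \<in> carrier_mat n n" and u: "u < r" and v: "v < r"
    and e: "endo n r A u = endo n r B v"
  have Av: "A *\<^sub>v w = B *\<^sub>v w" if w: "w \<in> carrier_vec n" for w
  proof -
    have "endo n r A u (of_vec n w, 0) = endo n r B v (of_vec n w, 0)" using e by simp
    then have "of_vec n (A *\<^sub>v w) = of_vec n (B *\<^sub>v w)"
      using r_pos w by (simp add: endo_eq to_vec_of_vec)
    then have "to_vec n (of_vec n (A *\<^sub>v w)) = to_vec n (of_vec n (B *\<^sub>v w))" by simp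
    then show ?thesis using A B w to_vec_of_vec by (metis mult_mat_vec_carrier)
  qed
  have "A = B"
  proof (rule eq_matI)
    fix i j assume "i < dim_row B" "j < dim_col B"
    then have ij: "i < n" "j < n" using B by auto
    have "col A j = col B j" using Av[of "unit_vec n j"] mult_mat_unit_vec[OF A ij(2)] mult_mat_unit_vec[OF B ij(2)]
      by simp
    then have "col A j $ i = col B j $ i" by simp
    then show "A $$ (i, j) = B $$ (i, j)" using A B ij by simp
  qed (use A B in auto)
  moreover have "u = v"
  \<comment> \<open>\<open>u\<close> is read off at the residue 1, which lies in the carrier only if
    \<open>r\<close> exceeds 1; for \<open>r = 1\<close> both \<open>u\<close> and \<open>v\<close>
    are 0.\<close>
  proof (cases "r = 1")
    case False
    then have "1 \<in> {0..<int r}" using r_pos by auto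
    then have "int u mod int r = int v mod int r"
      using fun_cong[OF e, of "(\<lambda>i\<in>{..<n}. 0, 1)"] endo_eq[OF zero_in_two_power, of 1] by simp
    then show ?thesis using u v by simp
  qed (use u v in simp)
  ultimately show "A = B \<and> u = v" ..
qed

text \<open>Cross terms vanish for parity reasons: doubling kills the first factor, while an element
  of odd-order \<open>C_r\<close> killed by doubling is 0; and every element of \<open>C_r\<close>
  is a double, while doubles in the first factor are 0. What remains is an additive map of bit
  vectors and a map of \<open>C_r\<close> determined by the image of 1.\<close>

lemma hom_eq_endo:
  assumes f: "f \<in> hom (Q_group n r) (Q_group n r)" and ext: "f \<in> extensional (carrier (Q_group n r))"
  shows "\<exists>A\<in>carrier_mat n n. \<exists>u<r. f = endo n r A u"
proof -
  let ?Q = "Q_group n r" and ?o = "\<lambda>i\<in>{..<n}. 0 :: int"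
  have fc: "f z \<in> carrier ?Q" if "z \<in> carrier ?Q" for z using f that by (auto simp: hom_def)
  have fm: "f (z \<otimes>\<^bsub>?Q\<^esub> z') = f z \<otimes>\<^bsub>?Q\<^esub> f z'" if "z \<in> carrier ?Q" "z' \<in> carrier ?Q" for z z'
    using f that by (auto simp: hom_def)
  have mem: "fst (f z) \<in> two_power n" "snd (f z) \<in> {0..<int r}" if "z \<in> carrier ?Q" for z
    using fc[OF that] unfolding carr mem_Times_iff by blast+
  have fsts: "fst (z \<otimes>\<^bsub>?Q\<^esub> z') = (\<lambda>i\<in>{..<n}. (fst z i + fst z' i) mod 2)"
    and snds: "snd (z \<otimes>\<^bsub>?Q\<^esub> z') = (snd z + snd z') mod int r" for z z'
    using mult_Q_group[of n r "fst z" "snd z" "fst z'" "snd z'"] by simp_all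
  have one: "f (?o, 0) = (?o, 0)"
    using hom_one[OF f group_Q_group group_Q_group] by (simp add: one_Q_group)
  have double: "(\<lambda>i\<in>{..<n}. (x i + x i) mod 2) = ?o" for x :: "nat \<Rightarrow> int"
    by (rule restrict_ext) presburger
  have x0: "(x, 0) \<in> carrier ?Q" if "x \<in> two_power n" for x using that r_pos by (simp add: carr)
  have oy: "(?o, y) \<in> carrier ?Q" if "y \<in> {0..<int r}" for y using that zero_in_two_power by (simp add: carr)
  have snd0: "snd (f (x, 0)) = 0" if x: "x \<in> two_power n" for x
  proof -
    let ?y = "snd (f (x, 0))"
    have d: "f (x, 0) \<otimes>\<^bsub>?Q\<^esub> f (x, 0) = (?o, 0)"
      using fm[OF x0[OF x] x0[OF x]] one by (simp add: mult_Q_group double)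
    have "(?y + ?y) mod int r = 0" unfolding snds[symmetric] d by simp
    then have "int r dvd 2 * ?y" by (simp add: dvd_eq_mod_eq_0)
    then have "int r dvd ?y" using r coprime_dvd_mult_right_iff[of "int r" 2 ?y] by simp
    then show ?thesis using mem(2)[OF x0[OF x]] zdvd_not_zless[of ?y "int r"] by fastforce
  qed
  have fst0: "fst (f (?o, y)) = ?o" if y: "y \<in> {0..<int r}" for y
  proof -
    \<comment> \<open>This is half of \<open>y\<close>: \<open>(r + 1) div 2\<close> inverts 2
      modulo the odd number \<open>r\<close>.\<close>
    define y' where "y' = (y * ((int r + 1) div 2)) mod int r"
    have y': "y' \<in> {0..<int r}" using r_pos by (simp add: y'_def)
    have "(y' + y') mod int r = (y * (2 * ((int r + 1) div 2))) mod int r"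
      by (simp add: y'_def mod_simps algebra_simps)
    also have "2 * ((int r + 1) div 2) = int r + 1" using r by (intro dvd_mult_div_cancel) simp
    also have "(y * (int r + 1)) mod int r = y" using y by (simp add: distrib_left)
    finally have "(?o, y') \<otimes>\<^bsub>?Q\<^esub> (?o, y') = (?o, y)" by (simp add: mult_Q_group cong: restrict_cong)
    then have "f (?o, y) = f (?o, y') \<otimes>\<^bsub>?Q\<^esub> f (?o, y')" using fm[OF oy[OF y'] oy[OF y']] by simp
    then show ?thesis by (simp only: fsts double)
  qed
  define g where "g v = to_vec n (fst (f (of_vec n v, 0)))" for v
  have "g (v + w) = g v + g w" if v: "v \<in> carrier_vec n" and w: "w \<in> carrier_vec n" for v w
  proof -
    have "to_vec n (of_vec n (v + w)) = to_vec n (\<lambda>i\<in>{..<n}. (of_vec n v i + of_vec n w i) mod 2)"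
      using v w to_vec_of_vec to_vec_add[OF of_vec_mem of_vec_mem] by simp
    then have "of_vec n (v + w) = (\<lambda>i\<in>{..<n}. (of_vec n v i + of_vec n w i) mod 2)"
      using to_vec_inj[OF of_vec_mem add_mem_two_power] by blast
    then have "(of_vec n (v + w), 0) = (of_vec n v, 0) \<otimes>\<^bsub>?Q\<^esub> (of_vec n w, 0)" by (simp add: mult_Q_group)
    then have "f (of_vec n (v + w), 0) = f (of_vec n v, 0) \<otimes>\<^bsub>?Q\<^esub> f (of_vec n w, 0)"
      using fm[OF x0[OF of_vec_mem] x0[OF of_vec_mem]] by metis
    then show ?thesis
      unfolding g_def by (simp only: fsts to_vec_add[OF mem(1)[OF x0[OF of_vec_mem]] mem(1)[OF x0[OF of_vec_mem]]])
  qed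
  then obtain A where A: "A \<in> carrier_mat n n" "\<And>v. v \<in> carrier_vec n \<Longrightarrow> g v = A *\<^sub>v v"
    using additive_bit_vec_eq_mat[of g n] by (auto simp: g_def)
  have fx: "f (x, 0) = (of_vec n (A *\<^sub>v to_vec n x), 0)" if x: "x \<in> two_power n" for x
  proof -
    have "to_vec n (fst (f (x, 0))) = A *\<^sub>v to_vec n x"
      using A(2)[of "to_vec n x"] of_vec_to_vec[OF x] by (simp add: g_def)
    then have "fst (f (x, 0)) = of_vec n (A *\<^sub>v to_vec n x)"
      using of_vec_to_vec[OF mem(1)[OF x0[OF x]]] by simp
    then show ?thesis using snd0[OF x] by (simp add: prod_eq_iff)
  qed
  define F where "F y = snd (f (?o, y))" for y
  have F0: "F 0 = 0" by (simp add: F_def one)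
  have Fadd: "F ((y + y') mod int r) = (F y + F y') mod int r"
    if y: "y \<in> {0..<int r}" and y': "y' \<in> {0..<int r}" for y y'
  proof -
    have "(?o, y) \<otimes>\<^bsub>?Q\<^esub> (?o, y') = (?o, (y + y') mod int r)" by (simp add: mult_Q_group double cong: restrict_cong)
    then have "f (?o, (y + y') mod int r) = f (?o, y) \<otimes>\<^bsub>?Q\<^esub> f (?o, y')" using fm[OF oy[OF y] oy[OF y']] by simp
    then show ?thesis by (simp only: F_def snds)
  qed
  \<comment> \<open>Writing \<open>1 mod int r\<close> instead of 1 keeps the generator inside the
    carrier when \<open>r = 1\<close>.\<close>
  define c where "c = F (1 mod int r)"
  have c: "c \<in> {0..<int r}" unfolding c_def F_def using r_pos by (intro mem(2) oy) simp
  have fy: "F (int k mod int r) = (c * int k) mod int r" for k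
  proof (induction k)
    case (Suc k)
    have "F (int (Suc k) mod int r) = F ((int k mod int r + 1 mod int r) mod int r)"
      by (simp add: mod_simps add.commute)
    also have "\<dots> = (F (int k mod int r) + c) mod int r"
      unfolding c_def by (rule Fadd) (use r_pos in simp_all)
    finally show ?case using Suc by (simp add: mod_simps algebra_simps)
  qed (simp add: F0)
  have "f = endo n r A (nat c)"
  proof (rule extensionalityI[OF ext])
    show "endo n r A (nat c) \<in> extensional (carrier ?Q)" unfolding endo_def by (rule restrict_extensional)
    fix z assume "z \<in> carrier ?Q"
    then obtain x y where z: "z = (x, y)" "x \<in> two_power n" "y \<in> {0..<int r}" by (auto simp: carr)
    have "(\<lambda>i\<in>{..<n}. (x i + ?o i) mod 2) = x"
    proof
      fix i show "(\<lambda>i\<in>{..<n}. (x i + ?o i) mod 2) i = x i"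
        using zero_or_one[OF z(2), of i] PiE_arb[OF z(2), of i] by (cases "i < n") auto
    qed
    then have "z = (x, 0) \<otimes>\<^bsub>?Q\<^esub> (?o, y)" using z by (simp add: mult_Q_group)
    then have fz: "f z = f (x, 0) \<otimes>\<^bsub>?Q\<^esub> f (?o, y)" using fm[OF x0[OF z(2)] oy[OF z(3)]] by metis
    have "snd (f (?o, y)) = (c * y) mod int r" using fy[of "nat y"] z by (simp add: F_def)
    then have fo: "f (?o, y) = (?o, (c * y) mod int r)" using fst0[OF z(3)] by (simp add: prod_eq_iff)
    have ov: "(\<lambda>i\<in>{..<n}. (of_vec n v i + ?o i) mod 2) = of_vec n v" for v
      by (auto simp: of_vec_def)
    show "f z = endo n r A (nat c) z"
      unfolding fz fx[OF z(2)] fo mult_Q_group ov unfolding z(1) endo_eq[OF z(2,3)] using c by simp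
  qed
  then show ?thesis using A(1) c by (intro bexI[of _ A] exI[of _ "nat c"]) auto
qed

end

declare One_nat_def [simp del]

section \<open>The wreath decomposition of tree automorphisms\<close>

text \<open>The element of the wreath recursion with root label \<sigma> and sections
  \<open>h x\<close>. Outside the tree it is the identity, as membership in \<open>AutT\<close>
  demands.\<close>

definition rooted :: "nat \<Rightarrow> (nat \<Rightarrow> nat) \<Rightarrow> (nat \<Rightarrow> nat list \<Rightarrow> nat list) \<Rightarrow> nat list \<Rightarrow> nat list" where
  "rooted d \<sigma> h v = (if v \<in> tree d then case v of [] \<Rightarrow> [] | x # w \<Rightarrow> \<sigma> x # h x w else v)"

lemma tree_Nil [simp]: "[] \<in> tree d"
  by (simp add: tree_def)

lemma tree_Cons [simp]: "x # w \<in> tree d \<longleftrightarrow> x \<in> {1..d} \<and> w \<in> tree d"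
  by (auto simp: tree_def)

lemma tree_append [simp]: "v @ w \<in> tree d \<longleftrightarrow> v \<in> tree d \<and> w \<in> tree d"
  by (auto simp: tree_def)

lemma level_0 [simp]: "level d 0 = {[]}"
  by (auto simp: level_def)

lemma Cons_in_level_Suc [simp]: "x # w \<in> level d (Suc n) \<longleftrightarrow> x \<in> {1..d} \<and> w \<in> level d n"
  by (auto simp: level_def)

lemma level_Suc: "level d (Suc n) = {x # w | x w. x \<in> {1..d} \<and> w \<in> level d n}"
  by (auto simp: level_def length_Suc_conv)

lemma level_subset_tree: "level d n \<subseteq> tree d"
  by (auto simp: level_def)

lemma rooted_Nil [simp]: "rooted d \<sigma> h [] = []"
  by (simp add: rooted_def)

lemma rooted_Cons:
  "x \<in> {1..d} \<Longrightarrow> w \<in> tree d \<Longrightarrow> rooted d \<sigma> h (x # w) = \<sigma> x # h x w"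
  by (simp add: rooted_def)

lemma adjacent_Nil [simp]:
  "adjacent [] v \<longleftrightarrow> (\<exists>x. v = [x])" "adjacent u [] \<longleftrightarrow> (\<exists>x. u = [x])"
  by (auto simp: adjacent_def)

lemma adjacent_Cons [simp]: "adjacent (a # u) (b # v) \<longleftrightarrow> a = b \<and> adjacent u v"
  by (auto simp: adjacent_def)

lemma adjacent_append: "adjacent (u @ v) (u @ w) \<longleftrightarrow> adjacent v w"
  by (induction u) auto

lemma AutT_permutes: "g \<in> carrier (AutT d) \<Longrightarrow> g permutes tree d"
  by (simp add: AutT_def)

lemma AutT_Nil: "g \<in> carrier (AutT d) \<Longrightarrow> g [] = []"
  by (simp add: AutT_def)

lemma AutT_in_tree: "g \<in> carrier (AutT d) \<Longrightarrow> g v \<in> tree d \<longleftrightarrow> v \<in> tree d"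
  by (meson AutT_permutes permutes_in_image)

lemma AutT_in_level: "g \<in> carrier (AutT d) \<Longrightarrow> v \<in> level d n \<Longrightarrow> g v \<in> level d n"
  by (simp add: level_def AutT_in_tree AutT_length)

lemma AutT_inj: "g \<in> carrier (AutT d) \<Longrightarrow> g u = g v \<longleftrightarrow> u = v"
  by (metis AutT_permutes permutes_inj injD)

lemma AutT_mult [simp]: "g \<otimes>\<^bsub>AutT d\<^esub> h = g \<circ> h"
  by (simp add: AutT_def)

lemma AutT_one [simp]: "\<one>\<^bsub>AutT d\<^esub> = id"
  by (simp add: AutT_def)

lemma AutT_comp: "g \<in> carrier (AutT d) \<Longrightarrow> h \<in> carrier (AutT d) \<Longrightarrow> g \<circ> h \<in> carrier (AutT d)"
  using monoid.m_closed[OF group.is_monoid[OF group_AutT]] by fastforce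

lemma AutT_id: "id \<in> carrier (AutT d)"
  using monoid.one_closed[OF group.is_monoid[OF group_AutT]] by simp

lemma rooted_AutT:
  assumes \<sigma>: "\<sigma> permutes {1..d}" and h': "h \<in> {1..d} \<rightarrow> carrier (AutT d)"
  shows "rooted d \<sigma> h \<in> carrier (AutT d)"
proof -
  let ?g = "rooted d \<sigma> h"
  have h: "h x \<in> carrier (AutT d)" if "x \<in> {1..d}" for x
    using h' that by blast
  have \<sigma>d: "\<sigma> x \<in> {1..d} \<longleftrightarrow> x \<in> {1..d}" for x
    using permutes_in_image[OF \<sigma>] .
  have inj: "inj_on ?g (tree d)"
  proof (rule inj_onI)
    fix u v assume "u \<in> tree d" "v \<in> tree d" "?g u = ?g v"
    then show "u = v"
      using AutT_inj[OF h] permutes_inj[OF \<sigma>]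
      by (cases u; cases v) (auto simp: rooted_Cons dest: injD)
  qed
  have im: "?g ` tree d = tree d"
  proof (intro equalityI subsetI)
    fix v assume "v \<in> ?g ` tree d"
    then obtain u where u: "u \<in> tree d" "v = ?g u" by blast
    then show "v \<in> tree d"
      using \<sigma>d AutT_in_tree[OF h] by (cases u) (auto simp: rooted_Cons)
  next
    fix v assume v: "v \<in> tree d"
    show "v \<in> ?g ` tree d"
    proof (cases v)
      case Nil
      then show ?thesis by (intro image_eqI[of _ _ "[]"]) auto
    next
      case (Cons y w)
      define x where "x = inv_into UNIV \<sigma> y"
      have x: "\<sigma> x = y" unfolding x_def using permutes_inverses[OF \<sigma>] by simp
      with Cons v \<sigma>d have xd: "x \<in> {1..d}" by auto
      define u where "u = inv_into UNIV (h x) w"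
      have u: "h x u = w" unfolding u_def using permutes_inverses[OF AutT_permutes[OF h[OF xd]]] by simp
      with Cons v AutT_in_tree[OF h[OF xd], of u] have "u \<in> tree d" by auto
      then show ?thesis using x xd u Cons by (intro image_eqI[of _ _ "x # u"]) (auto simp: rooted_Cons)
    qed
  qed
  have "?g permutes tree d"
    using inj im by (intro bij_imp_permutes) (auto simp: bij_betw_def rooted_def)
  moreover have "adjacent (?g u) (?g v) \<longleftrightarrow> adjacent u v" if uv: "u \<in> tree d" "v \<in> tree d" for u v
  proof -
    have nil: "h x w = [] \<longleftrightarrow> w = []" if "x \<in> {1..d}" "w \<in> tree d" for x w
      using AutT_length[OF h that(2), of x] that by (metis length_0_conv)
    show ?thesis
      using uv AutT_adjacent[OF h] nil permutes_inj[OF \<sigma>]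
      by (cases u; cases v) (auto simp: rooted_Cons inj_eq)
  qed
  ultimately show ?thesis by (simp add: AutT_def)
qed

lemma section_at_AutT:
  assumes g: "g \<in> carrier (AutT d)" and v: "v \<in> tree d"
  shows "section_at d g v \<in> carrier (AutT d)"
proof -
  let ?s = "section_at d g v"
  have eq: "g (v @ w) = g v @ ?s w" if "w \<in> tree d" for w
    by (rule section_at_eq[OF g v that])
  have st: "?s w \<in> tree d" if "w \<in> tree d" for w
    using AutT_in_tree[OF g, of "v @ w"] eq[OF that] that v by simp
  have inj: "inj_on ?s (tree d)"
    using eq AutT_inj[OF g] by (metis inj_onI same_append_eq)
  have "w \<in> ?s ` tree d" if w: "w \<in> tree d" for w
  proof -
    \<comment> \<open>The preimage of \<open>g v @ w\<close> has a prefix as long as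
      \<open>v\<close> whose image is \<open>g v\<close>; by injectivity that prefix is
      \<open>v\<close>, and the rest is the preimage of \<open>w\<close> under the section.\<close>
    define u where "u = inv_into UNIV g (g v @ w)"
    have gu: "g u = g v @ w" unfolding u_def using permutes_inverses[OF AutT_permutes[OF g]] by simp
    have ut: "u \<in> tree d" using AutT_in_tree[OF g] gu w v by (metis tree_append)
    define u1 u2 where "u1 = take (length v) u" and "u2 = drop (length v) u"
    have u12: "u = u1 @ u2" by (simp add: u1_def u2_def)
    have t12: "u1 \<in> tree d" "u2 \<in> tree d" using ut u12 by (metis tree_append)+
    have "length u = length (g v @ w)" using gu AutT_length[OF g ut] by simp
    then have l1: "length u1 = length v" using AutT_length[OF g v] by (simp add: u1_def)
    have "g u1 @ section_at d g u1 u2 = g v @ w"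
      using section_at_eq[OF g t12] gu u12 by simp
    then have "g u1 = g v" using l1 AutT_length[OF g v] AutT_length[OF g t12(1)]
      by simp
    then have "u1 = v" using AutT_inj[OF g] by blast
    then have "?s u2 = w" using eq[OF t12(2)] gu u12 by simp
    then show ?thesis using t12 by blast
  qed
  then have "?s permutes tree d"
    using inj st by (intro bij_imp_permutes) (auto simp: bij_betw_def section_at_def)
  moreover have "?s [] = []" using eq[of "[]"] by simp
  moreover have "adjacent (?s u) (?s w) \<longleftrightarrow> adjacent u w" if "u \<in> tree d" "w \<in> tree d" for u w
    using AutT_adjacent[OF g, of "v @ u" "v @ w"] that v eq by (simp add: adjacent_append)
  ultimately show ?thesis by (simp add: AutT_def)
qed

lemma section_at_section:
  assumes g: "g \<in> carrier (AutT d)" and v: "v \<in> tree d" and w: "w \<in> tree d"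
  shows "section_at d (section_at d g v) w = section_at d g (v @ w)"
proof
  fix u
  show "section_at d (section_at d g v) w u = section_at d g (v @ w) u"
  proof (cases "u \<in> tree d")
    case True
    have "g (v @ w @ u) = g v @ section_at d g v w @ section_at d (section_at d g v) w u"
      using section_at_eq[OF section_at_AutT[OF g v] w True] section_at_eq[OF g v, of "w @ u"] True w
      by simp
    moreover have "g ((v @ w) @ u) = g v @ section_at d g v w @ section_at d g (v @ w) u"
      using section_at_eq[OF g _ True, of "v @ w"] section_at_eq[OF g v w] v w by simp
    ultimately show ?thesis by simp
  qed (simp add: section_at_def)
qed

lemma label_section:
  assumes "g \<in> carrier (AutT d)" "v \<in> tree d" "w \<in> tree d"
  shows "label d (section_at d g v) w = label d g (v @ w)"
  by (simp only: label_def section_at_section[OF assms])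

lemma section_at_singleton:
  assumes g: "g \<in> carrier (AutT d)" and v: "v \<in> tree d" and x: "x \<in> {1..d}"
  shows "section_at d g v [x] = [label d g v x]"
proof -
  have "length (section_at d g v [x]) = 1"
    using AutT_length[OF section_at_AutT[OF g v], of "[x]"] x by simp
  then show ?thesis using x by (cases "section_at d g v [x]") (auto simp: label_def)
qed

lemma AutT_snoc_label:
  assumes g: "g \<in> carrier (AutT d)" and v: "v \<in> tree d" and x: "x \<in> {1..d}"
  shows "g (v @ [x]) = g v @ [label d g v x]"
  using section_at_eq[OF g v, of "[x]"] section_at_singleton[OF assms] x by simp

lemma AutT_Cons:
  assumes g: "g \<in> carrier (AutT d)" and x: "x \<in> {1..d}" and w: "w \<in> tree d"
  shows "g (x # w) = label d g [] x # section_at d g [x] w"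
  using section_at_eq[OF g _ w, of "[x]"] AutT_snoc_label[OF g, of "[]" x] AutT_Nil[OF g] x by simp

lemma label_permutes:
  assumes g: "g \<in> carrier (AutT d)" and v: "v \<in> tree d"
  shows "label d g v permutes {1..d}"
proof (rule bij_imp_permutes)
  have "inj_on (label d g v) {1..d}"
  proof (rule inj_onI)
    fix x y assume "x \<in> {1..d}" "y \<in> {1..d}" "label d g v x = label d g v y"
    then have "g (v @ [x]) = g (v @ [y])" using AutT_snoc_label[OF g v] by simp
    then show "x = y" using AutT_inj[OF g] by simp
  qed
  moreover have "label d g v x \<in> {1..d}" if x: "x \<in> {1..d}" for x
    using AutT_in_tree[OF g, of "v @ [x]"] AutT_snoc_label[OF g v x] v x by simp
  ultimately show "bij_betw (label d g v) {1..d} {1..d}"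
    by (intro bij_betw_imageI endo_inj_surj) auto
qed (auto simp: label_def)

text \<open>Together with \<open>label_rooted_Nil\<close> and \<open>section_rooted\<close> this
  makes \<open>rooted\<close> the inverse of taking the root label and the first-level sections, the
  source of every recursion over levels.\<close>

lemma AutT_eq_rooted:
  assumes g: "g \<in> carrier (AutT d)"
  shows "g = rooted d (label d g []) (\<lambda>x. section_at d g [x])"
proof
  fix v show "g v = rooted d (label d g []) (\<lambda>x. section_at d g [x]) v"
    using AutT_permutes[OF g] AutT_Nil[OF g] AutT_Cons[OF g]
    by (cases v) (auto simp: rooted_def permutes_def)
qed

lemma label_rooted_Nil:
  assumes "\<sigma> permutes {1..d}"
  shows "label d (rooted d \<sigma> h) [] = \<sigma>"
  using assms by (auto simp: label_def section_at_def rooted_Cons permutes_def fun_eq_iff)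

lemma section_rooted:
  assumes "\<sigma> permutes {1..d}" "h \<in> {1..d} \<rightarrow> carrier (AutT d)" and "x \<in> {1..d}"
  shows "section_at d (rooted d \<sigma> h) [x] = h x"
proof
  fix w show "section_at d (rooted d \<sigma> h) [x] w = h x w"
    using AutT_permutes[OF funcset_mem[OF assms(2,3)]] assms(3)
    by (auto simp: section_at_def rooted_Cons permutes_def)
qed

lemma label_rooted_Cons:
  assumes "\<sigma> permutes {1..d}" "h \<in> {1..d} \<rightarrow> carrier (AutT d)"
    and "x \<in> {1..d}" "w \<in> tree d"
  shows "label d (rooted d \<sigma> h) (x # w) = label d (h x) w"
  using label_section[OF rooted_AutT[OF assms(1,2)], of "[x]" w] section_rooted[OF assms(1-3)] assms(3,4)
  by simp

text \<open>Chain rule for labels: \<open>h\<close> carries \<open>v\<close> to \<open>h v\<close>,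
  and there \<open>g\<close> applies its own label.\<close>

lemma label_comp:
  assumes g: "g \<in> carrier (AutT d)" and h: "h \<in> carrier (AutT d)" and v: "v \<in> tree d"
  shows "label d (g \<circ> h) v = label d g (h v) \<circ> label d h v"
proof
  fix x
  show "label d (g \<circ> h) v x = (label d g (h v) \<circ> label d h v) x"
  proof (cases "x \<in> {1..d}")
    case True
    have hv: "h v \<in> tree d" using AutT_in_tree[OF h] v by simp
    have lx: "label d h v x \<in> {1..d}" using permutes_in_image[OF label_permutes[OF h v]] True by simp
    have "(g \<circ> h) v @ [label d (g \<circ> h) v x] = (g \<circ> h) (v @ [x])"
      using AutT_snoc_label[OF AutT_comp[OF g h] v True] by simp
    also have "\<dots> = (g \<circ> h) v @ [label d g (h v) (label d h v x)]"
      using AutT_snoc_label[OF g hv lx] AutT_snoc_label[OF h v True] by simp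
    finally show ?thesis by simp
  qed (use permutes_not_in[OF label_permutes[OF g, of "h v"]] v AutT_in_tree[OF h] in \<open>auto simp: label_def\<close>)
qed

lemma label_id: "v \<in> tree d \<Longrightarrow> label d id v = id"
  by (auto simp: label_def section_at_def fun_eq_iff)

lemma label_inv:
  assumes g: "g \<in> carrier (AutT d)" and v: "v \<in> tree d"
  shows "label d (inv\<^bsub>AutT d\<^esub> g) v = inv_into UNIV (label d g ((inv\<^bsub>AutT d\<^esub> g) v))"
proof -
  interpret A: group "AutT d" by (rule group_AutT)
  let ?i = "inv\<^bsub>AutT d\<^esub> g"
  have i: "?i \<in> carrier (AutT d)" using g by simp
  have "g \<circ> ?i = id" using A.r_inv[OF g] by simp
  then have "label d g (?i v) \<circ> label d ?i v = id"
    using label_comp[OF g i v] label_id[OF v] by simp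
  moreover have "bij (label d g (?i v))"
    using label_permutes[OF g, of "?i v"] AutT_in_tree[OF i] v permutes_bij by blast
  ultimately show ?thesis
    by (metis bij_is_inj comp_id fun.map_comp inv_o_cancel id_comp)
qed

subsection \<open>Automorphisms with labels in a given set\<close>

text \<open>\<open>K\<close> is an arbitrary set because the main use is for cosets of
  \<open>Q\<close>, which need not be groups; \<open>Q\<close> itself and the full symmetric group
  are other instances.\<close>

definition labelled :: "nat \<Rightarrow> (nat \<Rightarrow> nat) set \<Rightarrow> (nat list \<Rightarrow> nat list) set" where
  "labelled d K = {g \<in> carrier (AutT d). \<forall>v\<in>tree d. label d g v \<in> K}"

lemma labelled_AutT: "g \<in> labelled d K \<Longrightarrow> g \<in> carrier (AutT d)"
  by (simp add: labelled_def)

text \<open>Lets the congruence quotients of the full automorphism group be counted by the same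
  formula as those of the cosets.\<close>

lemma carrier_AutT_eq_labelled: "carrier (AutT d) = labelled d {\<sigma>. \<sigma> permutes {1..d}}"
  by (auto simp: labelled_def label_permutes)

lemma section_labelled:
  "g \<in> labelled d K \<Longrightarrow> v \<in> tree d \<Longrightarrow> section_at d g v \<in> labelled d K"
  by (auto simp: labelled_def section_at_AutT label_section)

lemma rooted_labelled:
  assumes "\<sigma> \<in> K" "\<sigma> permutes {1..d}" "h \<in> {1..d} \<rightarrow> labelled d K"
  shows "rooted d \<sigma> h \<in> labelled d K"
proof -
  have h: "h \<in> {1..d} \<rightarrow> carrier (AutT d)" using assms(3) labelled_AutT by blast
  have "label d (rooted d \<sigma> h) v \<in> K" if "v \<in> tree d" for v
    using that assms label_rooted_Cons[OF assms(2) h]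
    by (cases v) (auto simp: label_rooted_Nil labelled_def Pi_def)
  then show ?thesis using rooted_AutT[OF assms(2) h] by (simp add: labelled_def)
qed

lemma labelled_mono: "K \<subseteq> L \<Longrightarrow> labelled d K \<subseteq> labelled d L"
  by (auto simp: labelled_def)

text \<open>Acting letter by letter gives an automorphism with constant label; it witnesses
  \<open>labelled_nonempty\<close>.\<close>

lemma map_labelled:
  assumes \<sigma>: "\<sigma> permutes {1..d}"
  defines "g \<equiv> (\<lambda>v. if v \<in> tree d then map \<sigma> v else v)"
  shows "g \<in> labelled d {\<sigma>}"
proof -
  have td: "map \<sigma> v \<in> tree d \<longleftrightarrow> v \<in> tree d" for v
    using permutes_in_image[OF \<sigma>] by (auto simp: tree_def in_lists_conv_set)
  have bj: "bij_betw g (tree d) (tree d)"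
  proof (intro bij_betw_imageI inj_onI equalityI subsetI)
    fix u v assume "u \<in> tree d" "v \<in> tree d" "g u = g v"
    then show "u = v" using permutes_inj[OF \<sigma>] by (simp add: g_def inj_map_eq_map)
  next
    fix v assume v: "v \<in> tree d"
    have "map \<sigma> (map (inv_into UNIV \<sigma>) v) = v"
      using permutes_inverses[OF \<sigma>] by (simp add: comp_def)
    with v show "v \<in> g ` tree d"
      using td[of "map (inv_into UNIV \<sigma>) v"]
      by (intro image_eqI[of _ _ "map (inv_into UNIV \<sigma>) v"]) (auto simp: g_def)
  qed (auto simp: g_def td)
  have adj: "adjacent (map \<sigma> u) (map \<sigma> v) \<longleftrightarrow> adjacent u v" for u v
  proof (induction u arbitrary: v)
    case (Cons a u)
    then show ?case using permutes_inj[OF \<sigma>] by (cases v) (auto simp: inj_eq)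
  qed auto
  have "g permutes tree d" using bj by (rule bij_imp_permutes) (simp add: g_def)
  then have gA: "g \<in> carrier (AutT d)"
    unfolding AutT_def using adj by (auto simp: g_def)
  moreover have "label d g v = \<sigma>" if v: "v \<in> tree d" for v
  proof
    fix x show "label d g v x = \<sigma> x"
    proof (cases "x \<in> {1..d}")
      case True
      then show ?thesis using AutT_snoc_label[OF gA v True] v by (auto simp: g_def split: if_splits)
    qed (auto simp: label_def permutes_not_in[OF \<sigma>])
  qed
  ultimately show ?thesis by (simp add: labelled_def)
qed

section \<open>Counting actions on a level and those without fixed vertices\<close>

text \<open>A concrete model of the image under the level projection: restrictions are extensional,
  so two of them are equal iff the automorphisms agree on level \<open>n\<close>.\<close>

definition acts :: "nat \<Rightarrow> nat \<Rightarrow> (nat list \<Rightarrow> nat list) set \<Rightarrow> (nat list \<Rightarrow> nat list) set" where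
  "acts d n G = (\<lambda>g. restrict g (level d n)) ` G"

text \<open>The complement of the event of interest is counted because the absence of fixed vertices
  is a conjunction over subtrees and therefore multiplies.\<close>

definition fixfree :: "nat \<Rightarrow> nat \<Rightarrow> (nat list \<Rightarrow> nat list) set \<Rightarrow> (nat list \<Rightarrow> nat list) set" where
  "fixfree d n G = {f \<in> acts d n G. \<forall>v\<in>level d n. f v \<noteq> v}"

text \<open>Labels at different vertices are chosen independently in \<open>K\<close>, so an action
  on level \<open>n + 1\<close> is a free choice of a root label and of \<open>d\<close> actions on
  level \<open>n\<close>.\<close>

lemma acts_Suc_bij:
  assumes K: "K \<subseteq> {\<sigma>. \<sigma> permutes {1..d}}"
  shows "bij_betw (\<lambda>(\<sigma>, h). restrict (rooted d \<sigma> h) (level d (Suc n)))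
    (K \<times> (\<Pi>\<^sub>E x\<in>{1..d}. acts d n (labelled d K))) (acts d (Suc n) (labelled d K))"
  (is "bij_betw ?F ?S ?T")
proof (intro bij_betw_imageI inj_onI equalityI subsetI)
  fix a b assume a: "a \<in> ?S" and b: "b \<in> ?S" and e: "?F a = ?F b"
  obtain \<sigma> h \<tau> k where ab: "a = (\<sigma>, h)" "b = (\<tau>, k)" by fastforce
  have \<sigma>: "\<sigma> \<in> K" and \<tau>: "\<tau> \<in> K"
    and h: "h \<in> (\<Pi>\<^sub>E x\<in>{1..d}. acts d n (labelled d K))"
    and k: "k \<in> (\<Pi>\<^sub>E x\<in>{1..d}. acts d n (labelled d K))" using a b ab by auto
  have e': "\<sigma> x = \<tau> x \<and> h x w = k x w" if "x \<in> {1..d}" "w \<in> level d n" for x w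
    using fun_cong[OF e, of "x # w"] that level_subset_tree[of d n]
    by (auto simp: ab rooted_Cons subset_iff)
  \<comment> \<open>The root label is recovered from the first letters of words on level
    \<open>n + 1\<close>, which requires a word below each letter.\<close>
  have ex: "\<exists>w. w \<in> level d n" if "x \<in> {1..d}" for x
    by (rule exI[of _ "replicate n x"]) (use that in \<open>auto simp: level_def tree_def\<close>)
  have "\<sigma> x = \<tau> x" for x
    using ex[of x] e'[of x] subsetD[OF K \<sigma>] subsetD[OF K \<tau>] by (cases "x \<in> {1..d}") (auto simp: permutes_def)
  moreover have "h x w = k x w" for x w
  proof (cases "x \<in> {1..d}")
    case True
    then have "h x \<in> extensional (level d n)" "k x \<in> extensional (level d n)"
      using h k by (auto simp: acts_def PiE_def Pi_def)
    then show ?thesis using e'[OF True, of w] by (cases "w \<in> level d n") (auto simp: extensional_def)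
  qed (use h k in \<open>auto simp: PiE_def extensional_def\<close>)
  ultimately show "a = b" by (auto simp: ab fun_eq_iff)
next
  fix f assume "f \<in> ?F ` ?S"
  then obtain \<sigma> h where f: "f = restrict (rooted d \<sigma> h) (level d (Suc n))" and \<sigma>: "\<sigma> \<in> K"
    and h: "h \<in> (\<Pi>\<^sub>E x\<in>{1..d}. acts d n (labelled d K))" by auto
  have "\<forall>x\<in>{1..d}. \<exists>g. g \<in> labelled d K \<and> h x = restrict g (level d n)"
    using h by (auto simp: acts_def PiE_def Pi_def)
  then obtain g where g: "\<And>x. x \<in> {1..d} \<Longrightarrow> g x \<in> labelled d K"
    "\<And>x. x \<in> {1..d} \<Longrightarrow> h x = restrict (g x) (level d n)" by metis
  have "f = restrict (rooted d \<sigma> g) (level d (Suc n))"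
    unfolding f using g(2) level_subset_tree[of d n]
    by (intro restrict_ext) (auto simp: level_Suc rooted_Cons subset_iff)
  then show "f \<in> ?T"
    using rooted_labelled[OF \<sigma>, of d g] subsetD[OF K \<sigma>] g(1) by (auto simp: acts_def)
next
  fix f assume "f \<in> ?T"
  then obtain g where g: "g \<in> labelled d K" "f = restrict g (level d (Suc n))"
    by (auto simp: acts_def)
  let ?h = "\<lambda>x\<in>{1..d}. restrict (section_at d g [x]) (level d n)"
  have "f = restrict (rooted d (label d g []) (\<lambda>x. section_at d g [x])) (level d (Suc n))"
    using AutT_eq_rooted[OF labelled_AutT[OF g(1)]] g(2) by simp
  also have "\<dots> = ?F (label d g [], ?h)"
    unfolding prod.case using level_subset_tree[of d n]
    by (intro restrict_ext) (auto simp: level_Suc rooted_Cons subset_iff)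
  finally have "f = ?F (label d g [], ?h)" .
  moreover have "label d g [] \<in> K" using g(1) by (simp add: labelled_def)
  moreover have "?h \<in> (\<Pi>\<^sub>E x\<in>{1..d}. acts d n (labelled d K))"
    using section_labelled[OF g(1)] by (auto simp: acts_def)
  ultimately show "f \<in> ?F ` ?S" by blast
qed

text \<open>A vertex below \<open>x\<close> can be fixed only if the root label fixes
  \<open>x\<close>, so only the sections at fixed letters are constrained.\<close>

lemma fixfree_rooted_iff:
  "(\<forall>v\<in>level d (Suc n). rooted d \<sigma> h v \<noteq> v) \<longleftrightarrow>
   (\<forall>x\<in>{1..d}. \<sigma> x = x \<longrightarrow> (\<forall>w\<in>level d n. h x w \<noteq> w))"
proof -
  have "rooted d \<sigma> h (x # w) \<noteq> x # w \<longleftrightarrow> (\<sigma> x = x \<longrightarrow> h x w \<noteq> w)" if "x \<in> {1..d}" "w \<in> level d n" for x w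
    using that level_subset_tree[of d n] by (auto simp: rooted_Cons)
  then show ?thesis unfolding level_Suc by blast
qed

definition fixpts :: "nat \<Rightarrow> (nat \<Rightarrow> nat) \<Rightarrow> nat set" where
  "fixpts d \<sigma> = {x \<in> {1..d}. \<sigma> x = x}"

lemma card_acts_Suc:
  assumes K: "K \<subseteq> {\<sigma>. \<sigma> permutes {1..d}}"
  shows "card (acts d (Suc n) (labelled d K)) = card K * card (acts d n (labelled d K)) ^ d"
  using bij_betw_same_card[OF acts_Suc_bij[OF K, where n=n]]
  by (simp add: card_cartesian_product card_PiE)

text \<open>Sections at fixed letters must be free of fixed vertices, the remaining ones are
  arbitrary. Divided by \<open>card_acts_Suc\<close>, this is the generating function of the
  offspring law.\<close>

lemma card_fixfree_Suc:
  assumes K: "K \<subseteq> {\<sigma>. \<sigma> permutes {1..d}}" and fin: "finite K"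
    and finA: "finite (acts d n (labelled d K))"
  shows "card (fixfree d (Suc n) (labelled d K)) =
    (\<Sum>\<sigma>\<in>K. card (fixfree d n (labelled d K)) ^ card (fixpts d \<sigma>) *
            card (acts d n (labelled d K)) ^ (d - card (fixpts d \<sigma>)))"
proof -
  let ?A = "acts d n (labelled d K)" and ?E = "fixfree d n (labelled d K)"
  let ?S = "SIGMA \<sigma>:K. \<Pi>\<^sub>E x\<in>{1..d}. if \<sigma> x = x then ?E else ?A"
  let ?F = "\<lambda>(\<sigma>, h). restrict (rooted d \<sigma> h) (level d (Suc n))"
  have EA: "?E \<subseteq> ?A" by (auto simp: fixfree_def)
  note bij = acts_Suc_bij[OF K, where n=n]
  have S: "?S = {(\<sigma>, h) \<in> K \<times> (\<Pi>\<^sub>E x\<in>{1..d}. ?A).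
      \<forall>x\<in>{1..d}. \<sigma> x = x \<longrightarrow> (\<forall>w\<in>level d n. h x w \<noteq> w)}" (is "_ = ?S'")
    by (auto simp: fixfree_def PiE_def Pi_def split: if_splits)
  have "fixfree d (Suc n) (labelled d K) =
      {f \<in> ?F ` (K \<times> (\<Pi>\<^sub>E x\<in>{1..d}. ?A)). \<forall>v\<in>level d (Suc n). f v \<noteq> v}"
    using bij by (simp add: fixfree_def bij_betw_def)
  also have "\<dots> = ?F ` ?S'"
    using fixfree_rooted_iff[of d n] by (auto simp: image_iff) (metis (no_types, lifting) restrict_apply)+
  finally have "fixfree d (Suc n) (labelled d K) = ?F ` ?S" using S by simp
  moreover have "inj_on ?F ?S"
    unfolding S by (rule inj_on_subset[OF bij_betw_imp_inj_on[OF bij]]) auto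
  ultimately have "card (fixfree d (Suc n) (labelled d K)) = card ?S" by (simp add: card_image)
  also have "\<dots> = (\<Sum>\<sigma>\<in>K. card (\<Pi>\<^sub>E x\<in>{1..d}. if \<sigma> x = x then ?E else ?A))"
    using fin finA finite_subset[OF EA finA] by (intro card_SigmaI) (auto intro!: finite_PiE)
  also have "\<dots> = (\<Sum>\<sigma>\<in>K. card ?E ^ card (fixpts d \<sigma>) * card ?A ^ (d - card (fixpts d \<sigma>)))"
  proof (rule sum.cong)
    fix \<sigma>
    have "card (\<Pi>\<^sub>E x\<in>{1..d}. if \<sigma> x = x then ?E else ?A)
        = (\<Prod>x\<in>{1..d}. if \<sigma> x = x then card ?E else card ?A)"
      by (simp add: card_PiE if_distrib[of card])
    also have "\<dots> = card ?E ^ card (fixpts d \<sigma>) * card ?A ^ card ({1..d} \<inter> - {x. \<sigma> x = x})"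
    proof -
      have "{1..d} \<inter> {x. \<sigma> x = x} = fixpts d \<sigma>" by (auto simp: fixpts_def)
      then show ?thesis by (simp add: prod.If_cases)
    qed
    also have "{1..d} \<inter> - {x. \<sigma> x = x} = {1..d} - fixpts d \<sigma>" by (auto simp: fixpts_def)
    also have "card \<dots> = d - card (fixpts d \<sigma>)"
      by (subst card_Diff_subset) (auto simp: fixpts_def)
    finally show "card (\<Pi>\<^sub>E x\<in>{1..d}. if \<sigma> x = x then ?E else ?A) =
      card ?E ^ card (fixpts d \<sigma>) * card ?A ^ (d - card (fixpts d \<sigma>))" .
  qed simp
  finally show ?thesis .
qed

lemma card_acts_0: "labelled d K \<noteq> {} \<Longrightarrow> card (acts d 0 (labelled d K)) = 1"
proof -
  assume ne: "labelled d K \<noteq> {}"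
  have "acts d 0 (labelled d K) = {\<lambda>x\<in>{[]}. []}"
  proof -
    have "restrict g {[]} = (\<lambda>x\<in>{[]}. [])" if "g \<in> labelled d K" for g
      using AutT_Nil[OF labelled_AutT[OF that]] by (intro restrict_ext) auto
    then show ?thesis using ne by (auto simp: acts_def)
  qed
  then show ?thesis by simp
qed

lemma labelled_nonempty: "\<sigma> \<in> K \<Longrightarrow> \<sigma> permutes {1..d} \<Longrightarrow> labelled d K \<noteq> {}"
  using map_labelled[of \<sigma> d] labelled_mono[of "{\<sigma>}" K d] by blast

text \<open>The exponent is the number of vertices on levels below \<open>n\<close>, each of which
  carries one independent label from \<open>K\<close>.\<close>

lemma card_acts:
  assumes K: "K \<subseteq> {\<sigma>. \<sigma> permutes {1..d}}" and ne: "K \<noteq> {}"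
  shows "card (acts d n (labelled d K)) = card K ^ (\<Sum>i<n. d ^ i)"
proof (induction n)
  case 0
  show ?case using card_acts_0 labelled_nonempty ne K by fastforce
next
  case (Suc n)
  have "(\<Sum>i<Suc n. d ^ i) = Suc ((\<Sum>i<n. d ^ i) * d)"
    by (subst sum.lessThan_Suc_shift) (simp add: sum_distrib_left mult.commute)
  then show ?case using Suc card_acts_Suc[OF K] by (simp add: power_mult)
qed

text \<open>Infinite sets have cardinality 0, so the positive count in \<open>card_acts\<close>
  already yields finiteness.\<close>

lemma finite_acts:
  assumes K: "K \<subseteq> {\<sigma>. \<sigma> permutes {1..d}}" and ne: "K \<noteq> {}" and fin: "finite K"
  shows "finite (acts d n (labelled d K))"
proof (rule card_ge_0_finite)
  show "card (acts d n (labelled d K)) > 0"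
    unfolding card_acts[OF K ne] using fin ne by (simp add: card_gt_0_iff)
qed

section \<open>A critical Galton--Watson recursion\<close>

text \<open>The power function lies above its tangent at 1.\<close>

lemma power_ge_Bernoulli:
  fixes t :: real
  assumes "0 \<le> t"
  shows "1 - real k * (1 - t) \<le> t ^ k"
  using Bernoulli_inequality[of "t - 1" k] assms by (simp add: algebra_simps)

text \<open>Multiplying the tangent bound for exponent \<open>k - 1\<close> by \<open>t\<close>
  beats the bound for \<open>k\<close> by \<open>(k - 1) * (1 - t)^2\<close>.\<close>

lemma power_gt_Bernoulli:
  fixes t :: real
  assumes "0 \<le> t" "t < 1" "k \<ge> 2"
  shows "1 - real k * (1 - t) < t ^ k"
proof -
  obtain j where k: "k = Suc j" "j \<ge> 1" using assms(3) by (cases k) auto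
  have "1 - real k * (1 - t) < 1 - real k * (1 - t) + real j * (1 - t)\<^sup>2"
    using assms k by simp
  also have "\<dots> = t * (1 - real j * (1 - t))"
    by (simp add: k power2_eq_square algebra_simps)
  also have "\<dots> \<le> t ^ k"
    using mult_left_mono[OF power_ge_Bernoulli[OF assms(1), of j] assms(1)] k by simp
  finally show ?thesis .
qed

text \<open>\<open>q n\<close> is the probability of extinction by generation \<open>n\<close>,
  obtained by iterating the generating function from 0. With mean 1 the averaged tangent at 1 is the
  diagonal, so \<open>q\<close> increases to a fixed point; one offspring number of at least 2 puts
  the function strictly above the diagonal on \<open>[0, 1)\<close>, leaving 1 as the only possible
  limit.\<close>

lemma critical_extinction_limit:
  fixes k :: "'a \<Rightarrow> nat" and q :: "nat \<Rightarrow> real"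
  assumes fin: "finite K" and ne: "K \<noteq> {}" and mean: "(\<Sum>\<sigma>\<in>K. k \<sigma>) = card K"
    and q0: "q 0 = 0" and qS: "\<And>n. q (Suc n) = (\<Sum>\<sigma>\<in>K. q n ^ k \<sigma>) / real (card K)"
  shows "q \<longlonglongrightarrow> (if \<forall>\<sigma>\<in>K. k \<sigma> = 1 then 0 else 1)"
proof (cases "\<forall>\<sigma>\<in>K. k \<sigma> = 1")
  case True
  have "q n = 0" for n
    by (induction n) (use True q0 qS in auto)
  then have "q = (\<lambda>_. 0)" by auto
  then show ?thesis using True by simp
next
  case False
  have c: "real (card K) > 0" using fin ne by (simp add: card_gt_0_iff)
  \<comment> \<open>Criticality: the tangent bounds at 1 average to exactly
    \<open>t\<close>.\<close>
  have lower: "(\<Sum>\<sigma>\<in>K. 1 - real (k \<sigma>) * (1 - t)) = real (card K) * t" for t :: real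
  proof -
    have "(\<Sum>\<sigma>\<in>K. 1 - real (k \<sigma>) * (1 - t)) = real (card K) - real (\<Sum>\<sigma>\<in>K. k \<sigma>) * (1 - t)"
      by (simp add: sum_subtractf sum_distrib_right[symmetric])
    then show ?thesis unfolding mean by (simp add: algebra_simps)
  qed
  have bounds: "0 \<le> q n \<and> q n \<le> 1" for n
  proof (induction n)
    case (Suc n)
    have "(\<Sum>\<sigma>\<in>K. q n ^ k \<sigma>) \<le> (\<Sum>\<sigma>\<in>K. 1)"
      by (rule sum_mono) (use Suc in \<open>auto intro: power_le_one\<close>)
    moreover have "0 \<le> (\<Sum>\<sigma>\<in>K. q n ^ k \<sigma>)"
      by (rule sum_nonneg) (use Suc in auto)
    ultimately show ?case using c by (simp add: qS)
  qed (use q0 in auto)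
  have "incseq q"
  proof (rule incseq_SucI)
    fix n
    have "real (card K) * q n \<le> (\<Sum>\<sigma>\<in>K. q n ^ k \<sigma>)"
      unfolding lower[symmetric] by (rule sum_mono) (use bounds power_ge_Bernoulli in auto)
    then show "q n \<le> q (Suc n)" using c by (simp add: qS field_simps)
  qed
  then obtain L where L: "q \<longlonglongrightarrow> L" "\<And>n. q n \<le> L"
    using bounds incseq_convergent[of q 1] by auto
  have L01: "0 \<le> L" "L \<le> 1"
    using L bounds by (auto intro: order_trans LIMSEQ_le_const2)
  have "(\<lambda>n. (\<Sum>\<sigma>\<in>K. q n ^ k \<sigma>) / real (card K)) \<longlonglongrightarrow> (\<Sum>\<sigma>\<in>K. L ^ k \<sigma>) / real (card K)"
    using c by (intro tendsto_intros L(1)) auto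
  moreover have "(\<lambda>n. (\<Sum>\<sigma>\<in>K. q n ^ k \<sigma>) / real (card K)) \<longlonglongrightarrow> L"
    using LIMSEQ_Suc[OF L(1)] by (simp add: qS)
  ultimately have fixpoint: "(\<Sum>\<sigma>\<in>K. L ^ k \<sigma>) = real (card K) * L"
    using c LIMSEQ_unique by (fastforce simp: field_simps)
  \<comment> \<open>Numbers with average 1 that are not all 1 cannot all be at most 1.\<close>
  obtain \<tau> where \<tau>: "\<tau> \<in> K" "k \<tau> \<ge> 2"
  proof (rule ccontr)
    assume "\<not> thesis"
    with that have le: "\<And>\<sigma>. \<sigma> \<in> K \<Longrightarrow> k \<sigma> \<le> 1" by fastforce
    with False obtain \<sigma> where "\<sigma> \<in> K" "k \<sigma> < 1" by (metis nat_less_le)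
    then have "(\<Sum>\<sigma>\<in>K. k \<sigma>) < (\<Sum>\<sigma>\<in>K. 1)"
      using fin le by (intro sum_strict_mono_ex1) auto
    then show False using mean by simp
  qed
  have "L = 1"
  proof (rule ccontr)
    assume "L \<noteq> 1"
    then have "(\<Sum>\<sigma>\<in>K. 1 - real (k \<sigma>) * (1 - L)) < (\<Sum>\<sigma>\<in>K. L ^ k \<sigma>)"
      using fin L01 \<tau> power_ge_Bernoulli power_gt_Bernoulli
      by (intro sum_strict_mono_ex1) (auto intro!: bexI[of _ \<tau>])
    then show False using fixpoint lower by simp
  qed
  then show ?thesis using L False by auto
qed

section \<open>Congruence quotients as sets of restrictions\<close>

text \<open>Maps with the same fibres have equally large images; this replaces cosets by
  restrictions in every count.\<close>

lemma card_image_eq_card_image: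
  assumes "\<And>x y. x \<in> A \<Longrightarrow> y \<in> A \<Longrightarrow> f x = f y \<longleftrightarrow> g x = g y"
  shows "card (f ` A) = card (g ` A)"
proof -
  have "bij_betw (\<lambda>y. g (inv_into A f y)) (f ` A) (g ` A)"
  proof (intro bij_betw_imageI inj_onI equalityI subsetI)
    fix a b assume "a \<in> f ` A" "b \<in> f ` A" "g (inv_into A f a) = g (inv_into A f b)"
    then show "a = b" using assms inv_into_into[of _ f A] f_inv_into_f[of _ f A] by metis
  next
    fix z assume "z \<in> g ` A"
    then obtain x where x: "x \<in> A" "z = g x" by blast
    have "g (inv_into A f (f x)) = g x"
      using x assms inv_into_into[of "f x" f A] f_inv_into_f[of "f x" f A] by blast
    with x show "z \<in> (\<lambda>y. g (inv_into A f y)) ` f ` A" by force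
  qed (auto intro: inv_into_into)
  then show ?thesis by (rule bij_betw_same_card)
qed

lemma finite_image_factor:
  assumes "finite (f ` A)" "\<And>x y. x \<in> A \<Longrightarrow> y \<in> A \<Longrightarrow> f x = f y \<Longrightarrow> g x = g y"
  shows "finite (g ` A)"
proof -
  have "g x = g (inv_into A f (f x))" if "x \<in> A" for x
    using that assms(2) inv_into_into[of "f x" f A] f_inv_into_f[of "f x" f A] by (metis imageI)
  then have "g ` A \<subseteq> (\<lambda>y. g (inv_into A f y)) ` f ` A" by blast
  then show ?thesis using assms(1) finite_subset by blast
qed

lemma AutT_inv:
  assumes g: "g \<in> carrier (AutT d)"
  shows "inv\<^bsub>AutT d\<^esub> g = inv_into UNIV g"
proof -
  interpret A: group "AutT d" by (rule group_AutT)
  have "g \<circ> inv\<^bsub>AutT d\<^esub> g = id" using A.r_inv[OF g] by simp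
  then have "g ((inv\<^bsub>AutT d\<^esub> g) x) = x" for x by (simp add: fun_eq_iff)
  then show ?thesis
    by (intro ext sym[OF inv_f_eq[OF permutes_inj[OF AutT_permutes[OF g]]]])
qed

lemma subgroup_AutTI:
  assumes "H \<subseteq> carrier (AutT d)" "id \<in> H" "\<And>g h. g \<in> H \<Longrightarrow> h \<in> H \<Longrightarrow> g \<circ> h \<in> H"
    "\<And>g. g \<in> H \<Longrightarrow> inv_into UNIV g \<in> H"
  shows "subgroup H (AutT d)"
  using assms AutT_inv[of _ d] by (intro subgroup.intro) (auto simp: subset_iff)

lemma subgroup_level_stabilizer: "subgroup (level_stabilizer d n) (AutT d)"
proof (rule subgroup_AutTI)
  fix g assume g: "g \<in> level_stabilizer d n"
  then have gA: "g \<in> carrier (AutT d)" by (simp add: level_stabilizer_def)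
  have "inv_into UNIV g v = v" if "v \<in> level d n" for v
    using g that permutes_inverses(2)[OF AutT_permutes[OF gA], of v] by (simp add: level_stabilizer_def)
  moreover have "inv_into UNIV g \<in> carrier (AutT d)"
    using group.inv_closed[OF group_AutT gA] AutT_inv[OF gA] by simp
  ultimately show "inv_into UNIV g \<in> level_stabilizer d n" by (simp add: level_stabilizer_def)
qed (auto simp: level_stabilizer_def AutT_comp AutT_id)

lemma level_proj_eq_iff:
  assumes g: "g \<in> carrier (AutT d)" and h: "h \<in> carrier (AutT d)"
  shows "level_proj d n g = level_proj d n h \<longleftrightarrow> restrict g (level d n) = restrict h (level d n)"
proof
  interpret A: group "AutT d" by (rule group_AutT)
  note S = subgroup_level_stabilizer[of d n]
  {
    assume "level_proj d n g = level_proj d n h"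
    then have "g \<in> level_stabilizer d n #>\<^bsub>AutT d\<^esub> h"
      using A.rcos_self[OF g S] by (simp add: level_proj_def)
    then obtain s where "s \<in> level_stabilizer d n" "g = s \<circ> h" by (auto simp: r_coset_def)
    then show "restrict g (level d n) = restrict h (level d n)"
      using AutT_in_level[OF h] by (intro restrict_ext) (auto simp: level_stabilizer_def)
  }
  assume e: "restrict g (level d n) = restrict h (level d n)"
  let ?s = "g \<otimes>\<^bsub>AutT d\<^esub> inv\<^bsub>AutT d\<^esub> h"
  have hi: "inv_into UNIV h v \<in> level d n" if "v \<in> level d n" for v
    using AutT_in_level[OF A.inv_closed[OF h] that] AutT_inv[OF h] by simp
  have "?s v = v" if "v \<in> level d n" for v
    using fun_cong[OF e, of "inv_into UNIV h v"] hi[OF that]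
      permutes_inverses(1)[OF AutT_permutes[OF h]] by (simp add: AutT_inv[OF h])
  then have "?s \<in> level_stabilizer d n" using g h A.m_closed[OF g A.inv_closed[OF h]]
    by (auto simp: level_stabilizer_def)
  moreover have "g = ?s \<otimes>\<^bsub>AutT d\<^esub> h" using g h A.m_assoc[of g "inv\<^bsub>AutT d\<^esub> h" h] A.l_inv[OF h] by simp
  ultimately have "g \<in> level_stabilizer d n #>\<^bsub>AutT d\<^esub> h" unfolding r_coset_def by blast
  then show "level_proj d n g = level_proj d n h"
    unfolding level_proj_def using A.repr_independence[OF _ h S] by simp
qed

lemma card_level_proj:
  assumes "G \<subseteq> carrier (AutT d)"
  shows "card (level_proj d n ` G) = card (acts d n G)"
  unfolding acts_def using assms by (intro card_image_eq_card_image level_proj_eq_iff) auto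

text \<open>All representatives of a coset agree with \<open>g\<close> on level \<open>n\<close>, so
  fixing a vertex simultaneously means that \<open>g\<close> fixes it.\<close>

lemma fpp_seq_eq:
  assumes G: "G \<subseteq> carrier (AutT d)"
  shows "fpp_seq d G n = real (card (acts d n G - fixfree d n G)) / real (card (acts d n G))"
proof -
  let ?fix = "\<lambda>g. \<exists>v\<in>level d n. g v = v"
  have stab: "(\<forall>h\<in>level_proj d n g. h v = v) \<longleftrightarrow> g v = v" if g: "g \<in> G" and v: "v \<in> level d n" for g v
  proof -
    have gA: "g \<in> carrier (AutT d)" using g G by blast
    have "g \<in> level_proj d n g"
      unfolding level_proj_def
      using group.rcos_self[OF group_AutT gA subgroup_level_stabilizer] .
    moreover have "h v = g v" if "h \<in> level_proj d n g" for h
      using that AutT_in_level[OF gA v] by (auto simp: level_proj_def r_coset_def level_stabilizer_def)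
    ultimately show ?thesis by metis
  qed
  have "(\<exists>v\<in>level d n. \<forall>h\<in>level_proj d n g. h v = v) \<longleftrightarrow> ?fix g" if "g \<in> G" for g
    using stab[OF that] by blast
  then have "{C \<in> level_proj d n ` G. \<exists>v\<in>level d n. \<forall>g\<in>C. g v = v} = level_proj d n ` {g \<in> G. ?fix g}"
    by blast
  moreover have "card (level_proj d n ` {g \<in> G. ?fix g}) = card (acts d n {g \<in> G. ?fix g})"
    using G by (intro card_level_proj) auto
  moreover have "acts d n {g \<in> G. ?fix g} = acts d n G - fixfree d n G"
  proof -
    have "restrict g (level d n) \<in> fixfree d n G \<longleftrightarrow> \<not> ?fix g" if "g \<in> G" for g
      using that by (auto simp: fixfree_def acts_def)
    then show ?thesis by (auto simp: acts_def)
  qed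
  ultimately show ?thesis by (simp add: fpp_seq_def card_level_proj[OF G])
qed

section \<open>The groups \<open>G\<close> for a regular normal subgroup\<close>

lemma sym_group_permutes: "subgroup H (sym_group d) \<Longrightarrow> H \<subseteq> {\<sigma>. \<sigma> permutes {1..d}}"
  using subgroup.subset by (fastforce simp: sym_group_carrier)

lemma finite_subgroup_sym_group: "subgroup H (sym_group d) \<Longrightarrow> finite H"
  using sym_group_permutes finite_permutations[of "{1..d}"] finite_subset by blast

lemma subgroup_sym_groupD:
  assumes "subgroup H (sym_group d)"
  shows "id \<in> H" "\<And>g h. g \<in> H \<Longrightarrow> h \<in> H \<Longrightarrow> g \<circ> h \<in> H" "\<And>g. g \<in> H \<Longrightarrow> inv_into UNIV g \<in> H"
proof -
  show "id \<in> H" using subgroup.one_closed[OF assms] by (simp add: sym_group_one)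
  show "g \<circ> h \<in> H" if "g \<in> H" "h \<in> H" for g h
    using subgroup.m_closed[OF assms that] by (simp add: sym_group_mult)
  show "inv_into UNIV g \<in> H" if "g \<in> H" for g
    using subgroup.m_inv_closed[OF assms that] subgroup.mem_carrier[OF assms that] by simp
qed

lemma label_inv_into:
  assumes g: "g \<in> carrier (AutT d)" and v: "v \<in> tree d"
  shows "label d (inv_into UNIV g) v = inv_into UNIV (label d g (inv_into UNIV g v))"
  using label_inv[OF assms] by (simp add: AutT_inv[OF g])

lemma inv_into_AutT: "g \<in> carrier (AutT d) \<Longrightarrow> inv_into UNIV g \<in> carrier (AutT d)"
  using group.inv_closed[OF group_AutT] AutT_inv by fastforce

lemma subgroup_labelled:
  assumes H: "subgroup H (sym_group d)"
  shows "subgroup (labelled d H) (AutT d)"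
proof (rule subgroup_AutTI)
  note [simp] = subgroup_sym_groupD[OF H]
  show "id \<in> labelled d H" by (simp add: labelled_def AutT_id label_id)
  show "g \<circ> h \<in> labelled d H" if "g \<in> labelled d H" "h \<in> labelled d H" for g h
    using that by (auto simp: labelled_def AutT_comp label_comp AutT_in_tree)
  show "inv_into UNIV g \<in> labelled d H" if "g \<in> labelled d H" for g
    using that AutT_in_tree[OF inv_into_AutT, of g d]
    by (auto simp: labelled_def inv_into_AutT label_inv_into)
qed (use labelled_AutT in blast)

text \<open>The root label moves the first letter, and one automorphism that moves the remaining
  word is used as the section at all letters.\<close>

lemma labelled_level_transitive:
  assumes H: "subgroup H (sym_group d)" and trans: "transitive_on H {1..d}"
  shows "level_transitive d (labelled d H)"
  unfolding level_transitive_def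
proof
  fix n
  note id = subgroup.one_closed[OF subgroup_labelled[OF H], simplified]
  show "transitive_on (labelled d H) (level d n)"
  proof (induction n)
    case 0
    show ?case using bexI[OF _ id, of "\<lambda>g. g [] = []"] by (simp add: transitive_on_def)
  next
    case (Suc n)
    show ?case
      unfolding transitive_on_def
    proof (intro ballI)
      fix u v assume "u \<in> level d (Suc n)" "v \<in> level d (Suc n)"
      then obtain x u' y v' where uv: "u = x # u'" "v = y # v'" "x \<in> {1..d}" "y \<in> {1..d}"
        "u' \<in> level d n" "v' \<in> level d n" by (auto simp: level_Suc)
      obtain \<sigma> where \<sigma>: "\<sigma> \<in> H" "\<sigma> x = y" using trans uv unfolding transitive_on_def by blast
      obtain h where h: "h \<in> labelled d H" "h u' = v'" using Suc uv unfolding transitive_on_def by blast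
      have "rooted d \<sigma> (\<lambda>_. h) \<in> labelled d H"
        using \<sigma> h sym_group_permutes[OF H] by (intro rooted_labelled) auto
      moreover have "rooted d \<sigma> (\<lambda>_. h) u = v"
        using uv \<sigma> h level_subset_tree by (auto simp: rooted_Cons subset_iff)
      ultimately show "\<exists>g\<in>labelled d H. g u = v" by blast
    qed
  qed
qed

text \<open>An invariant \<open>f\<close> with finitely many values that separates the cosets bounds
  the index; below it is the root label.\<close>

lemma finite_index_subgroupI:
  assumes H: "subgroup H (AutT d)" and K: "subgroup K (AutT d)" and HK: "H \<subseteq> K"
    and fin: "finite (f ` K)"
    and f: "\<And>g h. g \<in> K \<Longrightarrow> h \<in> K \<Longrightarrow> f g = f h \<Longrightarrow> g \<circ> inv_into UNIV h \<in> H"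
  shows "finite_index_subgroup (AutT d) H K"
proof -
  interpret A: group "AutT d" by (rule group_AutT)
  have "H #>\<^bsub>AutT d\<^esub> g = H #>\<^bsub>AutT d\<^esub> h" if "g \<in> K" "h \<in> K" "f g = f h" for g h
  proof -
    have gh: "g \<in> carrier (AutT d)" "h \<in> carrier (AutT d)" using that subgroup.mem_carrier[OF K] by auto
    have "g = (g \<circ> inv_into UNIV h) \<circ> h"
      using permutes_inv_o(2)[OF AutT_permutes[OF gh(2)]] by (simp add: comp_assoc)
    then have "g \<in> H #>\<^bsub>AutT d\<^esub> h" using f[OF that] unfolding r_coset_def by auto
    then show ?thesis using A.repr_independence[OF _ gh(2) H] by simp
  qed
  then have "finite ((\<lambda>g. H #>\<^bsub>AutT d\<^esub> g) ` K)" using finite_image_factor[OF fin] by blast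
  moreover have "rcosets\<^bsub>AutT d\<lparr>carrier := K\<rparr>\<^esub> H = (\<lambda>g. H #>\<^bsub>AutT d\<^esub> g) ` K"
    by (auto simp: RCOSETS_def r_coset_def)
  ultimately show ?thesis
    unfolding finite_index_subgroup_def using A.subgroup_incl[OF H K HK] by simp
qed

section \<open>Label cosets of a regular normal subgroup\<close>

text \<open>Transitivity together with \<open>card Q = d\<close> says that \<open>Q\<close> acts
  regularly, and \<open>conj\<close> is normality spelled out for functions.\<close>

locale regular_pair =
  fixes d :: nat and Q P :: "(nat \<Rightarrow> nat) set"
  assumes d_pos: "d > 0"
    and Q: "subgroup Q (sym_group d)" and P: "subgroup P (sym_group d)" and QP: "Q \<subseteq> P"
    and conj: "\<And>p q. p \<in> P \<Longrightarrow> q \<in> Q \<Longrightarrow> p \<circ> q \<circ> inv_into UNIV p \<in> Q"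
    and trans: "transitive_on Q {1..d}" and card_Q: "card Q = d"
begin

text \<open>Right cosets, because the defining quotient of two labels of \<open>G\<close> has its
  inverse on the right.\<close>

definition coset :: "(nat \<Rightarrow> nat) \<Rightarrow> (nat \<Rightarrow> nat) set" where
  "coset \<sigma> = (\<lambda>q. q \<circ> \<sigma>) ` Q"

definition label_cosets :: "(nat \<Rightarrow> nat) set set" where
  "label_cosets = coset ` P"

lemmas Q_closed = subgroup_sym_groupD[OF Q] and P_closed = subgroup_sym_groupD[OF P]

lemma P_permutes: "p \<in> P \<Longrightarrow> p permutes {1..d}"
  using sym_group_permutes[OF P] by blast

lemma comp_inv_P: "p \<in> P \<Longrightarrow> p \<circ> inv_into UNIV p = id" "p \<in> P \<Longrightarrow> inv_into UNIV p \<circ> p = id"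
  using P_permutes permutes_inv_o by blast+

lemma coset_subset: "\<sigma> \<in> P \<Longrightarrow> coset \<sigma> \<subseteq> P"
  using P_closed QP by (auto simp: coset_def)

lemma mem_coset_iff:
  assumes \<sigma>: "\<sigma> \<in> P"
  shows "\<tau> \<in> coset \<sigma> \<longleftrightarrow> \<tau> \<circ> inv_into UNIV \<sigma> \<in> Q"
proof
  assume "\<tau> \<in> coset \<sigma>"
  then show "\<tau> \<circ> inv_into UNIV \<sigma> \<in> Q" using comp_inv_P[OF \<sigma>] by (auto simp: coset_def comp_assoc)
next
  assume "\<tau> \<circ> inv_into UNIV \<sigma> \<in> Q"
  moreover have "\<tau> = (\<tau> \<circ> inv_into UNIV \<sigma>) \<circ> \<sigma>" using comp_inv_P[OF \<sigma>] by (simp add: comp_assoc)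
  ultimately show "\<tau> \<in> coset \<sigma>" unfolding coset_def by blast
qed

lemma coset_eqI:
  assumes \<sigma>: "\<sigma> \<in> P" and \<tau>: "\<tau> \<in> coset \<sigma>"
  shows "coset \<tau> = coset \<sigma>"
proof -
  obtain q where q: "q \<in> Q" "\<tau> = q \<circ> \<sigma>" using \<tau> by (auto simp: coset_def)
  have "(\<lambda>p. p \<circ> q) ` Q = Q"
  proof (intro equalityI subsetI)
    fix p assume p: "p \<in> Q"
    have "p = (p \<circ> inv_into UNIV q) \<circ> q" using comp_inv_P q QP by (auto simp: comp_assoc)
    then show "p \<in> (\<lambda>p. p \<circ> q) ` Q" using Q_closed p q by blast
  qed (use Q_closed q in auto)
  moreover have "coset \<tau> = (\<lambda>p. p \<circ> \<sigma>) ` (\<lambda>p. p \<circ> q) ` Q"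
    by (simp add: coset_def q(2) image_image comp_assoc)
  ultimately show ?thesis by (simp add: coset_def)
qed

lemma label_cosets_disjoint:
  assumes "K \<in> label_cosets" "L \<in> label_cosets" "\<sigma> \<in> K" "\<sigma> \<in> L"
  shows "K = L"
  using assms coset_eqI unfolding label_cosets_def by blast

lemma class_permutes: "K \<in> label_cosets \<Longrightarrow> K \<subseteq> {\<sigma>. \<sigma> permutes {1..d}}"
  using coset_subset P_permutes by (auto simp: label_cosets_def)

lemma finite_label_cosets: "finite label_cosets"
  unfolding label_cosets_def using finite_subgroup_sym_group[OF P] by simp

lemma label_cosets_nonempty: "label_cosets \<noteq> {}"
  using P_closed(1) by (auto simp: label_cosets_def)

lemma inj_comp_right: "\<sigma> \<in> P \<Longrightarrow> inj_on (\<lambda>q. q \<circ> \<sigma>) A"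
proof (rule inj_onI)
  fix p q assume \<sigma>: "\<sigma> \<in> P" and "p \<circ> \<sigma> = q \<circ> \<sigma>"
  then have "p \<circ> \<sigma> \<circ> inv_into UNIV \<sigma> = q \<circ> \<sigma> \<circ> inv_into UNIV \<sigma>" by simp
  then show "p = q" using comp_inv_P[OF \<sigma>] by (simp add: comp_assoc)
qed

lemma card_class:
  assumes "K \<in> label_cosets" shows "card K = d"
  using assms card_image[OF inj_comp_right] card_Q by (auto simp: label_cosets_def coset_def)

lemma finite_class: "K \<in> label_cosets \<Longrightarrow> finite K"
  using card_class d_pos card_ge_0_finite[of K] by auto

lemma class_nonempty: "K \<in> label_cosets \<Longrightarrow> K \<noteq> {}"
  using card_class[of K] d_pos by auto

text \<open>Evaluation at \<open>x\<close> is onto by transitivity, hence injective, since both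
  sides have \<open>d\<close> elements.\<close>

lemma regular: "x \<in> {1..d} \<Longrightarrow> bij_betw (\<lambda>q. q x) Q {1..d}"
proof -
  assume x: "x \<in> {1..d}"
  have im: "(\<lambda>q. q x) ` Q = {1..d}"
  proof (intro equalityI subsetI)
    fix y assume "y \<in> (\<lambda>q. q x) ` Q"
    then show "y \<in> {1..d}" using x permutes_in_image[OF P_permutes] QP by auto
  next
    fix y assume "y \<in> {1..d}"
    then obtain q where "q \<in> Q" "q x = y" using trans x unfolding transitive_on_def by blast
    then show "y \<in> (\<lambda>q. q x) ` Q" by blast
  qed
  moreover have "inj_on (\<lambda>q. q x) Q"
    using im card_Q finite_subgroup_sym_group[OF Q] by (intro eq_card_imp_inj_on) auto
  ultimately show ?thesis by (simp add: bij_betw_def)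
qed

lemma card_regular:
  assumes "x \<in> {1..d}" "y \<in> {1..d}"
  shows "card {q \<in> Q. q x = y} = 1"
proof -
  obtain q where "q \<in> Q" "q x = y" using assms trans unfolding transitive_on_def by blast
  then have "{q \<in> Q. q x = y} = {q}"
    using bij_betw_imp_inj_on[OF regular[OF assms(1)]] by (auto dest: inj_onD)
  then show ?thesis by simp
qed

text \<open>Criticality by double counting: \<open>q \<circ> \<sigma>\<close> fixes \<open>x\<close>
  iff \<open>q\<close> sends \<open>\<sigma> x\<close> to \<open>x\<close>, which regularity grants
  to exactly one \<open>q\<close>.\<close>

lemma sum_card_fixpts:
  assumes K: "K \<in> label_cosets"
  shows "(\<Sum>\<sigma>\<in>K. card (fixpts d \<sigma>)) = card K"
proof -
  obtain \<sigma> where \<sigma>: "\<sigma> \<in> P" "K = coset \<sigma>" using K by (auto simp: label_cosets_def)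
  have one: "card {\<tau> \<in> K. \<tau> x = x} = 1" if "x \<in> {1..d}" for x
  proof -
    have "{\<tau> \<in> K. \<tau> x = x} = (\<lambda>q. q \<circ> \<sigma>) ` {q \<in> Q. q (\<sigma> x) = x}"
      by (auto simp: \<sigma> coset_def)
    then have "card {\<tau> \<in> K. \<tau> x = x} = card {q \<in> Q. q (\<sigma> x) = x}"
      using card_image[OF inj_comp_right[OF \<sigma>(1)]] by simp
    then show ?thesis using card_regular permutes_in_image[OF P_permutes[OF \<sigma>(1)]] that by simp
  qed
  have "(\<Sum>\<tau>\<in>K. card (fixpts d \<tau>)) = (\<Sum>\<tau>\<in>K. \<Sum>x\<in>{1..d}. of_bool (\<tau> x = x))"
    by (simp add: fixpts_def Int_def conj_commute)
  also have "\<dots> = (\<Sum>x\<in>{1..d}. \<Sum>\<tau>\<in>K. of_bool (\<tau> x = x))" by (rule sum.swap)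
  also have "\<dots> = (\<Sum>x\<in>{1..d}. card {\<tau> \<in> K. \<tau> x = x})"
    using finite_class[OF K] by (simp add: Int_def)
  finally show ?thesis using one card_class[OF K] by simp
qed

definition G :: "(nat list \<Rightarrow> nat list) set" where
  "G = GQP d Q P"

text \<open>Comparing every label with the root label puts all of them in one coset; conversely two
  elements of one coset differ by an element of \<open>Q\<close>.\<close>

lemma G_eq: "G = (\<Union>K\<in>label_cosets. labelled d K)"
proof (intro equalityI subsetI)
  have inv: "inv\<^bsub>sym_group d\<^esub> p = inv_into UNIV p" if "p \<in> P" for p
    using P_permutes[OF that] by (simp add: sym_group_carrier)
  {
    fix g assume "g \<in> G"
    then have g: "g \<in> carrier (AutT d)" "\<And>v. v \<in> tree d \<Longrightarrow> label d g v \<in> P"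
      "\<And>v. v \<in> tree d \<Longrightarrow> label d g v \<circ> inv_into UNIV (label d g []) \<in> Q"
      using inv by (auto simp: G_def GQP_def sym_group_mult)
    then have "g \<in> labelled d (coset (label d g []))" by (simp add: labelled_def mem_coset_iff)
    then show "g \<in> (\<Union>K\<in>label_cosets. labelled d K)" using g by (auto simp: label_cosets_def)
  next
    fix g assume "g \<in> (\<Union>K\<in>label_cosets. labelled d K)"
    then obtain \<sigma> where \<sigma>: "\<sigma> \<in> P" and g: "g \<in> labelled d (coset \<sigma>)" by (auto simp: label_cosets_def)
    then have P': "label d g v \<in> P" if "v \<in> tree d" for v
      using coset_subset that by (auto simp: labelled_def)
    have "label d g v \<circ> inv_into UNIV (label d g w) \<in> Q" if "v \<in> tree d" "w \<in> tree d" for v w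
      using g that coset_eqI[OF \<sigma>, of "label d g w"] mem_coset_iff[OF P'[OF that(2)], of "label d g v"]
      by (simp add: labelled_def)
    then show "g \<in> G" using g P' inv by (auto simp: G_def GQP_def sym_group_mult labelled_def)
  }
qed

lemma G_AutT: "G \<subseteq> carrier (AutT d)"
  using labelled_AutT by (auto simp: G_eq)

lemma G_iff:
  "g \<in> G \<longleftrightarrow> g \<in> carrier (AutT d) \<and> (\<forall>v\<in>tree d. label d g v \<in> P) \<and>
    (\<forall>v\<in>tree d. \<forall>w\<in>tree d. label d g v \<circ> inv_into UNIV (label d g w) \<in> Q)"
proof -
  have "inv\<^bsub>sym_group d\<^esub> p = inv_into UNIV p" if "p \<in> P" for p
    using P_permutes[OF that] by (simp add: sym_group_carrier)
  then show ?thesis by (auto simp: G_def GQP_def sym_group_mult)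
qed

lemma inv_comp_P:
  assumes "p \<in> P" "q \<in> P" shows "inv_into UNIV (p \<circ> q) = inv_into UNIV q \<circ> inv_into UNIV p"
  using assms P_permutes permutes_bij o_inv_distrib by blast

section \<open>The group and its branching subgroup\<close>

lemma subgroup_G: "subgroup G (AutT d)"
proof (rule subgroup_AutTI)
  show "id \<in> G" using AutT_id label_id P_closed(1) Q_closed(1) by (auto simp: G_iff)
next
  fix g h assume g: "g \<in> G" and h: "h \<in> G"
  have gA: "g \<in> carrier (AutT d)" and hA: "h \<in> carrier (AutT d)" using g h G_iff by auto
  have lP: "label d g v \<in> P" "label d h v \<in> P" if "v \<in> tree d" for v using that g h by (auto simp: G_iff)
  have "label d (g \<circ> h) v \<circ> inv_into UNIV (label d (g \<circ> h) w) \<in> Q" if v: "v \<in> tree d" and w: "w \<in> tree d" for v w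
  proof -
    have hv: "h v \<in> tree d" "h w \<in> tree d" using AutT_in_tree[OF hA] v w by auto
    let ?a = "label d g (h v)" and ?b = "label d g (h w)" and ?q = "label d h v \<circ> inv_into UNIV (label d h w)"
    have q: "?q \<in> Q" using h v w by (simp add: G_iff)
    have "label d (g \<circ> h) v \<circ> inv_into UNIV (label d (g \<circ> h) w) = ?a \<circ> ?q \<circ> inv_into UNIV ?b"
      using label_comp[OF gA hA] v w inv_comp_P lP hv by (simp add: comp_assoc)
    \<comment> \<open>Splitting off a conjugate of \<open>?q\<close> leaves a quotient of two labels
      of \<open>g\<close>; normality handles the first factor.\<close>
    also have "\<dots> = (?a \<circ> ?q \<circ> inv_into UNIV ?a) \<circ> (?a \<circ> inv_into UNIV ?b)"
      using comp_inv_P(2)[OF lP(1)[OF hv(1)]] by (metis comp_assoc comp_id)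
    also have "\<dots> \<in> Q" using Q_closed(2) conj[OF lP(1)[OF hv(1)] q] g hv by (auto simp: G_iff)
    finally show ?thesis .
  qed
  then show "g \<circ> h \<in> G"
    using AutT_comp[OF gA hA] label_comp[OF gA hA] lP AutT_in_tree[OF hA] P_closed(2) by (auto simp: G_iff)
next
  fix g assume g: "g \<in> G"
  have gA: "g \<in> carrier (AutT d)" using g G_iff by auto
  have lP: "label d g v \<in> P" if "v \<in> tree d" for v using that g by (auto simp: G_iff)
  have it: "inv_into UNIV g v \<in> tree d" if "v \<in> tree d" for v
    using AutT_in_tree[OF inv_into_AutT[OF gA]] that by simp
  have "label d (inv_into UNIV g) v \<circ> inv_into UNIV (label d (inv_into UNIV g) w) \<in> Q"
    if v: "v \<in> tree d" and w: "w \<in> tree d" for v w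
  proof -
    let ?a = "label d g (inv_into UNIV g v)" and ?b = "label d g (inv_into UNIV g w)"
    have ab: "?a \<in> P" "?b \<in> P" using lP it v w by auto
    have ba: "?b \<circ> inv_into UNIV ?a \<in> Q" using g it v w by (simp add: G_iff)
    have "label d (inv_into UNIV g) v \<circ> inv_into UNIV (label d (inv_into UNIV g) w)
        = inv_into UNIV ?a \<circ> ?b"
      using label_inv_into[OF gA] v w permutes_bij[OF P_permutes[OF ab(2)]] by (simp add: inv_inv_eq)
    \<comment> \<open>The quotient has its inverse on the wrong side; conjugating by the inverse of
      \<open>?a\<close> repairs this.\<close>
    also have "\<dots> = inv_into UNIV ?a \<circ> (?b \<circ> inv_into UNIV ?a) \<circ> inv_into UNIV (inv_into UNIV ?a)"
      using comp_inv_P(2)[OF ab(1)] permutes_bij[OF P_permutes[OF ab(1)]]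
      by (simp add: inv_inv_eq comp_assoc)
    also have "\<dots> \<in> Q" by (rule conj[OF P_closed(3)[OF ab(1)] ba])
    finally show ?thesis .
  qed
  then show "inv_into UNIV g \<in> G"
    using inv_into_AutT[OF gA] label_inv_into[OF gA] P_closed(3)[OF lP[OF it]] by (auto simp: G_iff)
qed (rule G_AutT)

lemma Q_class: "Q \<in> label_cosets"
  unfolding label_cosets_def coset_def by (rule image_eqI[OF _ P_closed(1)]) simp

lemma finite_labels: "finite ((\<lambda>g. label d g []) ` G)"
  by (rule finite_subset[OF _ finite_subgroup_sym_group[OF P]]) (auto simp: G_iff)

text \<open>An element of the first-level stabilizer has root label \<open>id\<close>, which lies in
  \<open>Q\<close>, so only the labels of its sections matter.\<close>

lemma first_level_copy_labelled: "first_level_copy d (labelled d Q) = labelled d Q \<inter> level_stabilizer d 1"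
proof (intro equalityI subsetI)
  fix g assume g: "g \<in> labelled d Q \<inter> level_stabilizer d 1"
  then show "g \<in> first_level_copy d (labelled d Q)"
    using section_labelled[of g d Q] level_subset_tree[of d 1] by (auto simp: first_level_copy_def)
next
  fix g assume g: "g \<in> first_level_copy d (labelled d Q)"
  then have gA: "g \<in> carrier (AutT d)" by (simp add: first_level_copy_def level_stabilizer_def)
  have lev: "[x] \<in> level d 1" if "x \<in> {1..d}" for x using that by (simp add: level_def)
  have "label d g [] x = x" for x
  proof (cases "x \<in> {1..d}")
    case True
    then have "g [x] = [x]" using g lev by (simp add: first_level_copy_def level_stabilizer_def)
    then show ?thesis using AutT_Cons[OF gA True, of "[]"] by simp
  qed (auto simp: label_def)
  then have "label d g [] = id" by auto
  moreover have "label d g (x # w) \<in> Q" if "x \<in> {1..d}" "w \<in> tree d" for x w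
  proof -
    have "section_at d g [x] \<in> labelled d Q" using g lev[OF that(1)] by (simp add: first_level_copy_def)
    then have "label d (section_at d g [x]) w \<in> Q" using that by (simp add: labelled_def)
    then show ?thesis using label_section[OF gA, of "[x]" w] that by (metis append_Cons append_Nil tree_Cons tree_Nil)
  qed
  ultimately have "label d g v \<in> Q" if "v \<in> tree d" for v
    using that Q_closed(1) by (cases v) auto
  then show "g \<in> labelled d Q \<inter> level_stabilizer d 1"
    using g gA by (simp add: labelled_def first_level_copy_def)
qed

text \<open>Elements with equal root labels differ by one with trivial root label. In
  \<open>G\<close> this puts all its labels in the coset \<open>Q\<close>; inside
  \<open>labelled d Q\<close> it lies in the first-level stabilizer. Hence finitely many root labels
  bound both indices.\<close>

theorem regular_branch_G: "regular_branch d G"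
proof -
  have B: "subgroup (labelled d Q) (AutT d)" by (rule subgroup_labelled[OF Q])
  have BG: "labelled d Q \<subseteq> G" using Q_class by (auto simp: G_eq)
  have root: "label d (g \<circ> inv_into UNIV h) [] = id"
    if "g \<in> G" "h \<in> G" "label d g [] = label d h []" for g h
  proof -
    have gh: "g \<in> carrier (AutT d)" "h \<in> carrier (AutT d)" using that G_AutT by auto
    have "inv_into UNIV h [] = []" using AutT_Nil[OF inv_into_AutT[OF gh(2)]] .
    moreover have "label d h [] \<in> P" using that by (simp add: G_iff)
    ultimately show ?thesis
      using label_comp[OF gh(1) inv_into_AutT[OF gh(2)]] label_inv_into[OF gh(2)] that comp_inv_P
      by simp
  qed
  have closed: "g \<circ> inv_into UNIV h \<in> H" if "g \<in> H" "h \<in> H" "subgroup H (AutT d)" for g h H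
    using subgroup.m_closed[OF that(3) that(1) subgroup.m_inv_closed[OF that(3,2)]]
      AutT_inv[OF subgroup.mem_carrier[OF that(3,2)]] by simp
  have "finite_index_subgroup (AutT d) (labelled d Q) G"
  proof (rule finite_index_subgroupI[OF B subgroup_G BG finite_labels])
    fix g h assume gh: "g \<in> G" "h \<in> G" "label d g [] = label d h []"
    have "g \<circ> inv_into UNIV h \<in> G" using closed[OF gh(1,2) subgroup_G] .
    then have "label d (g \<circ> inv_into UNIV h) v \<circ> inv_into UNIV (label d (g \<circ> inv_into UNIV h) []) \<in> Q"
      if "v \<in> tree d" for v using that unfolding G_iff by simp
    then show "g \<circ> inv_into UNIV h \<in> labelled d Q"
      using \<open>g \<circ> inv_into UNIV h \<in> G\<close> root[OF gh] by (simp add: labelled_def G_iff)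
  qed
  moreover have "finite_index_subgroup (AutT d) (first_level_copy d (labelled d Q)) (labelled d Q)"
    unfolding first_level_copy_labelled
  proof (rule finite_index_subgroupI[OF _ B])
    show "subgroup (labelled d Q \<inter> level_stabilizer d 1) (AutT d)"
      using group.subgroups_Inter_pair[OF group_AutT B subgroup_level_stabilizer] .
    show "finite ((\<lambda>g. label d g []) ` labelled d Q)"
      using finite_subset[OF image_mono[OF BG] finite_labels] .
    fix g h assume gh: "g \<in> labelled d Q" "h \<in> labelled d Q" "label d g [] = label d h []"
    have m: "g \<circ> inv_into UNIV h \<in> labelled d Q" using closed[OF gh(1,2) B] .
    have "label d (g \<circ> inv_into UNIV h) [] = id" using root gh BG by blast
    then have "(g \<circ> inv_into UNIV h) v = v" if v: "v \<in> level d 1" for v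
    proof -
      obtain x where x: "v = [x]" "x \<in> {1..d}"
        using v unfolding One_nat_def level_Suc by auto
      show ?thesis
        using AutT_snoc_label[OF labelled_AutT[OF m], of "[]" x] x AutT_Nil[OF labelled_AutT[OF m]]
          \<open>label d (g \<circ> inv_into UNIV h) [] = id\<close> by simp
    qed
    then show "g \<circ> inv_into UNIV h \<in> labelled d Q \<inter> level_stabilizer d 1"
      using m labelled_AutT[OF m] by (simp add: level_stabilizer_def)
  qed auto
  moreover have "level_transitive d G"
    using labelled_level_transitive[OF Q trans] BG
    unfolding level_transitive_def transitive_on_def by blast
  ultimately show ?thesis unfolding regular_branch_def using subgroup_G by blast
qed

section \<open>Orders of the congruence quotients and Hausdorff dimension\<close>

text \<open>The root label, and with it the coset, is visible from level 1 on. On level 0 all cosets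
  act alike, hence the shift to \<open>Suc n\<close> here and in the later counts.\<close>

lemma acts_disjoint:
  assumes "K \<in> label_cosets" "L \<in> label_cosets" "K \<noteq> L"
  shows "acts d (Suc n) (labelled d K) \<inter> acts d (Suc n) (labelled d L) = {}"
proof (rule ccontr)
  assume "\<not> ?thesis"
  then obtain g h where g: "g \<in> labelled d K" and h: "h \<in> labelled d L"
    and e: "restrict g (level d (Suc n)) = restrict h (level d (Suc n))"
    by (auto simp: acts_def)
  have "label d g [] x = label d h [] x" for x
  proof (cases "x \<in> {1..d}")
    case True
    let ?w = "replicate n x"
    have w: "?w \<in> level d n" using True by (auto simp: level_def tree_def)
    then have "g (x # ?w) = h (x # ?w)" using fun_cong[OF e, of "x # ?w"] True by simp
    then show ?thesis
      using AutT_Cons[OF labelled_AutT[OF g] True] AutT_Cons[OF labelled_AutT[OF h] True] w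
        level_subset_tree[of d n] by auto
  qed (auto simp: label_def)
  then have "label d g [] = label d h []" by auto
  then have "label d g [] \<in> K \<inter> L" using g h unfolding labelled_def by (auto dest: bspec[of _ _ "[]"])
  then show False using label_cosets_disjoint assms by blast
qed

lemma acts_G: "acts d n G = (\<Union>K\<in>label_cosets. acts d n (labelled d K))"
  by (auto simp: acts_def G_eq)

lemma fixfree_G: "fixfree d n G = (\<Union>K\<in>label_cosets. fixfree d n (labelled d K))"
  by (auto simp: fixfree_def acts_G)

lemma card_acts_class:
  assumes "K \<in> label_cosets"
  shows "card (acts d n (labelled d K)) = d ^ (\<Sum>i<n. d ^ i)"
  using card_acts[OF class_permutes class_nonempty] assms card_class by metis

lemma finite_acts_class: "K \<in> label_cosets \<Longrightarrow> finite (acts d n (labelled d K))"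
  using finite_acts[OF class_permutes class_nonempty finite_class] by blast

lemma card_acts_G: "card (acts d (Suc n) G) = card label_cosets * d ^ (\<Sum>i<Suc n. d ^ i)"
  unfolding acts_G using finite_label_cosets finite_acts_class acts_disjoint card_acts_class
  by (subst card_UN_disjoint) auto

lemma card_fixfree_G:
  "card (fixfree d (Suc n) G) = (\<Sum>K\<in>label_cosets. card (fixfree d (Suc n) (labelled d K)))"
  unfolding fixfree_G
proof (rule card_UN_disjoint[OF finite_label_cosets])
  show "\<forall>K\<in>label_cosets. finite (fixfree d (Suc n) (labelled d K))"
    using finite_acts_class by (auto simp: fixfree_def)
  show "\<forall>K\<in>label_cosets. \<forall>L\<in>label_cosets. K \<noteq> L \<longrightarrow>
      fixfree d (Suc n) (labelled d K) \<inter> fixfree d (Suc n) (labelled d L) = {}"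
    using acts_disjoint unfolding fixfree_def by blast
qed

text \<open>Both logarithms grow linearly in the number \<open>N n\<close> of vertices above level
  \<open>n\<close>; the cosets add only \<open>ln m\<close>, which vanishes after division by
  \<open>N n\<close>. The actual limit exists, so it equals the lower limit.\<close>

theorem hausdorff_dim_G:
  assumes d2: "d \<ge> 2"
  shows "hausdorff_dim d G = ereal (ln (real d) / ln (fact d))"
proof -
  define N where "N n = (\<Sum>i<n. d ^ i)" for n
  define m where "m = card label_cosets"
  have m: "m > 0" using finite_label_cosets label_cosets_nonempty by (simp add: m_def card_gt_0_iff)
  have lnf: "ln (fact d :: real) > 0"
    using d2 fact_mono[of 2 d, where ?'a=real] by (simp add: ln_gt_zero)
  have Nge: "n \<le> N n" for n
    using sum_mono[of "{..<n}" "\<lambda>_. 1" "\<lambda>i. d ^ i"] d_pos by (simp add: N_def)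
  have cA: "card (level_proj d n ` carrier (AutT d)) = fact d ^ N n" for n
  proof -
    have ne: "{\<sigma>. \<sigma> permutes {1..d}} \<noteq> {}" using permutes_id by blast
    have "card (acts d n (labelled d {\<sigma>. \<sigma> permutes {1..d}})) = fact d ^ N n"
      using card_acts[OF order_refl ne] card_permutations[of "{1..d}" d] by (simp add: N_def)
    then show ?thesis using card_level_proj[OF order_refl] carrier_AutT_eq_labelled by metis
  qed
  have cG: "card (level_proj d (Suc n) ` G) = m * d ^ N (Suc n)" for n
    using card_level_proj[OF G_AutT] card_acts_G by (simp add: N_def m_def)
  let ?f = "\<lambda>n. ln (real (card (level_proj d n ` G))) / ln (real (card (level_proj d n ` carrier (AutT d))))"
  have f: "?f (Suc n) = ln (real m) / ln (fact d) * inverse (real (N (Suc n))) + ln (real d) / ln (fact d)" for n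
  proof -
    have "real (N (Suc n)) > 0" using Nge[of "Suc n"] by simp
    then show ?thesis
      using m d2 lnf unfolding cA cG
      by (simp add: ln_mult ln_realpow field_simps)
  qed
  have "filterlim (\<lambda>n. real (N (Suc n))) at_top sequentially"
    by (rule filterlim_at_top_mono[OF filterlim_real_sequentially])
      (use Nge Suc_leD[OF Nge] in \<open>auto intro!: always_eventually\<close>)
  then have "(\<lambda>n. inverse (real (N (Suc n)))) \<longlonglongrightarrow> 0"
    by (rule tendsto_inverse_0_at_top)
  then have "(\<lambda>n. ?f (Suc n)) \<longlonglongrightarrow> ln (real m) / ln (fact d) * 0 + ln (real d) / ln (fact d)"
    unfolding f by (intro tendsto_intros)
  then have "?f \<longlonglongrightarrow> ln (real d) / ln (fact d)"
    by (intro LIMSEQ_imp_Suc[of ?f]) simp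
  then show ?thesis
    unfolding hausdorff_dim_def by (intro lim_imp_Liminf) auto
qed

text \<open>All cosets have equally many actions on a level, so the proportion is the average over
  cosets of the survival probabilities \<open>1 - q K n\<close>, which tend to 1 or 0.\<close>

theorem fpp_seq_limit:
  "fpp_seq d G \<longlonglongrightarrow>
    real (card {K \<in> label_cosets. \<forall>\<sigma>\<in>K. card (fixpts d \<sigma>) = 1}) / real (card label_cosets)"
proof -
  define q where "q K n = real (card (fixfree d n (labelled d K))) / real (card (acts d n (labelled d K)))" for K n
  have q: "q K \<longlonglongrightarrow> (if \<forall>\<sigma>\<in>K. card (fixpts d \<sigma>) = 1 then 0 else 1)" if K: "K \<in> label_cosets" for K
  proof (rule critical_extinction_limit[OF finite_class[OF K] class_nonempty[OF K] sum_card_fixpts[OF K]])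
    have "fixfree d 0 (labelled d K) = {}"
      using AutT_Nil[OF labelled_AutT] by (auto simp: fixfree_def acts_def)
    then show "q K 0 = 0" by (simp add: q_def)
    fix n
    let ?e = "card (fixfree d n (labelled d K))" and ?N = "card (acts d n (labelled d K))"
    have N: "real ?N > 0" using card_acts_class[OF K] d_pos by simp
    have "q K (Suc n) = (\<Sum>\<sigma>\<in>K. real ?e ^ card (fixpts d \<sigma>) * real ?N ^ (d - card (fixpts d \<sigma>)))
        / (real (card K) * real ?N ^ d)"
      unfolding q_def card_acts_Suc[OF class_permutes[OF K]]
        card_fixfree_Suc[OF class_permutes[OF K] finite_class[OF K] finite_acts_class[OF K]]
      by simp
    also have "\<dots> = (\<Sum>\<sigma>\<in>K. real ?e ^ card (fixpts d \<sigma>) * real ?N ^ (d - card (fixpts d \<sigma>)) / real ?N ^ d)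
        / real (card K)"
      by (simp add: sum_divide_distrib mult.commute)
    \<comment> \<open>Distributing the \<open>d\<close> factors of the denominator, those at
      non-fixed letters cancel and each fixed letter contributes one \<open>q K n\<close>.\<close>
    also have "(\<Sum>\<sigma>\<in>K. real ?e ^ card (fixpts d \<sigma>) * real ?N ^ (d - card (fixpts d \<sigma>)) / real ?N ^ d)
        = (\<Sum>\<sigma>\<in>K. q K n ^ card (fixpts d \<sigma>))"
    proof (rule sum.cong)
      fix \<sigma>
      have "fixpts d \<sigma> \<subseteq> {1..d}" by (auto simp: fixpts_def)
      then have le: "card (fixpts d \<sigma>) \<le> d" using card_mono[of "{1..d}"] by fastforce
      have "real ?N ^ d = real ?N ^ card (fixpts d \<sigma>) * real ?N ^ (d - card (fixpts d \<sigma>))"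
        using le by (simp flip: power_add)
      then show "real ?e ^ card (fixpts d \<sigma>) * real ?N ^ (d - card (fixpts d \<sigma>)) / real ?N ^ d
          = q K n ^ card (fixpts d \<sigma>)"
        using N by (simp add: q_def power_divide)
    qed simp
    finally show "q K (Suc n) = (\<Sum>\<sigma>\<in>K. q K n ^ card (fixpts d \<sigma>)) / real (card K)" .
  qed
  define m where "m = card label_cosets"
  have m: "m > 0" using finite_label_cosets label_cosets_nonempty by (simp add: m_def card_gt_0_iff)
  have eq: "fpp_seq d G (Suc n) = (\<Sum>K\<in>label_cosets. 1 - q K (Suc n)) / real m" for n
  proof -
    let ?D = "real (d ^ (\<Sum>i<Suc n. d ^ i))"
    have D: "?D > 0" using d_pos by simp
    have fin: "finite (acts d (Suc n) G)" unfolding acts_G using finite_label_cosets finite_acts_class by auto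
    have sub: "fixfree d (Suc n) G \<subseteq> acts d (Suc n) G" by (auto simp: fixfree_def)
    have "real (card (acts d (Suc n) G - fixfree d (Suc n) G)) =
        real m * ?D - (\<Sum>K\<in>label_cosets. real (card (fixfree d (Suc n) (labelled d K))))"
      using card_Diff_subset[OF finite_subset[OF sub fin] sub] card_mono[OF fin sub]
      by (simp add: of_nat_diff card_acts_G card_fixfree_G m_def)
    also have "\<dots> = (\<Sum>K\<in>label_cosets. ?D * (1 - q K (Suc n)))"
      using D card_acts_class by (simp add: q_def sum_subtractf algebra_simps m_def)
    also have "\<dots> = ?D * (\<Sum>K\<in>label_cosets. 1 - q K (Suc n))" by (simp add: sum_distrib_left)
    finally show ?thesis
      unfolding fpp_seq_eq[OF G_AutT] card_acts_G using D m by (simp add: m_def)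
  qed
  have "(\<lambda>n. (\<Sum>K\<in>label_cosets. 1 - q K (Suc n)) / real m) \<longlonglongrightarrow>
      (\<Sum>K\<in>label_cosets. 1 - (if \<forall>\<sigma>\<in>K. card (fixpts d \<sigma>) = 1 then 0 else 1)) / real m"
    using m by (intro tendsto_intros LIMSEQ_Suc[OF q]) auto
  moreover have "(\<Sum>K\<in>label_cosets. 1 - (if \<forall>\<sigma>\<in>K. card (fixpts d \<sigma>) = 1 then 0 else 1)) =
      (\<Sum>K\<in>label_cosets. if \<forall>\<sigma>\<in>K. card (fixpts d \<sigma>) = 1 then 1 else (0::real))"
    by (rule sum.cong) auto
  ultimately have "(\<lambda>n. fpp_seq d G (Suc n)) \<longlonglongrightarrow>
      real (card {K \<in> label_cosets. \<forall>\<sigma>\<in>K. card (fixpts d \<sigma>) = 1}) / real m"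
    using finite_label_cosets by (simp add: eq sum.If_cases Int_def)
  then show ?thesis unfolding m_def by (rule LIMSEQ_imp_Suc)
qed

end

declare One_nat_def [simp]

section \<open>The holomorph acting with a regular normal factor\<close>

lemma comm_group_Q_group: "comm_group (Q_group n r)"
proof (rule group.group_comm_groupI[OF group_Q_group])
  fix z z' :: q_elem
  show "z \<otimes>\<^bsub>Q_group n r\<^esub> z' = z' \<otimes>\<^bsub>Q_group n r\<^esub> z"
    by (cases z; cases z') (simp add: mult_Q_group add.commute)
qed

abbreviation idQ :: "nat \<Rightarrow> nat \<Rightarrow> q_elem \<Rightarrow> q_elem" where
  "idQ n r \<equiv> (\<lambda>x\<in>carrier (Q_group n r). x)"

lemma carrier_P_group: "carrier (P_group n r) = carrier (Q_group n r) \<times> auto (Q_group n r)"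
  by (simp add: P_group_def semidirect_def AutoGroup_def)

lemma auto_mem: "f \<in> auto G \<Longrightarrow> x \<in> carrier G \<Longrightarrow> f x \<in> carrier G"
  by (auto simp: auto_def hom_def)

lemma auto_mult:
  "f \<in> auto G \<Longrightarrow> x \<in> carrier G \<Longrightarrow> y \<in> carrier G \<Longrightarrow> f (x \<otimes>\<^bsub>G\<^esub> y) = f x \<otimes>\<^bsub>G\<^esub> f y"
  by (auto simp: auto_def hom_def)

lemma auto_one: "group G \<Longrightarrow> f \<in> auto G \<Longrightarrow> f \<one>\<^bsub>G\<^esub> = \<one>\<^bsub>G\<^esub>"
  using hom_one[of f G G] by (simp add: auto_def)

lemma auto_Bij: "f \<in> auto G \<Longrightarrow> f \<in> Bij (carrier G)"
  by (simp add: auto_def)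

lemma mult_P_group:
  assumes "f \<in> auto (Q_group n r)" "g \<in> auto (Q_group n r)"
  shows "(a, f) \<otimes>\<^bsub>P_group n r\<^esub> (b, g) = (a \<otimes>\<^bsub>Q_group n r\<^esub> f b, compose (carrier (Q_group n r)) f g)"
  using assms auto_Bij by (auto simp: P_group_def semidirect_def AutoGroup_def BijGroup_def)

lemma idQ_auto: "idQ n r \<in> auto (Q_group n r)"
  using group.id_in_auto[OF group_Q_group] .

lemma Q_in_P_eq: "Q_in_P n r = carrier (Q_group n r) \<times> {idQ n r}"
  by (simp add: Q_in_P_def AutoGroup_def BijGroup_def)

lemma Q_in_P_normal: "Q_in_P n r \<lhd> P_group n r"
proof -
  \<comment> \<open>The normal factor is the kernel of the projection to the automorphism
    group.\<close>
  have "snd \<in> hom (P_group n r) (AutoGroup (Q_group n r))"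
    by (auto intro!: homI simp: P_group_def semidirect_def)
  then interpret group_hom "P_group n r" "AutoGroup (Q_group n r)" snd
    using group_P_group group.AutoGroup[OF group_Q_group] by (simp add: group_hom_def group_hom_axioms_def)
  have "one (AutoGroup (Q_group n r)) \<in> carrier (AutoGroup (Q_group n r))" by simp
  then have "Q_in_P n r = kernel (P_group n r) (AutoGroup (Q_group n r)) snd"
    by (auto simp: kernel_def Q_in_P_def P_group_def semidirect_def)
  then show ?thesis using normal_kernel by simp
qed

section \<open>Arbitrary embeddings of the holomorph\<close>

locale holomorph_embedding =
  fixes n r d :: nat and \<phi> :: "q_elem \<times> (q_elem \<Rightarrow> q_elem) \<Rightarrow> nat \<Rightarrow> nat"
  assumes r: "odd r" and d: "d = 2 ^ n * r"
    and \<phi>: "\<phi> \<in> mon (P_group n r) (sym_group d)"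
begin

sublocale \<phi>: group_hom "P_group n r" "sym_group d" \<phi>
  using \<phi> group_P_group sym_group_is_group by (simp add: group_hom_def group_hom_axioms_def mon_def)

sublocale Q: comm_group "Q_group n r"
  by (rule comm_group_Q_group)

lemma inj_\<phi>: "inj_on \<phi> (carrier (P_group n r))"
  using \<phi> by (simp add: mon_def)

lemma \<phi>_mult:
  "x \<in> carrier (P_group n r) \<Longrightarrow> y \<in> carrier (P_group n r) \<Longrightarrow> \<phi> (x \<otimes>\<^bsub>P_group n r\<^esub> y) = \<phi> x \<circ> \<phi> y"
  using \<phi>.hom_mult by (simp add: sym_group_mult)

lemma d_pos': "d > 0"
  using r_pos[OF r] by (simp add: d)

lemma subgroup_image_P: "subgroup (\<phi> ` carrier (P_group n r)) (sym_group d)"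
  by (rule \<phi>.img_is_subgroup)

lemma subgroup_image_Q: "subgroup (\<phi> ` Q_in_P n r) (sym_group d)"
  using \<phi>.subgroup_img_is_subgroup[OF normal_imp_subgroup[OF Q_in_P_normal]] .

lemma Q_in_P_subset: "Q_in_P n r \<subseteq> carrier (P_group n r)"
  using normal_imp_subgroup[OF Q_in_P_normal] subgroup.subset by blast

lemma image_conj:
  assumes p: "p \<in> \<phi> ` carrier (P_group n r)" and q: "q \<in> \<phi> ` Q_in_P n r"
  shows "p \<otimes>\<^bsub>sym_group d\<^esub> q \<otimes>\<^bsub>sym_group d\<^esub> inv\<^bsub>sym_group d\<^esub> p \<in> \<phi> ` Q_in_P n r"
proof -
  obtain x y where xy: "p = \<phi> x" "x \<in> carrier (P_group n r)" "q = \<phi> y" "y \<in> Q_in_P n r" using p q by blast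
  have "x \<otimes>\<^bsub>P_group n r\<^esub> y \<otimes>\<^bsub>P_group n r\<^esub> inv\<^bsub>P_group n r\<^esub> x \<in> Q_in_P n r"
    using normal.inv_op_closed2[OF Q_in_P_normal xy(2,4)] .
  moreover have "\<phi> (x \<otimes>\<^bsub>P_group n r\<^esub> y \<otimes>\<^bsub>P_group n r\<^esub> inv\<^bsub>P_group n r\<^esub> x) =
      p \<otimes>\<^bsub>sym_group d\<^esub> q \<otimes>\<^bsub>sym_group d\<^esub> inv\<^bsub>sym_group d\<^esub> p"
    using xy subsetD[OF Q_in_P_subset xy(4)] by (simp del: sym_group_inv_equality)
  ultimately show ?thesis by (metis imageI)
qed

lemma normal_image: "\<phi> ` Q_in_P n r \<lhd> (sym_group d)\<lparr>carrier := \<phi> ` carrier (P_group n r)\<rparr>"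
proof -
  let ?H = "(sym_group d)\<lparr>carrier := \<phi> ` carrier (P_group n r)\<rparr>"
  interpret H: group ?H by (rule group.subgroup_imp_group[OF sym_group_is_group subgroup_image_P])
  have "subgroup (\<phi> ` Q_in_P n r) ?H"
    using group.subgroup_incl[OF sym_group_is_group subgroup_image_Q subgroup_image_P image_mono[OF Q_in_P_subset]] .
  moreover have "inv\<^bsub>?H\<^esub> p = inv\<^bsub>sym_group d\<^esub> p" if "p \<in> \<phi> ` carrier (P_group n r)" for p
    using group.m_inv_consistent[OF sym_group_is_group subgroup_image_P that] .
  ultimately show ?thesis unfolding H.normal_inv_iff using image_conj by simp
qed

lemma card_image_Q: "card (\<phi> ` Q_in_P n r) = d"
  using card_image[OF inj_on_subset[OF inj_\<phi> Q_in_P_subset]] card_Q_group[OF r]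
  by (simp add: Q_in_P_eq card_cartesian_product d)

lemma regular_pair_image:
  assumes "transitive_on (\<phi> ` Q_in_P n r) {1..d}"
  shows "regular_pair d (\<phi> ` Q_in_P n r) (\<phi> ` carrier (P_group n r))"
proof (rule regular_pair.intro)
  show "p \<circ> q \<circ> inv_into UNIV p \<in> \<phi> ` Q_in_P n r"
    if "p \<in> \<phi> ` carrier (P_group n r)" "q \<in> \<phi> ` Q_in_P n r" for p q
    using image_conj[OF that] subgroup.mem_carrier[OF subgroup_image_P that(1)]
    by (simp add: sym_group_mult)
qed (rule d_pos' subgroup_image_Q subgroup_image_P image_mono[OF Q_in_P_subset] assms card_image_Q)+

end

locale transitive_holomorph_embedding = holomorph_embedding +
  assumes trans: "transitive_on (\<phi> ` Q_in_P n r) {1..d}"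
begin

sublocale R: regular_pair d "\<phi> ` Q_in_P n r" "\<phi> ` carrier (P_group n r)"
  by (rule regular_pair_image[OF trans])

definition aut_class :: "(q_elem \<Rightarrow> q_elem) \<Rightarrow> (nat \<Rightarrow> nat) set" where
  "aut_class f = \<phi> ` (carrier (Q_group n r) \<times> {f})"

text \<open>Left multiplication by \<open>(b, id)\<close> only translates the first coordinate, so
  the coset depends on the automorphism alone.\<close>

lemma coset_eq_aut_class:
  assumes a: "a \<in> carrier (Q_group n r)" and f: "f \<in> auto (Q_group n r)"
  shows "R.coset (\<phi> (a, f)) = aut_class f"
proof -
  have ext: "f \<in> extensional (carrier (Q_group n r))" using auto_Bij[OF f] Bij_imp_extensional by blast
  have comp: "\<phi> (b, idQ n r) \<circ> \<phi> (a, f) = \<phi> (b \<otimes>\<^bsub>Q_group n r\<^esub> a, f)" if "b \<in> carrier (Q_group n r)" for b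
  proof -
    have "(b, idQ n r) \<otimes>\<^bsub>P_group n r\<^esub> (a, f) = (b \<otimes>\<^bsub>Q_group n r\<^esub> a, f)"
      unfolding mult_P_group[OF idQ_auto f] using a auto_mem[OF f] ext
      by (auto simp: Id_compose Pi_def)
    then show ?thesis using \<phi>_mult[of "(b, idQ n r)" "(a, f)"] a f that idQ_auto by (simp add: carrier_P_group)
  qed
  have "R.coset (\<phi> (a, f)) = (\<lambda>b. \<phi> (b, idQ n r) \<circ> \<phi> (a, f)) ` carrier (Q_group n r)"
    unfolding R.coset_def unfolding Q_in_P_eq by auto
  also have "\<dots> = (\<lambda>b. \<phi> (b \<otimes>\<^bsub>Q_group n r\<^esub> a, f)) ` carrier (Q_group n r)"
    using comp by (intro image_cong) auto
  also have "\<dots> = aut_class f"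
  proof (intro equalityI subsetI)
    fix s assume "s \<in> aut_class f"
    then obtain b where b: "b \<in> carrier (Q_group n r)" "s = \<phi> (b, f)" by (auto simp: aut_class_def)
    have "b = (b \<otimes>\<^bsub>Q_group n r\<^esub> inv\<^bsub>Q_group n r\<^esub> a) \<otimes>\<^bsub>Q_group n r\<^esub> a"
      using a b Q.m_assoc by simp
    moreover have "b \<otimes>\<^bsub>Q_group n r\<^esub> inv\<^bsub>Q_group n r\<^esub> a \<in> carrier (Q_group n r)" using a b by simp
    ultimately show "s \<in> (\<lambda>b. \<phi> (b \<otimes>\<^bsub>Q_group n r\<^esub> a, f)) ` carrier (Q_group n r)"
      using b(2) by (metis (no_types, lifting) image_eqI)
  qed (use a in \<open>auto simp: aut_class_def\<close>)
  finally show ?thesis .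
qed

lemma label_cosets_eq: "R.label_cosets = aut_class ` auto (Q_group n r)"
proof -
  have "R.label_cosets = (\<lambda>(a, f). R.coset (\<phi> (a, f))) ` (carrier (Q_group n r) \<times> auto (Q_group n r))"
    unfolding R.label_cosets_def unfolding carrier_P_group by (simp add: image_image case_prod_unfold)
  also have "\<dots> = (\<lambda>(a, f). aut_class f) ` (carrier (Q_group n r) \<times> auto (Q_group n r))"
    using coset_eq_aut_class by (intro image_cong) auto
  also have "\<dots> = aut_class ` auto (Q_group n r)" using Q.one_closed by force
  finally show ?thesis .
qed

lemma inj_aut_class: "inj_on aut_class (auto (Q_group n r))"
proof (rule inj_onI)
  fix f g assume fg: "f \<in> auto (Q_group n r)" "g \<in> auto (Q_group n r)" "aut_class f = aut_class g"
  have "\<phi> (\<one>\<^bsub>Q_group n r\<^esub>, f) \<in> aut_class g" unfolding fg(3)[symmetric] by (auto simp: aut_class_def)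
  then obtain b where "b \<in> carrier (Q_group n r)" "\<phi> (\<one>\<^bsub>Q_group n r\<^esub>, f) = \<phi> (b, g)" by (auto simp: aut_class_def)
  then show "f = g" using inj_onD[OF inj_\<phi>, of "(\<one>\<^bsub>Q_group n r\<^esub>, f)" "(b, g)"] fg by (simp add: carrier_P_group)
qed

text \<open>The orbit map of the base point 1 under the regular image of \<open>Q\<close>; it
  carries the group structure to the letters.\<close>

definition point :: "q_elem \<Rightarrow> nat" where
  "point q = \<phi> (q, idQ n r) 1"

lemma bij_point: "bij_betw point (carrier (Q_group n r)) {1..d}"
proof -
  have inner: "bij_betw (\<lambda>q. \<phi> (q, idQ n r)) (carrier (Q_group n r)) (\<phi> ` Q_in_P n r)"
    by (intro bij_betw_imageI inj_onI)
      (auto simp: Q_in_P_eq carrier_P_group idQ_auto dest!: inj_onD[OF inj_\<phi>])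
  have outer: "bij_betw (\<lambda>q. q 1) (\<phi> ` Q_in_P n r) {1..d}"
    using d_pos' by (intro R.regular) auto
  have "point = (\<lambda>q. q 1) \<circ> (\<lambda>q. \<phi> (q, idQ n r))" by (simp add: fun_eq_iff point_def)
  then show ?thesis using bij_betw_trans[OF inner outer] by simp
qed

text \<open>Under \<^const>\<open>point\<close>, the element \<open>\<phi> (c, f)\<close> acts on \<open>Q\<close> as \<open>q \<mapsto> c + f q + t\<close>, where \<open>t\<close>
  only depends on \<open>f\<close>; its fixed points are the solutions of \<open>q - f q = c + t\<close>.\<close>

lemma card_fixpts:
  assumes f: "f \<in> auto (Q_group n r)"
  obtains t where "t \<in> carrier (Q_group n r)"
    "\<And>c. c \<in> carrier (Q_group n r) \<Longrightarrow> card (fixpts d (\<phi> (c, f))) =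
      card {q \<in> carrier (Q_group n r). q \<otimes>\<^bsub>Q_group n r\<^esub> inv\<^bsub>Q_group n r\<^esub> (f q) = c \<otimes>\<^bsub>Q_group n r\<^esub> t}"
proof -
  let ?G = "Q_group n r"
  have ext: "f \<in> extensional (carrier ?G)" using auto_Bij[OF f] Bij_imp_extensional by blast
  have fm: "f q \<in> carrier ?G" if "q \<in> carrier ?G" for q using auto_mem[OF f that] .
  have PG: "(a, g) \<in> carrier (P_group n r)" if "a \<in> carrier ?G" "g \<in> {f, idQ n r}" for a g
    using that f idQ_auto by (auto simp: carrier_P_group)
  have "\<phi> (\<one>\<^bsub>?G\<^esub>, f) permutes {1..d}"
    using R.P_permutes PG by blast
  then have "\<phi> (\<one>\<^bsub>?G\<^esub>, f) 1 \<in> {1..d}" using d_pos' permutes_in_image by fastforce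
  then obtain t where t: "t \<in> carrier ?G" "\<phi> (\<one>\<^bsub>?G\<^esub>, f) 1 = point t"
    using bij_point by (metis bij_betw_imp_surj_on imageE)
  have idmult: "(a, idQ n r) \<otimes>\<^bsub>P_group n r\<^esub> (b, g) = (a \<otimes>\<^bsub>?G\<^esub> b, g)"
    if "b \<in> carrier ?G" "g \<in> {f, idQ n r}" for a b g
  proof -
    have g: "g \<in> auto ?G" using that f idQ_auto by auto
    have "g \<in> extensional (carrier ?G)" using auto_Bij[OF g] Bij_imp_extensional by blast
    then show ?thesis unfolding mult_P_group[OF idQ_auto g] using that(1) auto_mem[OF g]
      by (auto simp: Id_compose Pi_def)
  qed
  have multid: "(a, f) \<otimes>\<^bsub>P_group n r\<^esub> (b, idQ n r) = (a \<otimes>\<^bsub>?G\<^esub> f b, f)" for a b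
    unfolding mult_P_group[OF f idQ_auto] using ext Bij_imp_funcset[OF auto_Bij[OF f]] by simp
  have act: "\<phi> (c, f) (point q) = point (c \<otimes>\<^bsub>?G\<^esub> f q \<otimes>\<^bsub>?G\<^esub> t)"
    if c: "c \<in> carrier ?G" and q: "q \<in> carrier ?G" for c q
  proof -
    have "\<phi> (c, f) (point q) = \<phi> ((c, f) \<otimes>\<^bsub>P_group n r\<^esub> (q, idQ n r)) 1"
      using PG c q by (simp add: sym_group_mult point_def)
    \<comment> \<open>Moves the automorphism next to the base point, where its effect is known to be
      the translation by \<open>t\<close>.\<close>
    also have "(c, f) \<otimes>\<^bsub>P_group n r\<^esub> (q, idQ n r) = (c \<otimes>\<^bsub>?G\<^esub> f q, idQ n r) \<otimes>\<^bsub>P_group n r\<^esub> (\<one>\<^bsub>?G\<^esub>, f)"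
      using idmult[of "\<one>\<^bsub>?G\<^esub>" f "c \<otimes>\<^bsub>?G\<^esub> f q"] c fm[OF q] by (simp add: multid)
    also have "\<phi> \<dots> 1 = \<phi> (c \<otimes>\<^bsub>?G\<^esub> f q, idQ n r) (point t)"
      using PG c q fm t by (simp add: sym_group_mult)
    also have "\<dots> = \<phi> ((c \<otimes>\<^bsub>?G\<^esub> f q, idQ n r) \<otimes>\<^bsub>P_group n r\<^esub> (t, idQ n r)) 1"
      using PG c q fm t by (simp add: sym_group_mult point_def)
    finally show ?thesis using idmult[OF t(1), of "idQ n r"] by (simp add: point_def)
  qed
  have "card (fixpts d (\<phi> (c, f))) =
      card {q \<in> carrier ?G. q \<otimes>\<^bsub>?G\<^esub> inv\<^bsub>?G\<^esub> (f q) = c \<otimes>\<^bsub>?G\<^esub> t}" if c: "c \<in> carrier ?G" for c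
  proof -
    have eq: "\<phi> (c, f) (point q) = point q \<longleftrightarrow> q \<otimes>\<^bsub>?G\<^esub> inv\<^bsub>?G\<^esub> (f q) = c \<otimes>\<^bsub>?G\<^esub> t" if q: "q \<in> carrier ?G" for q
    proof -
      have "c \<otimes>\<^bsub>?G\<^esub> f q \<otimes>\<^bsub>?G\<^esub> t = (c \<otimes>\<^bsub>?G\<^esub> t) \<otimes>\<^bsub>?G\<^esub> f q" using c fm[OF q] t(1) by (simp add: Q.m_ac)
      then have "\<phi> (c, f) (point q) = point q \<longleftrightarrow> (c \<otimes>\<^bsub>?G\<^esub> t) \<otimes>\<^bsub>?G\<^esub> f q = q"
        using act[OF c q] bij_betw_imp_inj_on[OF bij_point] c fm[OF q] t(1) q
        by (simp add: inj_on_eq_iff)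
      also have "\<dots> \<longleftrightarrow> q \<otimes>\<^bsub>?G\<^esub> inv\<^bsub>?G\<^esub> (f q) = c \<otimes>\<^bsub>?G\<^esub> t"
        using Q.inv_solve_right'[of "c \<otimes>\<^bsub>?G\<^esub> t" q "f q"] c t(1) q fm[OF q] by auto
      finally show ?thesis .
    qed
    have "fixpts d (\<phi> (c, f)) = {x \<in> point ` carrier ?G. \<phi> (c, f) x = x}"
      using bij_betw_imp_surj_on[OF bij_point] by (simp add: fixpts_def)
    also have "\<dots> = point ` {q \<in> carrier ?G. q \<otimes>\<^bsub>?G\<^esub> inv\<^bsub>?G\<^esub> (f q) = c \<otimes>\<^bsub>?G\<^esub> t}"
      using eq by blast
    finally show ?thesis
      using card_image[OF inj_on_subset[OF bij_betw_imp_inj_on[OF bij_point]]] by simp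
  qed
  then show ?thesis using that t(1) by blast
qed

text \<open>As \<open>c\<close> varies, \<open>c + t\<close> runs through all of \<open>Q\<close>,
  so the condition says that \<open>?D\<close> takes each value once. \<open>?D\<close> is an
  endomorphism of a finite abelian group whose kernel is the set of fixed points of
  \<open>f\<close>.\<close>

lemma aut_class_fixpts_iff:
  assumes f: "f \<in> auto (Q_group n r)"
  shows "(\<forall>\<sigma>\<in>aut_class f. card (fixpts d \<sigma>) = 1) \<longleftrightarrow>
    (\<forall>q\<in>carrier (Q_group n r). f q = q \<longrightarrow> q = \<one>\<^bsub>Q_group n r\<^esub>)"
proof -
  let ?G = "Q_group n r"
  let ?D = "\<lambda>q. q \<otimes>\<^bsub>?G\<^esub> inv\<^bsub>?G\<^esub> (f q)"
  have fm: "f q \<in> carrier ?G" if "q \<in> carrier ?G" for q using auto_mem[OF f that] .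
  obtain t where t: "t \<in> carrier ?G"
    "\<And>c. c \<in> carrier ?G \<Longrightarrow> card (fixpts d (\<phi> (c, f))) = card {q \<in> carrier ?G. ?D q = c \<otimes>\<^bsub>?G\<^esub> t}"
    using card_fixpts[OF f] by blast
  have D1: "?D q = \<one>\<^bsub>?G\<^esub> \<longleftrightarrow> f q = q" if q: "q \<in> carrier ?G" for q
    using Q.inv_solve_right'[of "\<one>\<^bsub>?G\<^esub>" q "f q"] q fm[OF q] by auto
  have Dhom: "?D \<in> hom ?G ?G"
  proof (rule homI)
    fix x y assume xy: "x \<in> carrier ?G" "y \<in> carrier ?G"
    show "?D (x \<otimes>\<^bsub>?G\<^esub> y) = ?D x \<otimes>\<^bsub>?G\<^esub> ?D y"
      using xy fm by (simp add: auto_mult[OF f] Q.inv_mult Q.m_ac)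
  qed (use fm in simp)
  show ?thesis
  proof
    assume L: "\<forall>\<sigma>\<in>aut_class f. card (fixpts d \<sigma>) = 1"
    \<comment> \<open>Choosing \<open>c\<close> inverse to \<open>t\<close> makes the right-hand
      side trivial, so the fixed points counted are those of \<open>f\<close> itself.\<close>
    have "\<phi> (inv\<^bsub>?G\<^esub> t, f) \<in> aut_class f" using t(1) by (auto simp: aut_class_def)
    then have "card {q \<in> carrier ?G. ?D q = \<one>\<^bsub>?G\<^esub>} = 1" using L t(2)[of "inv\<^bsub>?G\<^esub> t"] t(1) by simp
    then obtain z where z: "{q \<in> carrier ?G. ?D q = \<one>\<^bsub>?G\<^esub>} = {z}" by (auto simp: card_1_singleton_iff)
    have "\<one>\<^bsub>?G\<^esub> \<in> {q \<in> carrier ?G. ?D q = \<one>\<^bsub>?G\<^esub>}"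
      using auto_one[OF group_Q_group f] by simp
    then have "z = \<one>\<^bsub>?G\<^esub>" using z by simp
    show "\<forall>q\<in>carrier ?G. f q = q \<longrightarrow> q = \<one>\<^bsub>?G\<^esub>"
    proof (intro ballI impI)
      fix q assume "q \<in> carrier ?G" "f q = q"
      then have "q \<in> {q \<in> carrier ?G. ?D q = \<one>\<^bsub>?G\<^esub>}" using D1 by blast
      then show "q = \<one>\<^bsub>?G\<^esub>" using z \<open>z = \<one>\<^bsub>?G\<^esub>\<close> by simp
    qed
  next
    assume R: "\<forall>q\<in>carrier ?G. f q = q \<longrightarrow> q = \<one>\<^bsub>?G\<^esub>"
    have inj: "inj_on ?D (carrier ?G)"
      unfolding hom_to_self_inj_iff[OF r Dhom] using R D1 by blast
    have surj: "?D ` carrier ?G = carrier ?G"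
      using fm by (intro endo_inj_surj[OF finite_Q[OF r] _ inj]) auto
    have one: "card {q \<in> carrier ?G. ?D q = e} = 1" if "e \<in> carrier ?G" for e
    proof -
      have "e \<in> ?D ` carrier ?G" using that unfolding surj .
      then obtain q where q: "q \<in> carrier ?G" "e = ?D q" by blast
      have "{x \<in> carrier ?G. ?D x = e} = {q}" using q inj_on_eq_iff[OF inj _ q(1)] by blast
      then show ?thesis by simp
    qed
    show "\<forall>\<sigma>\<in>aut_class f. card (fixpts d \<sigma>) = 1"
    proof
      fix \<sigma> assume "\<sigma> \<in> aut_class f"
      then obtain c where "c \<in> carrier ?G" "\<sigma> = \<phi> (c, f)" by (auto simp: aut_class_def)
      then show "card (fixpts d \<sigma>) = 1" using t one by simp
    qed
  qed
qed

abbreviation fixed_point_free_autos :: "(q_elem \<Rightarrow> q_elem) set" where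
  "fixed_point_free_autos \<equiv> {f \<in> auto (Q_group n r). \<forall>q\<in>carrier (Q_group n r). f q = q \<longrightarrow> q = \<one>\<^bsub>Q_group n r\<^esub>}"

lemma fpp_limit:
  "fpp_seq d R.G \<longlonglongrightarrow> real (card fixed_point_free_autos) / real (card (auto (Q_group n r)))"
proof -
  have "{K \<in> R.label_cosets. \<forall>\<sigma>\<in>K. card (fixpts d \<sigma>) = 1} = aut_class ` fixed_point_free_autos"
    unfolding label_cosets_eq using aut_class_fixpts_iff by blast
  moreover have "card (aut_class ` fixed_point_free_autos) = card fixed_point_free_autos"
    by (rule card_image[OF inj_on_subset[OF inj_aut_class]]) blast
  moreover have "card R.label_cosets = card (auto (Q_group n r))"
    unfolding label_cosets_eq by (rule card_image[OF inj_aut_class])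
  ultimately show ?thesis using R.fpp_seq_limit by simp
qed

end

section \<open>Counting automorphisms that fix only the identity\<close>

lemma auto_eq_endo_image:
  assumes r: "odd r"
  shows "auto (Q_group n r) = (\<lambda>(A, u). endo n r A u) ` (GL_F2 n \<times> units_mod r)"
proof (intro equalityI subsetI)
  fix f assume f: "f \<in> auto (Q_group n r)"
  then obtain A u where "A \<in> carrier_mat n n" "u < r" "f = endo n r A u"
    using hom_eq_endo[OF r, of f n] by (auto simp: auto_def Bij_def)
  then show "f \<in> (\<lambda>(A, u). endo n r A u) ` (GL_F2 n \<times> units_mod r)"
    using f endo_auto_iff[OF r] by (auto simp: units_mod_def)
qed (auto simp: units_mod_def GL_F2_iff endo_auto_iff[OF r])

text \<open>Pairs \<open>(A, u)\<close> parametrise the automorphisms injectively, and being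
  fixed-point free is a separate condition on each entry, so both counts are products.\<close>

lemma fixed_point_free_ratio:
  assumes r: "odd r"
  shows "real (card {f \<in> auto (Q_group n r). \<forall>q\<in>carrier (Q_group n r). f q = q \<longrightarrow> q = \<one>\<^bsub>Q_group n r\<^esub>}) /
      real (card (auto (Q_group n r))) =
    real (card {A \<in> GL_F2 n. A - 1\<^sub>m n \<in> GL_F2 n}) / real (card (GL_F2 n)) *
    (\<Prod>p\<in>{p. prime p \<and> p dvd r}. (real p - 2) / (real p - 1))"
proof -
  let ?e = "\<lambda>(A, u). endo n r A u"
  let ?V = "{A \<in> GL_F2 n. A - 1\<^sub>m n \<in> GL_F2 n} \<times> {u \<in> units_mod r. coprime (int u - 1) (int r)}"
  have sub: "GL_F2 n \<times> units_mod r \<subseteq> carrier_mat n n \<times> {..<r}"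
    by (auto simp: GL_F2_def units_mod_def)
  have "{f \<in> auto (Q_group n r). \<forall>q\<in>carrier (Q_group n r). f q = q \<longrightarrow> q = \<one>\<^bsub>Q_group n r\<^esub>} = ?e ` ?V"
  proof -
    have "(\<forall>q\<in>carrier (Q_group n r). ?e z q = q \<longrightarrow> q = \<one>\<^bsub>Q_group n r\<^esub>) \<longleftrightarrow> z \<in> ?V"
      if "z \<in> GL_F2 n \<times> units_mod r" for z
      using that endo_fixed_point_free_iff[OF r] by (cases z) (auto simp: GL_F2_def)
    then show ?thesis unfolding auto_eq_endo_image[OF r] by blast
  qed
  moreover have "card (?e ` ?V) = card ?V"
    using sub by (intro card_image inj_on_subset[OF inj_endo[OF r]]) auto
  moreover have "card (auto (Q_group n r)) = card (GL_F2 n \<times> units_mod r)"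
    unfolding auto_eq_endo_image[OF r] using sub by (intro card_image inj_on_subset[OF inj_endo[OF r]])
  ultimately show ?thesis
    using units_mod_ratio[OF r] by (simp add: card_cartesian_product flip: times_divide_times_eq)
qed

lemma fixed_point_free_positive:
  assumes r: "odd r" and n: "n \<noteq> 1"
  shows "real (card {f \<in> auto (Q_group n r). \<forall>q\<in>carrier (Q_group n r). f q = q \<longrightarrow> q = \<one>\<^bsub>Q_group n r\<^esub>}) /
      real (card (auto (Q_group n r))) > 0"
proof -
  let ?F = "{f \<in> auto (Q_group n r). \<forall>q\<in>carrier (Q_group n r). f q = q \<longrightarrow> q = \<one>\<^bsub>Q_group n r\<^esub>}"
  obtain A where A: "A \<in> GL_F2 n" "A - 1\<^sub>m n \<in> GL_F2 n" using exists_fixed_point_free_GL_F2[OF n] by blast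
  have "A \<in> carrier_mat n n" using A by (simp add: GL_F2_def)
  \<comment> \<open>Multiplication by 2 works for every odd \<open>r\<close>, as both 2 and
    \<open>2 - 1\<close> are units; \<open>endo\<close> accepts the unreduced 2 even when
    \<open>r = 1\<close>.\<close>
  moreover have "coprime (int 2) (int r)" using r by simp
  ultimately have "endo n r A 2 \<in> ?F"
    using A endo_auto_iff[OF r, of A n 2] endo_fixed_point_free_iff[OF r, of A n 2] by simp
  moreover have "auto (Q_group n r) \<subseteq> (\<Pi>\<^sub>E x\<in>carrier (Q_group n r). carrier (Q_group n r))"
    by (auto simp: auto_def Bij_def bij_betw_def PiE_def)
  then have fin: "finite (auto (Q_group n r))"
    by (rule finite_subset) (intro finite_PiE finite_Q[OF r])
  ultimately have "card ?F > 0" "card (auto (Q_group n r)) > 0"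
    by (auto simp: card_gt_0_iff)
  then show ?thesis by simp
qed

section \<open>Existence of a transitive embedding\<close>

text \<open>The holomorph acts on \<open>Q\<close> by the affine maps sending \<open>q\<close> to
  \<open>a + f q\<close>; this action is transported to the letters along an arbitrary bijection
  \<open>b\<close>.\<close>

lemma exists_transitive_embedding:
  assumes r: "odd r" and d: "d = 2 ^ n * r"
  shows "\<exists>\<phi>\<in>mon (P_group n r) (sym_group d). transitive_on (\<phi> ` Q_in_P n r) {1..d}"
proof -
  let ?G = "Q_group n r"
  interpret Q: comm_group ?G by (rule comm_group_Q_group)
  have "card (carrier ?G) = card {1..d}" using card_Q_group[OF r] d by simp
  then obtain b where b: "bij_betw b (carrier ?G) {1..d}"
    using finite_same_card_bij[OF finite_Q[OF r], of "{1..d}"] by blast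
  define b' where "b' = inv_into (carrier ?G) b"
  have b'_mem: "b' x \<in> carrier ?G" if "x \<in> {1..d}" for x
    using bij_betw_inv_into[OF b] that unfolding b'_def by (meson bij_betwE)
  have b_mem: "b q \<in> {1..d}" if "q \<in> carrier ?G" for q using b that by (meson bij_betwE)
  have bb': "b (b' x) = x" if "x \<in> {1..d}" for x
    using b that unfolding b'_def by (meson bij_betw_inv_into_right)
  have b'b: "b' (b q) = q" if "q \<in> carrier ?G" for q
    using b that unfolding b'_def by (meson bij_betw_inv_into_left)
  define \<phi> where "\<phi> = (\<lambda>(a, f) x. if x \<in> {1..d} then b (a \<otimes>\<^bsub>?G\<^esub> f (b' x)) else x)"
  have \<phi>_eq: "\<phi> (a, f) x = b (a \<otimes>\<^bsub>?G\<^esub> f (b' x))" if "x \<in> {1..d}" for a f x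
    using that by (simp add: \<phi>_def)
  have \<phi>_out: "\<phi> (a, f) x = x" if "x \<notin> {1..d}" for a f x
    using that by (auto simp: \<phi>_def)
  have perm: "\<phi> (a, f) permutes {1..d}" if a: "a \<in> carrier ?G" and f: "f \<in> auto ?G" for a f
  proof (rule bij_imp_permutes)
    have finj: "inj_on f (carrier ?G)" using f by (simp add: auto_def Bij_def bij_betw_def)
    have maps: "\<phi> (a, f) ` {1..d} \<subseteq> {1..d}"
      using a auto_mem[OF f b'_mem] b_mem Q.m_closed by (fastforce simp: \<phi>_eq)
    have "inj_on (\<phi> (a, f)) {1..d}"
    proof (rule inj_onI)
      fix x y assume xy: "x \<in> {1..d}" "y \<in> {1..d}" "\<phi> (a, f) x = \<phi> (a, f) y"
      have m: "f (b' x) \<in> carrier ?G" "f (b' y) \<in> carrier ?G" using auto_mem[OF f b'_mem] xy by auto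
      have cl: "a \<otimes>\<^bsub>?G\<^esub> f (b' x) \<in> carrier ?G" "a \<otimes>\<^bsub>?G\<^esub> f (b' y) \<in> carrier ?G" using a m by auto
      have "b (a \<otimes>\<^bsub>?G\<^esub> f (b' x)) = b (a \<otimes>\<^bsub>?G\<^esub> f (b' y))"
        using xy(3) unfolding \<phi>_eq[OF xy(1)] \<phi>_eq[OF xy(2)] .
      then have "b' (b (a \<otimes>\<^bsub>?G\<^esub> f (b' x))) = b' (b (a \<otimes>\<^bsub>?G\<^esub> f (b' y)))" by (rule arg_cong)
      then have "a \<otimes>\<^bsub>?G\<^esub> f (b' x) = a \<otimes>\<^bsub>?G\<^esub> f (b' y)" unfolding b'b[OF cl(1)] b'b[OF cl(2)] .
      then have "f (b' x) = f (b' y)" using a m by simp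
      then have "b' x = b' y" using inj_onD[OF finj] b'_mem xy by blast
      then show "x = y" using bb' xy by metis
    qed
    then show "bij_betw (\<phi> (a, f)) {1..d} {1..d}"
      using maps by (simp add: bij_betw_def endo_inj_surj)
  qed (rule \<phi>_out)
  have hom: "\<phi> \<in> hom (P_group n r) (sym_group d)"
  proof (rule homI)
    fix x assume "x \<in> carrier (P_group n r)"
    then show "\<phi> x \<in> carrier (sym_group d)" using perm by (auto simp: carrier_P_group sym_group_carrier)
  next
    fix x y assume xy: "x \<in> carrier (P_group n r)" "y \<in> carrier (P_group n r)"
    obtain a f c g where e: "x = (a, f)" "y = (c, g)" by fastforce
    have m: "a \<in> carrier ?G" "f \<in> auto ?G" "c \<in> carrier ?G" "g \<in> auto ?G"
      using xy by (auto simp: e carrier_P_group)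
    show "\<phi> (x \<otimes>\<^bsub>P_group n r\<^esub> y) = \<phi> x \<otimes>\<^bsub>sym_group d\<^esub> \<phi> y"
    proof
      fix v
      show "\<phi> (x \<otimes>\<^bsub>P_group n r\<^esub> y) v = (\<phi> x \<otimes>\<^bsub>sym_group d\<^esub> \<phi> y) v"
      proof (cases "v \<in> {1..d}")
        case True
        have gm: "g (b' v) \<in> carrier ?G" using auto_mem[OF m(4) b'_mem[OF True]] .
        have w: "c \<otimes>\<^bsub>?G\<^esub> g (b' v) \<in> carrier ?G" using gm m by simp
        have "(\<phi> x \<otimes>\<^bsub>sym_group d\<^esub> \<phi> y) v = \<phi> (a, f) (b (c \<otimes>\<^bsub>?G\<^esub> g (b' v)))"
          by (simp add: sym_group_mult e \<phi>_eq[OF True])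
        also have "\<dots> = b (a \<otimes>\<^bsub>?G\<^esub> f (c \<otimes>\<^bsub>?G\<^esub> g (b' v)))"
          using \<phi>_eq[OF b_mem[OF w]] b'b[OF w] by simp
        also have "\<dots> = b (a \<otimes>\<^bsub>?G\<^esub> f c \<otimes>\<^bsub>?G\<^esub> f (g (b' v)))"
          using m gm auto_mem[OF m(2)] by (simp add: auto_mult[OF m(2)] Q.m_assoc)
        also have "\<dots> = \<phi> (x \<otimes>\<^bsub>P_group n r\<^esub> y) v"
          by (simp add: e mult_P_group[OF m(2,4)] \<phi>_eq[OF True] compose_eq[OF b'_mem[OF True]])
        finally show ?thesis by simp
      next
        case False
        then show ?thesis by (simp only: e mult_P_group[OF m(2,4)] sym_group_mult o_apply \<phi>_out not_False_eq_True)
      qed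
    qed
  qed
  have "inj_on \<phi> (carrier (P_group n r))"
  proof (rule inj_onI)
    fix x y assume xy: "x \<in> carrier (P_group n r)" "y \<in> carrier (P_group n r)" "\<phi> x = \<phi> y"
    obtain a f c g where e: "x = (a, f)" "y = (c, g)" by fastforce
    have m: "a \<in> carrier ?G" "f \<in> auto ?G" "c \<in> carrier ?G" "g \<in> auto ?G"
      using xy by (auto simp: e carrier_P_group)
    have eq: "a \<otimes>\<^bsub>?G\<^esub> f q = c \<otimes>\<^bsub>?G\<^esub> g q" if q: "q \<in> carrier ?G" for q
    proof -
      have "b (a \<otimes>\<^bsub>?G\<^esub> f q) = b (c \<otimes>\<^bsub>?G\<^esub> g q)"
        using fun_cong[OF xy(3), of "b q"] \<phi>_eq[OF b_mem[OF q]] b'b[OF q] by (simp add: e)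
      then have "b' (b (a \<otimes>\<^bsub>?G\<^esub> f q)) = b' (b (c \<otimes>\<^bsub>?G\<^esub> g q))" by simp
      then show ?thesis using b'b m auto_mem[OF m(2) q] auto_mem[OF m(4) q] by simp
    qed
    \<comment> \<open>Evaluating at the identity isolates the translation part; cancelling it then
      compares the automorphisms.\<close>
    have ac: "a = c"
      using eq[OF Q.one_closed] m auto_one[OF group_Q_group m(2)] auto_one[OF group_Q_group m(4)] by simp
    have "f = g"
    proof (rule extensionalityI)
      show "f \<in> extensional (carrier ?G)" "g \<in> extensional (carrier ?G)"
        using auto_Bij m Bij_imp_extensional by blast+
      show "f q = g q" if "q \<in> carrier ?G" for q
        using eq[OF that] ac m auto_mem[OF m(2) that] auto_mem[OF m(4) that] by simp
    qed
    then show "x = y" using ac e by simp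
  qed
  then have mon: "\<phi> \<in> mon (P_group n r) (sym_group d)" using hom by (simp add: mon_def)
  moreover have "transitive_on (\<phi> ` Q_in_P n r) {1..d}"
    unfolding transitive_on_def
  proof (intro ballI)
    fix x y assume xy: "x \<in> {1..d}" "y \<in> {1..d}"
    \<comment> \<open>The translation by the difference of the two elements of
      \<open>Q\<close>.\<close>
    let ?a = "b' y \<otimes>\<^bsub>?G\<^esub> inv\<^bsub>?G\<^esub> (b' x)"
    have "?a \<in> carrier ?G" using b'_mem xy by simp
    moreover have "\<phi> (?a, idQ n r) x = y"
      using xy b'_mem bb' by (simp add: \<phi>_eq Q.m_assoc)
    ultimately show "\<exists>g\<in>\<phi> ` Q_in_P n r. g x = y" by (force simp: Q_in_P_eq)
  qed
  ultimately show ?thesis by blast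
qed

theorem theorem2:
  fixes d n r :: nat
  assumes "d \<ge> 2" and "d = 2 ^ n * r" and "odd r"
  shows "(\<exists>\<phi> \<in> mon (P_group n r) (sym_group d).
            subgroup (\<phi> ` carrier (P_group n r)) (sym_group d) \<and>
            \<phi> ` Q_in_P n r \<lhd> (sym_group d)\<lparr>carrier := \<phi> ` carrier (P_group n r)\<rparr> \<and>
            transitive_on (\<phi> ` Q_in_P n r) {1..d})
       \<and> (\<forall>\<phi> \<in> mon (P_group n r) (sym_group d).
            transitive_on (\<phi> ` Q_in_P n r) {1..d} \<longrightarrow>
            (let G = GQP d (\<phi> ` Q_in_P n r) (\<phi> ` carrier (P_group n r)) in
               regular_branch d G \<and>
               hausdorff_dim d G = ereal (ln (real d) / ln (fact d)) \<and>
               convergent (fpp_seq d G) \<and>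
               FPP d G =
                 real (card {A \<in> GL_F2 n. A - 1\<^sub>m n \<in> GL_F2 n}) / real (card (GL_F2 n)) *
                 (\<Prod>p\<in>{p. prime p \<and> p dvd r}. (real p - 2) / (real p - 1)) \<and>
               (d mod 4 \<noteq> 2 \<longrightarrow> FPP d G > 0)))"
proof (intro conjI ballI impI)
  from exists_transitive_embedding[OF assms(3,2)]
  obtain \<phi> where emb: "\<phi> \<in> mon (P_group n r) (sym_group d)" "transitive_on (\<phi> ` Q_in_P n r) {1..d}"
    by (elim bexE)
  interpret holomorph_embedding n r d \<phi>
    by (rule holomorph_embedding.intro[OF assms(3,2) emb(1)])
  show "\<exists>\<phi> \<in> mon (P_group n r) (sym_group d).
      subgroup (\<phi> ` carrier (P_group n r)) (sym_group d) \<and>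
      \<phi> ` Q_in_P n r \<lhd> (sym_group d)\<lparr>carrier := \<phi> ` carrier (P_group n r)\<rparr> \<and>
      transitive_on (\<phi> ` Q_in_P n r) {1..d}"
    by (intro bexI[OF _ emb(1)] conjI subgroup_image_P normal_image emb(2))
next
  fix \<phi> assume emb: "\<phi> \<in> mon (P_group n r) (sym_group d)" "transitive_on (\<phi> ` Q_in_P n r) {1..d}"
  interpret transitive_holomorph_embedding n r d \<phi>
    by (intro transitive_holomorph_embedding.intro holomorph_embedding.intro
        transitive_holomorph_embedding_axioms.intro assms(2,3) emb)
  have FPP: "FPP d R.G = real (card fixed_point_free_autos) / real (card (auto (Q_group n r)))"
    unfolding FPP_def using fpp_limit by (rule limI)
  have "n \<noteq> 1" if "d mod 4 \<noteq> 2"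
  proof
    assume "n = 1"
    then have "d = 2 * r" using assms(2) by simp
    then show False using assms(3) that by presburger
  qed
  then have pos: "FPP d R.G > 0" if "d mod 4 \<noteq> 2"
    using that fixed_point_free_positive[OF assms(3)] FPP by simp
  have conv: "convergent (fpp_seq d R.G)" using fpp_limit by (rule convergentI)
  have eq: "FPP d R.G =
      real (card {A \<in> GL_F2 n. A - 1\<^sub>m n \<in> GL_F2 n}) / real (card (GL_F2 n)) *
      (\<Prod>p\<in>{p. prime p \<and> p dvd r}. (real p - 2) / (real p - 1))"
    unfolding FPP by (rule fixed_point_free_ratio[OF assms(3)])
  show "let G = GQP d (\<phi> ` Q_in_P n r) (\<phi> ` carrier (P_group n r)) in
       regular_branch d G \<and>
       hausdorff_dim d G = ereal (ln (real d) / ln (fact d)) \<and>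
       convergent (fpp_seq d G) \<and>
       FPP d G =
         real (card {A \<in> GL_F2 n. A - 1\<^sub>m n \<in> GL_F2 n}) / real (card (GL_F2 n)) *
         (\<Prod>p\<in>{p. prime p \<and> p dvd r}. (real p - 2) / (real p - 1)) \<and>
       (d mod 4 \<noteq> 2 \<longrightarrow> FPP d G > 0)"
    unfolding Let_def R.G_def[symmetric]
    by (intro conjI impI R.regular_branch_G R.hausdorff_dim_G assms(1) conv eq pos)
qed

end
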